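(* Let $U,W$ be superspaces with homogeneous bases $u_i$ ($i\in R_U$) and $w_j$ ($j\in R_W$), let $\lambda\vdash N$ and let $t$ be a standard $\lambda$-tableau. Then the family $\{P_t(I,J)\}$, where $I$ runs over all $t$-semistandard sequences of length $N$ with entries in $R_U$ and $J$ over all $t$-semistandard sequences of length $N$ with entries in $R_W$, is a basis of the component $U^\lambda\otimes W^\lambda$ of $S^N(U\otimes W)$. The same holds for the family $\{\tilde P_t(I,J)\}$.
   Context: Index conventions: $\mathbb M=\mathbb N\sqcup\bar{\mathbb N}$, elements of $\mathbb N$ called even (parity $0$), of $\bar{\mathbb N}$ odd (parity $1$), totally ordered so every element of $\mathbb N$ precedes every element of $\bar{\mathbb N}$, with the natural order inside each copy. If $\dim U=(k|l)$, $\dim W=(p|q)$, then $R_U=\{1,\dots,k,\bar1,\dots,\bar l\}$, $R_W=\{1,\dots,p,\bar1,\dots,\bar q\}$ and $p(u_i)=p(i)$, $p(w_j)=p(j)$. Tableaux: for a $\lambda$-tableau $t$ (cells filled bijectively with $1,\dots,N$), $R_t$ and $C_t$ are its row and column stabilizers in $\mathfrak S_N$, $\varepsilon$ is the sign character; $t$ is standard if entries increase along rows and down columns. A sequence $I=(i_1,\dots,i_N)$ with entries in $\mathbb M$ is placed into $t$ by writing $i_\alpha$ in the cell containing $\alpha$; $I$ is $t$-semistandard if the resulting entries weakly increase left to right along rows and downward along columns, even entries strictly increase down columns and odd entries strictly increase along rows. Signs: $\mathfrak S_N$ acts on sequences by permuting positions. For a sequence $I$ and $\sigma\in\mathfrak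 S_N$, $c(I,\sigma)\in\{\pm1\}$ is defined by $x_{\sigma^{-1}I}=c(I,\sigma)x_I$ in the free supercommutative algebra on generators $x_i$ of parity $p(i)$, where $x_I=x_{i_1}\cdots x_{i_N}$. Polynomials: $z_{ij}=u_i\otimes w_j\in U\otimes W$. For sequences $I$ (entries in $R_U$) and $J$ (entries in $R_W$) of length $N$, $\alpha(I,J)=\sum_{\alpha>\beta}p(i_\alpha)p(j_\beta)$ and $Z(I,J)=(-1)^{\alpha(I,J)}\prod_{\alpha=1}^N z_{i_\alpha j_\alpha}\in S^N(U\otimes W)$. Then $P_t(I,J)=\sum_{\sigma\in R_t,\tau\in C_t}\varepsilon(\tau)c(I,(\sigma\tau)^{-1})Z(\sigma\tau I,J)$ and $\tilde P_t(I,J)=\sum_{\sigma\in R_t,\tau\in C_t}\varepsilon(\tau)c(I,(\tau\sigma)^{-1})Z(\tau\sigma I,J)$. $U^\lambda\otimes W^\lambda$ is the isotypic summand of $S^N(U\otimes W)$ in the decomposition $S^\bullet(U\otimes W)=\bigoplus_\lambda U^\lambda\otimes W^\lambda$, where $U^\lambda$ (resp. $W^\lambda$) is the irreducible $\mathfrak{gl}(U)$- (resp. $\mathfrak{gl}(W)$-)module paired with the Specht module $S^\lambda$ under super Schur–Weyl duality. *)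

theory Defs
  imports "HOL-Combinatorics.Permutations" "HOL-Library.Multiset" "HOL-Library.Product_Lexorder"
begin

text \<open>An index is a pair (odd, n): (False, n) is the even index n, (True, n) is the odd
  index bar n.  The lexicographic order (False < True) puts all even indices before all odd
  ones, with the natural order inside each copy.\<close>

type_synonym idx = "bool \<times> nat"

definition par :: "idx \<Rightarrow> bool" where "par i = fst i"

text \<open>R for a superspace of dimension (k|l): {1..k} and {bar 1 .. bar l}.\<close>
definition RR :: "nat \<Rightarrow> nat \<Rightarrow> idx set" where
  "RR k l = {(False, n) | n. 1 \<le> n \<and> n \<le> k} \<union> {(True, n) | n. 1 \<le> n \<and> n \<le> l}"

definition seqs :: "idx set \<Rightarrow> nat \<Rightarrow> idx list set" where
  "seqs R N = {I. length I = N \<and> set I \<subseteq> R}"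

definition is_partition :: "nat list \<Rightarrow> nat \<Rightarrow> bool" where
  "is_partition lam N \<longleftrightarrow> sum_list lam = N \<and> sorted_wrt (\<ge>) lam \<and> 0 \<notin> set lam"

definition cells :: "nat list \<Rightarrow> (nat \<times> nat) set" where
  "cells lam = {(r, c). r < length lam \<and> c < lam ! r}"

definition is_tableau :: "nat list \<Rightarrow> nat \<Rightarrow> (nat \<times> nat \<Rightarrow> nat) \<Rightarrow> bool" where
  "is_tableau lam N t \<longleftrightarrow> bij_betw t (cells lam) {0..<N}"

definition standard_tableau :: "nat list \<Rightarrow> nat \<Rightarrow> (nat \<times> nat \<Rightarrow> nat) \<Rightarrow> bool" where
  "standard_tableau lam N t \<longleftrightarrow> is_tableau lam N t \<and>
     (\<forall>r c. (r, c) \<in> cells lam \<and> (r, Suc c) \<in> cells lam \<longrightarrow> t (r, c) < t (r, Suc c)) \<and>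
     (\<forall>r c. (r, c) \<in> cells lam \<and> (Suc r, c) \<in> cells lam \<longrightarrow> t (r, c) < t (Suc r, c))"

definition rowstab :: "nat list \<Rightarrow> nat \<Rightarrow> (nat \<times> nat \<Rightarrow> nat) \<Rightarrow> (nat \<Rightarrow> nat) set" where
  "rowstab lam N t = {\<sigma>. \<sigma> permutes {0..<N} \<and>
     (\<forall>x\<in>cells lam. \<exists>y\<in>cells lam. fst y = fst x \<and> \<sigma> (t x) = t y)}"

definition colstab :: "nat list \<Rightarrow> nat \<Rightarrow> (nat \<times> nat \<Rightarrow> nat) \<Rightarrow> (nat \<Rightarrow> nat) set" where
  "colstab lam N t = {\<sigma>. \<sigma> permutes {0..<N} \<and>
     (\<forall>x\<in>cells lam. \<exists>y\<in>cells lam. snd y = snd x \<and> \<sigma> (t x) = t y)}"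

definition semistd :: "nat list \<Rightarrow> (nat \<times> nat \<Rightarrow> nat) \<Rightarrow> idx list \<Rightarrow> bool" where
  "semistd lam t I \<longleftrightarrow>
     (\<forall>r c c'. (r, c) \<in> cells lam \<and> (r, c') \<in> cells lam \<and> c < c' \<longrightarrow>
        I ! t (r, c) \<le> I ! t (r, c') \<and>
        (par (I ! t (r, c)) \<and> par (I ! t (r, c')) \<longrightarrow> I ! t (r, c) < I ! t (r, c'))) \<and>
     (\<forall>r r' c. (r, c) \<in> cells lam \<and> (r', c) \<in> cells lam \<and> r < r' \<longrightarrow>
        I ! t (r, c) \<le> I ! t (r', c) \<and>
        (\<not> par (I ! t (r, c)) \<and> \<not> par (I ! t (r', c)) \<longrightarrow> I ! t (r, c) < I ! t (r', c)))"

text \<open>(act sigma I) ! (sigma a) = I ! a: the entry in position a moves to position sigma a.\<close>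
definition act :: "(nat \<Rightarrow> nat) \<Rightarrow> idx list \<Rightarrow> idx list" where
  "act \<sigma> I = map (\<lambda>b. I ! inv \<sigma> b) [0..<length I]"

text \<open>c(I,sigma): x_{sigma^{-1} I} = c(I,sigma) x_I in the free supercommutative algebra;
  x_{sigma^{-1} I} = prod_a x_{I!(sigma a)}, so c is (-1) to the number of inversions of sigma
  between positions carrying odd entries.\<close>
definition csign :: "idx list \<Rightarrow> (nat \<Rightarrow> nat) \<Rightarrow> 'a::comm_ring_1" where
  "csign I \<sigma> = (- 1) ^ card {(a, b). a < b \<and> b < length I \<and> \<sigma> b < \<sigma> a \<and>
                                    par (I ! \<sigma> a) \<and> par (I ! \<sigma> b)}"

text \<open>Generators z_{ij} = u_i \<otimes> w_j, indexed by (i,j), parity p(i)+p(j).  An element of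
  S(U \<otimes> W) is a coefficient function on monomials (multisets of generators in which each
  odd generator occurs at most once); a product of generators is rewritten to the
  monomial in increasing generator order, with the Koszul sign.\<close>

definition gpar :: "idx \<times> idx \<Rightarrow> bool" where "gpar g = (par (fst g) \<noteq> par (snd g))"

definition sprod :: "(idx \<times> idx) list \<Rightarrow> (idx \<times> idx) multiset \<Rightarrow> 'a::comm_ring_1" where
  "sprod gs = (if \<exists>a b. a < b \<and> b < length gs \<and> gs ! a = gs ! b \<and> gpar (gs ! a) then (\<lambda>m. 0)
     else (\<lambda>m. if m = mset gs then
        (- 1) ^ card {(a, b). a < b \<and> b < length gs \<and> gs ! b < gs ! a \<and> gpar (gs ! a) \<and> gpar (gs ! b)}
        else 0))"

definition alphaIJ :: "idx list \<Rightarrow> idx list \<Rightarrow> nat" where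
  "alphaIJ I J = card {(a, b). b < a \<and> a < length I \<and> par (I ! a) \<and> par (J ! b)}"

definition Z :: "idx list \<Rightarrow> idx list \<Rightarrow> (idx \<times> idx) multiset \<Rightarrow> 'a::comm_ring_1" where
  "Z I J = (\<lambda>m. (- 1) ^ alphaIJ I J * sprod (zip I J) m)"

definition Pt :: "nat list \<Rightarrow> nat \<Rightarrow> (nat \<times> nat \<Rightarrow> nat) \<Rightarrow> idx list \<Rightarrow> idx list
                   \<Rightarrow> (idx \<times> idx) multiset \<Rightarrow> 'a::comm_ring_1" where
  "Pt lam N t I J = (\<lambda>m. \<Sum>\<sigma>\<in>rowstab lam N t. \<Sum>\<tau>\<in>colstab lam N t.
      of_int (sign \<tau>) * csign I (inv (\<sigma> \<circ> \<tau>)) * Z (act (\<sigma> \<circ> \<tau>) I) J m)"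

definition Ptil :: "nat list \<Rightarrow> nat \<Rightarrow> (nat \<times> nat \<Rightarrow> nat) \<Rightarrow> idx list \<Rightarrow> idx list
                   \<Rightarrow> (idx \<times> idx) multiset \<Rightarrow> 'a::comm_ring_1" where
  "Ptil lam N t I J = (\<lambda>m. \<Sum>\<sigma>\<in>rowstab lam N t. \<Sum>\<tau>\<in>colstab lam N t.
      of_int (sign \<tau>) * csign I (inv (\<tau> \<circ> \<sigma>)) * Z (act (\<tau> \<circ> \<sigma>) I) J m)"

definition lspan :: "('g \<Rightarrow> 'a::field) set \<Rightarrow> ('g \<Rightarrow> 'a) set" where
  "lspan S = {(\<lambda>m. \<Sum>v\<in>F. c v * v m) | F c. finite F \<and> F \<subseteq> S}"

definition basis_family :: "('i \<Rightarrow> 'g \<Rightarrow> 'a::field) \<Rightarrow> 'i set \<Rightarrow> ('g \<Rightarrow> 'a) set \<Rightarrow> bool" where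
  "basis_family f A V \<longleftrightarrow> finite A \<and>
     (\<forall>c. (\<lambda>m. \<Sum>a\<in>A. c a * f a m) = (\<lambda>m. 0) \<longrightarrow> (\<forall>a\<in>A. c a = 0)) \<and>
     lspan (f ` A) = V"

text \<open>Tabloids: row-assignment functions on positions {0..<N}.\<close>
definition rowf :: "nat list \<Rightarrow> nat \<Rightarrow> (nat \<times> nat \<Rightarrow> nat) \<Rightarrow> nat \<Rightarrow> nat" where
  "rowf lam N t = (\<lambda>a. if a < N then fst (inv_into (cells lam) t a) else 0)"

text \<open>Permutation module M^lambda: (sigma f)(T) = f(sigma^{-1} T), sigma T = T o sigma^{-1}.\<close>
definition Mact :: "(nat \<Rightarrow> nat) \<Rightarrow> ((nat \<Rightarrow> nat) \<Rightarrow> 'a) \<Rightarrow> ((nat \<Rightarrow> nat) \<Rightarrow> 'a)" where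
  "Mact \<sigma> f = (\<lambda>T. f (T \<circ> \<sigma>))"

definition polytabloid :: "nat list \<Rightarrow> nat \<Rightarrow> (nat \<times> nat \<Rightarrow> nat) \<Rightarrow> (nat \<Rightarrow> nat) \<Rightarrow> 'a::comm_ring_1" where
  "polytabloid lam N t = (\<lambda>T. \<Sum>\<tau>\<in>colstab lam N t.
      if T = rowf lam N (\<tau> \<circ> t) then of_int (sign \<tau>) else 0)"

definition specht :: "nat list \<Rightarrow> nat \<Rightarrow> ((nat \<Rightarrow> nat) \<Rightarrow> 'a::field) set" where
  "specht lam N = lspan {polytabloid lam N t | t. is_tableau lam N t}"

text \<open>U^{\<otimes>N} for dim U = (k|l): coefficient functions on sequences u_I.  S_N acts with
  Koszul signs: sigma . u_I = c(I, sigma^{-1}) u_{sigma I}.\<close>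
definition tensp :: "nat \<Rightarrow> nat \<Rightarrow> nat \<Rightarrow> (idx list \<Rightarrow> 'a::zero) set" where
  "tensp k l N = {x. \<forall>I. x I \<noteq> 0 \<longrightarrow> I \<in> seqs (RR k l) N}"

definition tact :: "nat \<Rightarrow> (nat \<Rightarrow> nat) \<Rightarrow> (idx list \<Rightarrow> 'a::comm_ring_1) \<Rightarrow> (idx list \<Rightarrow> 'a)" where
  "tact N \<sigma> x = (\<lambda>I'. if length I' = N
      then csign (act (inv \<sigma>) I') (inv \<sigma>) * x (act (inv \<sigma>) I') else 0)"

definition equivariant :: "nat \<Rightarrow> nat \<Rightarrow> nat list \<Rightarrow> nat
     \<Rightarrow> (((nat \<Rightarrow> nat) \<Rightarrow> 'a::field) \<Rightarrow> (idx list \<Rightarrow> 'a)) \<Rightarrow> bool" where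
  "equivariant k l lam N \<phi> \<longleftrightarrow>
     (\<forall>v\<in>specht lam N. \<phi> v \<in> tensp k l N) \<and>
     (\<forall>v\<in>specht lam N. \<forall>w\<in>specht lam N. \<forall>a b.
        \<phi> (\<lambda>T. a * v T + b * w T) = (\<lambda>I. a * \<phi> v I + b * \<phi> w I)) \<and>
     (\<forall>\<sigma> v. \<sigma> permutes {0..<N} \<and> v \<in> specht lam N \<longrightarrow> \<phi> (Mact \<sigma> v) = tact N \<sigma> (\<phi> v))"

text \<open>The S^lambda-isotypic component of U^{\<otimes>N}: sum of images of all S_N-module maps
  S^lambda \<rightarrow> U^{\<otimes>N}.  By super Schur-Weyl duality it is U^lambda \<otimes> S^lambda.\<close>
definition isotypic :: "nat \<Rightarrow> nat \<Rightarrow> nat list \<Rightarrow> nat \<Rightarrow> (idx list \<Rightarrow> 'a::field) set" where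
  "isotypic k l lam N = lspan (\<Union> {\<phi> ` specht lam N | \<phi>. equivariant k l lam N \<phi>})"

text \<open>Multiplication U^{\<otimes>N} \<otimes> W^{\<otimes>N} \<rightarrow> S^N(U \<otimes> W), u_I \<otimes> w_J \<mapsto> Z(I,J).\<close>
definition mmap :: "nat \<Rightarrow> nat \<Rightarrow> nat \<Rightarrow> (idx list \<Rightarrow> 'a::field) \<Rightarrow> idx list
                     \<Rightarrow> (idx \<times> idx) multiset \<Rightarrow> 'a" where
  "mmap k l N x J = (\<lambda>m. \<Sum>I\<in>seqs (RR k l) N. x I * Z I J m)"

text \<open>U^lambda \<otimes> W^lambda \<subseteq> S^N(U \<otimes> W): image of (U^lambda \<otimes> S^lambda) \<otimes> W^{\<otimes>N}.\<close>
definition component :: "nat \<Rightarrow> nat \<Rightarrow> nat \<Rightarrow> nat \<Rightarrow> nat list \<Rightarrow> nat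
                          \<Rightarrow> ((idx \<times> idx) multiset \<Rightarrow> 'a::field) set" where
  "component k l p q lam N =
     lspan {mmap k l N x J | x J. x \<in> isotypic k l lam N \<and> J \<in> seqs (RR p q) N}"

end

theory Submission
  imports Defs "HOL-Library.Function_Algebras" "HOL.Vector_Spaces"
begin

text \<open>
  Let \<open>E\<close> be the Young symmetrizer of \<open>t\<close> (the row symmetrizer times the column antisymmetrizer, in
  either order) and \<open>E\<^sup>*\<close> its image under inversion of permutations, which is the product in the other
  order.  With the Koszul signs, \<open>P\<^sub>t(I, J)\<close> is the image of \<open>E u\<^sub>I \<otimes> w\<^sub>J\<close> under the multiplication map
  to \<open>S\<^sup>N(U \<otimes> W)\<close>, and that map is the projection to the coinvariants of the symmetric group.
  The vectors \<open>E u\<^sub>I\<close> with \<open>I\<close> semistandard form a basis of the image of \<open>E\<close>: they span by Garnir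
  straightening, and they are independent because their matrix is triangular for the weighted sum of
  the entries.  Von Neumann's lemma gives \<open>E \<pi> E = h e(\<pi>\<^sup>-\<^sup>1) E\<close> with \<open>e\<close> the coefficients of \<open>E\<close> and
  \<open>h \<noteq> 0\<close>.  Hence the multiplication map sends \<open>E a \<otimes> b\<close> to a multiple of the image of
  \<open>E a \<otimes> E\<^sup>* b\<close>, which gives spanning; and applying \<open>E\<close> to the average of a relation between the
  \<open>E u\<^sub>I \<otimes> w\<^sub>J\<close> turns it into a relation between the \<open>E u\<^sub>I \<otimes> E\<^sup>* w\<^sub>J\<close>, which gives independence.
  Finally, the polytabloid of \<open>t\<close> generates the Specht module and is an eigenvector of \<open>E\<^sup>*\<close> for
  the eigenvalue \<open>h\<close>, so the isotypic component is spanned by the \<open>\<pi> E\<^sup>* v\<close>.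
\<close>

section \<open>Koszul signs\<close>

text \<open>The multiplication map identifies tensors that agree modulo the diagonal action, so
  independence of the \<open>E u_I \<otimes> w_J\<close> does not pass through it by itself. What
  survives is the average of the \<open>\<pi> E u_I \<otimes> \<pi> w_J\<close>. Applying
  \<open>E\<close> to its left factor replaces \<open>E \<pi> E u_I\<close> by
  \<open>h e(inv \<pi>) E u_I\<close>, and the remaining sum of the
  \<open>e(inv \<pi>) \<pi> w_J\<close> is \<open>E\<^sup>* w_J\<close>: the average decouples into
  a tensor of two independent families. The constant \<open>h\<close> is the coefficient of the
  identity in \<open>E E\<close>. Classically it is the product of the hook lengths; here it is only
  shown to be positive, which allows division by it in characteristic zero. A Young diagram enters
  as two coordinate functions and a flag, so that the two families of the theorem are two instances
  of one result.\<close>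

definition pairs :: "nat \<Rightarrow> (nat \<times> nat) set" where
  "pairs n = {(a, b). a < b \<and> b < n}"

lemma finite_pairs [simp]: "finite (pairs n)"
  by (rule finite_subset[of _ "{..<n} \<times> {..<n}"]) (auto simp: pairs_def)

text \<open>Signs given as powers of cardinalities become products over pairs of positions, which
  can be multiplied and reindexed factor by factor.\<close>

lemma minus_one_power_card:
  assumes "finite A"
  shows "(- 1 :: 'a::comm_ring_1) ^ card {z \<in> A. P z} = (\<Prod>z\<in>A. if P z then - 1 else 1)"
proof -
  have "{z \<in> A. P z} = A \<inter> {z. P z}" by auto
  then show ?thesis using assms by (simp add: prod.If_cases)
qed

text \<open>A permutation of the positions permutes the unordered pairs, and a symmetric
  \<open>f\<close> sees only those. The map \<open>g\<close> below puts the image of a pair back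
  into increasing order.\<close>

lemma prod_pairs_permute:
  fixes f :: "nat \<Rightarrow> nat \<Rightarrow> 'a::comm_monoid_mult"
  assumes \<tau>: "\<tau> permutes {..<n}" and sym: "\<And>a b. f a b = f b a"
  shows "(\<Prod>(a, b)\<in>pairs n. f (\<tau> a) (\<tau> b)) = (\<Prod>(a, b)\<in>pairs n. f a b)"
proof -
  define g where "g \<rho> z = (min (\<rho> (fst z)) (\<rho> (snd z)), max (\<rho> (fst z)) (\<rho> (snd z)))"
    for \<rho> :: "nat \<Rightarrow> nat" and z
  have g_in: "g \<rho> z \<in> pairs n" if "\<rho> permutes {..<n}" "z \<in> pairs n" for \<rho> z
  proof -
    have "fst z < snd z" "snd z < n" using that by (auto simp: pairs_def)
    then have "\<rho> (fst z) < n" "\<rho> (snd z) < n" "\<rho> (fst z) \<noteq> \<rho> (snd z)"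
      using permutes_in_image[OF that(1)] inj_eq[OF permutes_inj[OF that(1)]] by simp_all
    then show ?thesis by (simp add: pairs_def g_def min_def max_def)
  qed
  have g_inv: "g (inv \<rho>) (g \<rho> z) = z" if "\<rho> permutes {..<n}" "z \<in> pairs n" for \<rho> z
    using that permutes_inverses[OF that(1)]
    by (auto simp: pairs_def g_def min_def max_def)
  have "(\<Prod>z\<in>pairs n. f (\<tau> (fst z)) (\<tau> (snd z))) = (\<Prod>z\<in>pairs n. f (fst z) (snd z))"
  proof (rule prod.reindex_bij_witness[where i = "g (inv \<tau>)" and j = "g \<tau>"])
    fix z assume "z \<in> pairs n"
    then show "g (inv \<tau>) (g \<tau> z) = z" "g \<tau> z \<in> pairs n" "g (inv \<tau>) z \<in> pairs n"
      using g_inv g_in \<tau> permutes_inv by blast+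
    show "g \<tau> (g (inv \<tau>) z) = z"
      using g_inv[OF permutes_inv[OF \<tau>] \<open>z \<in> pairs n\<close>] permutes_inv_inv[OF \<tau>] by simp
    show "f (fst (g \<tau> z)) (snd (g \<tau> z)) = f (\<tau> (fst z)) (\<tau> (snd z))"
      by (simp add: g_def min_def max_def sym[of "\<tau> (snd z)"])
  qed
  then show ?thesis by (simp add: case_prod_unfold)
qed

lemma csign_prod:
  "csign I \<sigma> = (\<Prod>(a, b)\<in>pairs (length I).
     if \<sigma> b < \<sigma> a \<and> par (I ! \<sigma> a) \<and> par (I ! \<sigma> b) then - 1 else 1)"
proof -
  have "{(a, b). a < b \<and> b < length I \<and> \<sigma> b < \<sigma> a \<and> par (I ! \<sigma> a) \<and> par (I ! \<sigma> b)}
      = {z \<in> pairs (length I). case z of (a, b) \<Rightarrow> \<sigma> b < \<sigma> a \<and> par (I ! \<sigma> a) \<and> par (I ! \<sigma> b)}"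
    by (auto simp: pairs_def)
  then show ?thesis
    unfolding csign_def by (simp add: minus_one_power_card case_prod_unfold)
qed

lemma csign_cases: "csign I \<sigma> = (1 :: 'a::comm_ring_1) \<or> csign I \<sigma> = (- 1 :: 'a)"
  unfolding csign_def by (simp only: minus_one_power_iff) simp

lemma csign_square [simp]: "csign I \<sigma> * csign I \<sigma> = (1 :: 'a::comm_ring_1)"
  using csign_cases[of I \<sigma>, where 'a = 'a] by auto

lemma csign_left_square [simp]: "csign I \<sigma> * (csign I \<sigma> * c) = (c :: 'a::comm_ring_1)"
  by (metis csign_square mult.assoc mult_1)

lemma csign_id [simp]: "csign I id = 1"
proof -
  have "{(a, b). a < b \<and> b < length I \<and> b < a \<and> par (I ! a) \<and> par (I ! b)} = {}" by auto
  then show ?thesis unfolding csign_def id_apply by (simp only: card.empty power_0)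
qed

text \<open>Cocycle rule: \<open>\<sigma> \<circ> \<tau>\<close> reverses a pair exactly when one,
  but not both, of \<open>\<tau>\<close> on the pair and \<open>\<sigma>\<close> on its image
  reverses the order.\<close>

lemma csign_compose:
  assumes "\<sigma> permutes {..<length I}" "\<tau> permutes {..<length I}"
  shows "csign I (\<sigma> \<circ> \<tau>) = (csign I \<sigma> * csign (permute_list \<sigma> I) \<tau> :: 'a::comm_ring_1)"
proof -
  let ?n = "length I"
  \<comment> \<open>The factor of \<open>\<sigma>\<close> at a pair, written symmetrically in
    \<open>a\<close> and \<open>b\<close> so that it can be evaluated at \<open>\<tau> a\<close> and
    \<open>\<tau> b\<close> in whichever order they come.\<close>
  define f where "f a b = (if (a < b) \<noteq> (\<sigma> a < \<sigma> b) \<and> a \<noteq> b \<and> par (I ! \<sigma> a) \<and> par (I ! \<sigma> b)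
      then - 1 else (1 :: 'a))" for a b
  have inj: "\<sigma> a = \<sigma> b \<longleftrightarrow> a = b" "\<tau> a = \<tau> b \<longleftrightarrow> a = b" for a b
    by (rule inj_eq[OF permutes_inj[OF assms(1)]] inj_eq[OF permutes_inj[OF assms(2)]])+
  have lt: "a < ?n \<Longrightarrow> \<tau> a < ?n" for a
    using permutes_in_image[OF assms(2)] by auto
  have "csign I \<sigma> = (\<Prod>(a, b)\<in>pairs ?n. f a b)"
    unfolding csign_prod
    by (rule prod.cong) (auto simp: f_def pairs_def not_less_iff_gr_or_eq inj)
  also have "\<dots> = (\<Prod>(a, b)\<in>pairs ?n. f (\<tau> a) (\<tau> b))"
    by (rule prod_pairs_permute[symmetric]) (use assms inj in \<open>auto simp: f_def not_less_iff_gr_or_eq\<close>)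
  finally have 1: "csign I \<sigma> = (\<Prod>(a, b)\<in>pairs ?n. f (\<tau> a) (\<tau> b))" .
  have "csign I \<sigma> * csign (permute_list \<sigma> I) \<tau>
      = (\<Prod>(a, b)\<in>pairs ?n. f (\<tau> a) (\<tau> b) *
          (if \<tau> b < \<tau> a \<and> par (I ! \<sigma> (\<tau> a)) \<and> par (I ! \<sigma> (\<tau> b)) then - 1 else 1))"
    unfolding 1 csign_prod[of "permute_list \<sigma> I"] prod.distrib[symmetric] length_permute_list
    by (rule prod.cong) (auto simp: pairs_def permute_list_nth[OF assms(1)] lt)
  also have "\<dots> = csign I (\<sigma> \<circ> \<tau>)"
    unfolding csign_prod
    by (rule prod.cong) (auto simp: f_def pairs_def not_less_iff_gr_or_eq inj)
  finally show ?thesis by simp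
qed

text \<open>For odd entries the inversions are the pair \<open>(p, q)\<close> itself and two for
  each odd position strictly between, an odd number in total.\<close>

lemma csign_transpose:
  assumes "p < q" "q < length I" "I ! p = I ! q"
  shows "csign I (Transposition.transpose p q) = (if par (I ! p) then - 1 else (1 :: 'a::comm_ring_1))"
proof (cases "par (I ! p)")
  case True
  define M where "M = {c. p < c \<and> c < q \<and> par (I ! c)}"
  have [simp]: "finite M" by (rule finite_subset[of _ "{..<q}"]) (auto simp: M_def)
  let ?t = "Transposition.transpose p q"
  have "{(a, b). a < b \<and> b < length I \<and> ?t b < ?t a \<and> par (I ! ?t a) \<and> par (I ! ?t b)}
     = insert (p, q) (Pair p ` M \<union> (\<lambda>c. (c, q)) ` M)"
    using assms True by (auto simp: M_def Transposition.transpose_def split: if_splits)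
  moreover have "card (insert (p, q) (Pair p ` M \<union> (\<lambda>c. (c, q)) ` M)) = Suc (2 * card M)"
    by (subst card_insert_disjoint, (auto simp: M_def)[2], subst card_Un_disjoint)
      (auto simp: card_image inj_on_def M_def)
  ultimately show ?thesis
    unfolding csign_def using True by simp
next
  case False
  let ?t = "Transposition.transpose p q"
  have "{(a, b). a < b \<and> b < length I \<and> ?t b < ?t a \<and> par (I ! ?t a) \<and> par (I ! ?t b)} = {}"
    using assms False by (auto simp: Transposition.transpose_def split: if_splits)
  then show ?thesis unfolding csign_def using False by (simp only: card.empty) simp
qed

lemma csign_transpose':
  assumes "p \<noteq> q" "p < length I" "q < length I" "I ! p = I ! q"
  shows "csign I (Transposition.transpose p q) = (if par (I ! p) then - 1 else (1 :: 'a::comm_ring_1))"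
  using assms csign_transpose[of p q I] csign_transpose[of q p I] transpose_commute[of p q]
  by (cases p q rule: linorder_cases) auto

lemma permute_list_transpose:
  assumes "p < length I" "q < length I" "I ! p = I ! q"
  shows "permute_list (Transposition.transpose p q) I = I"
  using assms by (intro nth_equalityI) (auto simp: permute_list_def Transposition.transpose_def)

text \<open>Symmetric in the two positions, unlike the ordered condition in \<open>sprod\<close>,
  and hence visibly stable under permutations.\<close>

definition repeats_odd :: "(idx \<times> idx) list \<Rightarrow> bool" where
  "repeats_odd gs \<longleftrightarrow> (\<exists>a b. a < length gs \<and> b < length gs \<and> a \<noteq> b \<and> gs ! a = gs ! b \<and> gpar (gs ! a))"

lemma repeats_oddI:
  "a < length gs \<Longrightarrow> b < length gs \<Longrightarrow> a \<noteq> b \<Longrightarrow> gs ! a = gs ! b \<Longrightarrow> gpar (gs ! a) \<Longrightarrow> repeats_odd gs"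
  unfolding repeats_odd_def by blast

lemma sprod_eq:
  "sprod gs m = (if repeats_odd gs \<or> m \<noteq> mset gs then 0 else
     (\<Prod>(a, b)\<in>pairs (length gs). if gs ! b < gs ! a \<and> gpar (gs ! a) \<and> gpar (gs ! b) then - 1 else 1))"
proof -
  have 1: "(\<exists>a b. a < b \<and> b < length gs \<and> gs ! a = gs ! b \<and> gpar (gs ! a)) \<longleftrightarrow> repeats_odd gs"
  proof
    assume "\<exists>a b. a < b \<and> b < length gs \<and> gs ! a = gs ! b \<and> gpar (gs ! a)"
    then obtain a b where "a < b" "b < length gs" "gs ! a = gs ! b" "gpar (gs ! a)"
      by blast
    then show "repeats_odd gs"
      by (intro repeats_oddI[of a _ b]) simp_all
  next
    assume "repeats_odd gs"
    then obtain a b where "a < length gs" "b < length gs" "a \<noteq> b" "gs ! a = gs ! b" "gpar (gs ! a)"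
      unfolding repeats_odd_def by blast
    then show "\<exists>a b. a < b \<and> b < length gs \<and> gs ! a = gs ! b \<and> gpar (gs ! a)"
      by (cases "a < b") ((rule exI[of _ a], rule exI[of _ b], simp), (rule exI[of _ b], rule exI[of _ a], simp))
  qed
  have 2: "{(a, b). a < b \<and> b < length gs \<and> gs ! b < gs ! a \<and> gpar (gs ! a) \<and> gpar (gs ! b)}
     = {z \<in> pairs (length gs). case z of (a, b) \<Rightarrow> gs ! b < gs ! a \<and> gpar (gs ! a) \<and> gpar (gs ! b)}"
    by (auto simp: pairs_def)
  show ?thesis
    unfolding sprod_def 1 2 minus_one_power_card[OF finite_pairs]
    by (cases "repeats_odd gs"; cases "m = mset gs") (simp_all only: if_True if_False simp_thms case_prod_unfold)
qed

text \<open>What a pair of positions contributes to the sign of \<open>Z\<close>: the share of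
  \<open>alphaIJ\<close> from moving an odd entry of \<open>I\<close> past an earlier odd entry of
  \<open>J\<close>, and the Koszul sign for sorting the two generators.\<close>

definition zsign :: "idx \<Rightarrow> idx \<Rightarrow> idx \<Rightarrow> idx \<Rightarrow> 'a::comm_ring_1" where
  "zsign i j i' j' = (if par i' \<and> par j then - 1 else 1) *
     (if (i', j') < (i, j) \<and> gpar (i, j) \<and> gpar (i', j') then - 1 else 1)"

text \<open>Different generators are strictly ordered in exactly one direction, and equal ones are
  even here, so that they give no sorting sign. What is left is an identity in the four
  parities.\<close>

lemma zsign_swap:
  assumes "\<not> ((i, j) = (i', j') \<and> gpar (i, j))"
  shows "(zsign i j i' j' :: 'a::comm_ring_1) = (if par i \<and> par i' then - 1 else 1) *
     (if par j \<and> par j' then - 1 else 1) * zsign i' j' i j"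
proof -
  have bool: "(if c \<and> b then - 1 else 1) * (if L \<and> a \<noteq> b \<and> c \<noteq> e then - 1 else 1)
      = (if a \<and> c then - 1 else 1) * (if b \<and> e then - 1 else 1) *
        ((if a \<and> e then - 1 else 1) * (if M \<and> c \<noteq> e \<and> a \<noteq> b then - 1 else (1 :: 'a)))"
    if "L \<noteq> M \<or> (a = c \<and> b = e \<and> a = b)" for a b c e L M
    using that by (cases a; cases b; cases c; cases e; cases L; cases M) auto
  have "((i', j') < (i, j)) \<noteq> ((i, j) < (i', j')) \<or> (par i = par i' \<and> par j = par j' \<and> par i = par j)"
  proof (cases "(i, j) = (i', j')")
    case True
    then show ?thesis using assms unfolding gpar_def by auto
  next
    case False
    then show ?thesis by (metis neq_iff less_not_sym)
  qed
  then show ?thesis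
    unfolding zsign_def gpar_def fst_conv snd_conv by (rule bool)
qed

lemma Z_eq:
  assumes "length I = N" "length J = N"
  shows "Z I J m = (if repeats_odd (zip I J) \<or> m \<noteq> mset (zip I J) then 0 else
     (\<Prod>(a, b)\<in>pairs N. zsign (I ! a) (J ! a) (I ! b) (J ! b)))"
proof -
  have "{(a, b). b < a \<and> a < length I \<and> par (I ! a) \<and> par (J ! b)}
      = prod.swap ` {z \<in> pairs N. case z of (a, b) \<Rightarrow> par (I ! b) \<and> par (J ! a)}"
    using assms by (auto simp: pairs_def image_iff)
  then have 1: "(- 1) ^ alphaIJ I J
      = (\<Prod>(a, b)\<in>pairs N. if par (I ! b) \<and> par (J ! a) then - 1 else (1 :: 'a))"
    unfolding alphaIJ_def
    by (simp only: card_image[OF inj_swap] minus_one_power_card finite_pairs)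
       (simp only: case_prod_unfold)
  have 2: "(\<Prod>(a, b)\<in>pairs N. if zip I J ! b < zip I J ! a \<and> gpar (zip I J ! a) \<and> gpar (zip I J ! b) then - 1 else (1 :: 'a))
     = (\<Prod>(a, b)\<in>pairs N. if (I ! b, J ! b) < (I ! a, J ! a) \<and> gpar (I ! a, J ! a) \<and> gpar (I ! b, J ! b) then - 1 else 1)"
    by (rule prod.cong) (use assms in \<open>auto simp: pairs_def\<close>)
  have "length (zip I J) = N" using assms by simp
  then have "Z I J m = (if repeats_odd (zip I J) \<or> m \<noteq> mset (zip I J) then 0 else
    (\<Prod>(a, b)\<in>pairs N. if par (I ! b) \<and> par (J ! a) then - 1 else (1 :: 'a)) *
    (\<Prod>(a, b)\<in>pairs N. if (I ! b, J ! b) < (I ! a, J ! a) \<and> gpar (I ! a, J ! a) \<and> gpar (I ! b, J ! b) then - 1 else 1))"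
    unfolding Z_def sprod_eq 1 by (simp only: 2 mult_zero_right if_distrib[of "(*) _"] cong: if_cong)
  then show ?thesis
    unfolding zsign_def prod.distrib[symmetric] by (simp only: case_prod_unfold)
qed

text \<open>The reason for the sign \<open>alphaIJ\<close>: with it \<open>Z\<close> is invariant
  under the diagonal signed action on pairs of sequences. By \<open>zsign_swap\<close>, a pair of
  positions that \<open>\<rho>\<close> reverses contributes exactly its factors in the two Koszul
  signs.\<close>

lemma Z_permute:
  assumes I: "length I = N" and J: "length J = N" and \<rho>: "\<rho> permutes {..<N}"
  shows "Z (permute_list \<rho> I) (permute_list \<rho> J) m
       = (csign I \<rho> * csign J \<rho> * Z I J m :: 'a::comm_ring_1)"
proof -
  let ?g = "zip I J"
  have lt: "\<rho> a < N \<longleftrightarrow> a < N" for a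
    using permutes_in_image[OF \<rho>] by auto
  have inj: "\<rho> a = \<rho> b \<longleftrightarrow> a = b" for a b
    by (rule inj_eq[OF permutes_inj[OF \<rho>]])
  have zp: "zip (permute_list \<rho> I) (permute_list \<rho> J) = permute_list \<rho> ?g"
    by (rule permute_list_zip[symmetric]) (use assms in auto)
  have lg: "length ?g = N" using I J by simp
  have pg: "permute_list \<rho> ?g ! a = ?g ! \<rho> a" if "a < N" for a
    by (rule permute_list_nth) (use that lg \<rho> in auto)
  have mset: "mset (permute_list \<rho> ?g) = mset ?g"
    by (rule mset_permute_list) (use lg \<rho> in auto)
  have bad_perm: "repeats_odd (permute_list \<rho> ?g) \<longleftrightarrow> repeats_odd ?g"
  proof
    assume "repeats_odd (permute_list \<rho> ?g)"
    then obtain a b where "a < N" "b < N" "a \<noteq> b" "?g ! \<rho> a = ?g ! \<rho> b" "gpar (?g ! \<rho> a)"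
      unfolding repeats_odd_def length_permute_list lg using pg by auto
    then show "repeats_odd ?g"
      by (intro repeats_oddI[of "\<rho> a" _ "\<rho> b"]) (simp_all add: lt inj I J)
  next
    assume "repeats_odd ?g"
    then obtain a b where ab: "a < N" "b < N" "a \<noteq> b" "?g ! a = ?g ! b" "gpar (?g ! a)"
      unfolding repeats_odd_def lg by blast
    let ?a = "inv \<rho> a" and ?b = "inv \<rho> b"
    have "\<rho> ?a = a" "\<rho> ?b = b" using permutes_inverses[OF \<rho>] by auto
    moreover from this have "?a < N" "?b < N" "?a \<noteq> ?b" using lt[of ?a] lt[of ?b] ab by auto
    ultimately show "repeats_odd (permute_list \<rho> ?g)"
      using ab by (intro repeats_oddI[of ?a _ ?b]) (simp_all add: pg I J)
  qed
  show ?thesis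
  proof (cases "repeats_odd ?g \<or> m \<noteq> mset ?g")
    case True
    then have "Z (permute_list \<rho> I) (permute_list \<rho> J) m = (0 :: 'a)" "Z I J m = (0 :: 'a)"
      using I J bad_perm mset by (subst Z_eq[of _ N]; simp add: zp)+
    then show ?thesis by simp
  next
    case False
    \<comment> \<open>\<open>zsign\<close> extended symmetrically to pairs in either order, as
      \<open>prod_pairs_permute\<close> demands.\<close>
    define f :: "nat \<Rightarrow> nat \<Rightarrow> 'a" where "f a b = (if a < b then zsign (I ! a) (J ! a) (I ! b) (J ! b)
       else if b < a then zsign (I ! b) (J ! b) (I ! a) (J ! a) else 1)" for a b
    have "Z (permute_list \<rho> I) (permute_list \<rho> J) m = (\<Prod>(a, b)\<in>pairs N.
          zsign (permute_list \<rho> I ! a) (permute_list \<rho> J ! a) (permute_list \<rho> I ! b) (permute_list \<rho> J ! b) :: 'a)"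
      using False bad_perm mset I J by (subst Z_eq[of _ N]) (simp_all add: zp)
    also have "\<dots> = (\<Prod>(a, b)\<in>pairs N.
         (if \<rho> b < \<rho> a \<and> par (I ! \<rho> a) \<and> par (I ! \<rho> b) then - 1 else 1) *
         (if \<rho> b < \<rho> a \<and> par (J ! \<rho> a) \<and> par (J ! \<rho> b) then - 1 else 1) * f (\<rho> a) (\<rho> b))"
    proof (rule prod.cong[OF refl], clarify)
      fix a b assume "(a, b) \<in> pairs N"
      then have ab: "a < b" "a < N" "b < N" by (auto simp: pairs_def)
      have nb: "\<not> ((I ! \<rho> a, J ! \<rho> a) = (I ! \<rho> b, J ! \<rho> b) \<and> gpar (I ! \<rho> a, J ! \<rho> a))"
      proof
        assume "(I ! \<rho> a, J ! \<rho> a) = (I ! \<rho> b, J ! \<rho> b) \<and> gpar (I ! \<rho> a, J ! \<rho> a)"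
        then have "repeats_odd ?g" using ab I J
          by (intro repeats_oddI[of "\<rho> a" _ "\<rho> b"]) (auto simp: lt inj I J)
        with False show False by simp
      qed
      have nth: "permute_list \<rho> I ! a = I ! \<rho> a" "permute_list \<rho> J ! a = J ! \<rho> a"
        "permute_list \<rho> I ! b = I ! \<rho> b" "permute_list \<rho> J ! b = J ! \<rho> b"
        using ab I J \<rho> by (simp_all add: permute_list_nth)
      have "\<rho> a \<noteq> \<rho> b" using inj ab by auto
      then consider "\<rho> a < \<rho> b" | "\<rho> b < \<rho> a" by linarith
      then show "zsign (permute_list \<rho> I ! a) (permute_list \<rho> J ! a) (permute_list \<rho> I ! b) (permute_list \<rho> J ! b) =
         (if \<rho> b < \<rho> a \<and> par (I ! \<rho> a) \<and> par (I ! \<rho> b) then - 1 else 1) *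
         (if \<rho> b < \<rho> a \<and> par (J ! \<rho> a) \<and> par (J ! \<rho> b) then - 1 else 1) * f (\<rho> a) (\<rho> b)"
      proof cases
        case 1
        then show ?thesis unfolding nth f_def by simp
      next
        case 2
        then have "f (\<rho> a) (\<rho> b) = zsign (I ! \<rho> b) (J ! \<rho> b) (I ! \<rho> a) (J ! \<rho> a)"
          unfolding f_def by simp
        then show ?thesis using 2 zsign_swap[OF nb, where 'a = 'a] unfolding nth by simp
      qed
    qed
    also have "\<dots> = csign I \<rho> * csign J \<rho> * (\<Prod>(a, b)\<in>pairs N. f (\<rho> a) (\<rho> b))"
      unfolding csign_prod I J prod.distrib[symmetric] by (simp add: case_prod_unfold)
    also have "(\<Prod>(a, b)\<in>pairs N. f (\<rho> a) (\<rho> b)) = (\<Prod>(a, b)\<in>pairs N. f a b)"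
      by (rule prod_pairs_permute[OF \<rho>]) (auto simp: f_def)
    also have "\<dots> = (\<Prod>(a, b)\<in>pairs N. zsign (I ! a) (J ! a) (I ! b) (J ! b))"
      by (rule prod.cong) (auto simp: f_def pairs_def)
    also have "\<dots> = Z I J m" using False I J by (subst Z_eq[of _ N]) auto
    finally show ?thesis .
  qed
qed


section \<open>Functions as vectors and the signed action of permutations\<close>

definition sc :: "'a::times \<Rightarrow> ('g \<Rightarrow> 'a) \<Rightarrow> 'g \<Rightarrow> 'a" where
  "sc c v = (\<lambda>g. c * v g)"

lemma sc_apply: "sc c v g = c * v g"
  by (simp add: sc_def)

lemma sum_fun_apply: "(\<Sum>a\<in>A. f a) g = (\<Sum>a\<in>A. f a g)"
  by (induction A rule: infinite_finite_induct) auto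

text \<open>As simplification rules these would rewrite every unapplied vector to a lambda abstraction.\<close>

declare plus_fun_apply [simp del] zero_fun_apply [simp del] times_fun_apply [simp del] one_fun_apply [simp del]

lemmas pointwise = sc_apply sum_fun_apply plus_fun_apply zero_fun_apply

interpretation fv: vector_space "sc :: 'a::field \<Rightarrow> ('g \<Rightarrow> 'a) \<Rightarrow> 'g \<Rightarrow> 'a"
  by unfold_locales (auto simp: fun_eq_iff pointwise algebra_simps)

lemma lspan_eq_span: "lspan S = fv.span S"
  unfolding lspan_def fv.span_explicit by (simp add: fun_eq_iff pointwise) 

section \<open>Stabilizers of functions on positions, and their characters\<close>

abbreviation Sym :: "nat \<Rightarrow> (nat \<Rightarrow> nat) set" where
  "Sym N \<equiv> {\<pi>. \<pi> permutes {..<N}}"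

lemma Sym_comp: "\<sigma> \<in> Sym N \<Longrightarrow> \<tau> \<in> Sym N \<Longrightarrow> \<sigma> \<circ> \<tau> \<in> Sym N"
  by (simp add: permutes_compose)

lemma Sym_inv: "\<sigma> \<in> Sym N \<Longrightarrow> inv \<sigma> \<in> Sym N"
  by (simp add: permutes_inv)

lemma finite_Sym [simp]: "finite (Sym N)"
  by (simp add: finite_permutations)

text \<open>Row stabilizers, column stabilizers, Garnir groups and the full symmetric group
  (constant \<open>f\<close>) all have this form, so reindexing and generation by transpositions are
  proved once.\<close>

definition stab :: "nat \<Rightarrow> (nat \<Rightarrow> 'b) \<Rightarrow> (nat \<Rightarrow> nat) set" where
  "stab N f = {\<sigma>. \<sigma> permutes {..<N} \<and> (\<forall>a<N. f (\<sigma> a) = f a)}"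

lemma stab_Sym: "\<sigma> \<in> stab N f \<Longrightarrow> \<sigma> permutes {..<N}"
  by (simp add: stab_def)

lemma stab_apply: "\<sigma> \<in> stab N f \<Longrightarrow> a < N \<Longrightarrow> f (\<sigma> a) = f a"
  by (simp add: stab_def)

lemma finite_stab [simp]: "finite (stab N f)"
  by (rule finite_subset[OF _ finite_Sym[of N]]) (auto simp: stab_def)

lemma permutes_lt: "\<sigma> permutes {..<N} \<Longrightarrow> \<sigma> a < N \<longleftrightarrow> a < N"
  using permutes_in_image[of \<sigma> "{..<N}" a] by simp

lemma stab_id [simp]: "id \<in> stab N f"
  by (simp add: stab_def)

lemma stab_comp: "\<sigma> \<in> stab N f \<Longrightarrow> \<tau> \<in> stab N f \<Longrightarrow> \<sigma> \<circ> \<tau> \<in> stab N f"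
  by (simp add: stab_def permutes_compose permutes_lt)

lemma stab_inv:
  assumes "\<sigma> \<in> stab N f" shows "inv \<sigma> \<in> stab N f"
proof -
  have \<sigma>: "\<sigma> permutes {..<N}" using assms by (rule stab_Sym)
  have "f (inv \<sigma> a) = f a" if "a < N" for a
    using stab_apply[OF assms, of "inv \<sigma> a"] that permutes_lt[OF permutes_inv[OF \<sigma>]]
      permutes_inverses(1)[OF \<sigma>] by simp
  then show ?thesis using \<sigma> by (simp add: stab_def permutes_inv)
qed

lemma stab_transpose:
  assumes "a < N" "b < N" "f a = f b"
  shows "Transposition.transpose a b \<in> stab N f"
  using assms by (simp add: stab_def permutes_swap_id Transposition.transpose_def)

text \<open>Generation by transpositions: composing on the left with the transposition of
  \<open>a\<close> and \<open>\<sigma> a\<close> fixes \<open>a\<close> and keeps the old fixed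
  points, so the number of moved points drops.\<close>

lemma stab_induct [consumes 1, case_names id swap]:
  assumes "\<sigma> \<in> stab N f" "P id"
    and "\<And>a b \<rho>. a < N \<Longrightarrow> b < N \<Longrightarrow> a \<noteq> b \<Longrightarrow> f a = f b \<Longrightarrow> \<rho> \<in> stab N f \<Longrightarrow> P \<rho>
        \<Longrightarrow> P (Transposition.transpose a b \<circ> \<rho>)"
  shows "P \<sigma>"
  using assms(1)
proof (induction "card {a. a < N \<and> \<sigma> a \<noteq> a}" arbitrary: \<sigma> rule: less_induct)
  case less
  have \<sigma>: "\<sigma> permutes {..<N}" using less.prems by (rule stab_Sym)
  show ?case
  proof (cases "\<exists>a<N. \<sigma> a \<noteq> a")
    case False
    then have "\<sigma> = id"
      using permutes_not_in[OF \<sigma>] by (metis eq_id_iff lessThan_iff)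
    then show ?thesis using assms(2) by simp
  next
    case True
    then obtain a where a: "a < N" "\<sigma> a \<noteq> a" by blast
    let ?t = "Transposition.transpose a (\<sigma> a)"
    have sa: "\<sigma> a < N" "f (\<sigma> a) = f a"
      using a permutes_lt[OF \<sigma>] stab_apply[OF less.prems] by auto
    have t: "?t \<in> stab N f" using a sa by (intro stab_transpose) auto
    let ?\<rho> = "?t \<circ> \<sigma>"
    have \<rho>: "?\<rho> \<in> stab N f" by (rule stab_comp[OF t less.prems])
    have "{b. b < N \<and> ?\<rho> b \<noteq> b} \<subset> {b. b < N \<and> \<sigma> b \<noteq> b}"
    proof
      show "{b. b < N \<and> ?\<rho> b \<noteq> b} \<subseteq> {b. b < N \<and> \<sigma> b \<noteq> b}"
        using inj_eq[OF permutes_inj[OF \<sigma>]]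
        by (auto simp: Transposition.transpose_def split: if_splits)
      show "{b. b < N \<and> ?\<rho> b \<noteq> b} \<noteq> {b. b < N \<and> \<sigma> b \<noteq> b}"
        using a by (auto simp: set_eq_iff intro!: exI[of _ a])
    qed
    then have "card {b. b < N \<and> ?\<rho> b \<noteq> b} < card {b. b < N \<and> \<sigma> b \<noteq> b}"
      by (intro psubset_card_mono) auto
    then have "P ?\<rho>" using less.hyps \<rho> by blast
    then have "P (?t \<circ> ?\<rho>)" using assms(3) a sa \<rho> by metis
    moreover have "?t \<circ> ?\<rho> = \<sigma>" by (simp add: o_assoc)
    ultimately show ?thesis by simp
  qed
qed

lemma bij_stab_left: "\<rho> \<in> stab N f \<Longrightarrow> bij_betw (\<lambda>\<sigma>. \<rho> \<circ> \<sigma>) (stab N f) (stab N f)"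
  by (rule bij_betw_byWitness[where f' = "\<lambda>\<sigma>. inv \<rho> \<circ> \<sigma>"])
    (auto simp: stab_comp stab_inv o_assoc permutes_inv_o[OF stab_Sym])

lemma bij_stab_right: "\<rho> \<in> stab N f \<Longrightarrow> bij_betw (\<lambda>\<sigma>. \<sigma> \<circ> \<rho>) (stab N f) (stab N f)"
  by (rule bij_betw_byWitness[where f' = "\<lambda>\<sigma>. \<sigma> \<circ> inv \<rho>"])
    (auto simp: stab_comp stab_inv o_assoc[symmetric] permutes_inv_o[OF stab_Sym])

lemma bij_stab_inv: "bij_betw inv (stab N f) (stab N f)"
  by (rule bij_betw_byWitness[where f' = inv])
    (auto simp: stab_inv permutes_inv_inv[OF stab_Sym])

lemma Sym_eq_stab: "Sym N = stab N (\<lambda>_. ())"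
  by (auto simp: stab_def)

lemmas bij_Sym_left = bij_stab_left[of _ _ "\<lambda>_. ()", folded Sym_eq_stab]
  and bij_Sym_right = bij_stab_right[of _ _ "\<lambda>_. ()", folded Sym_eq_stab]
  and bij_Sym_inv = bij_stab_inv[of _ "\<lambda>_. ()", folded Sym_eq_stab]

definition chi :: "bool \<Rightarrow> (nat \<Rightarrow> nat) \<Rightarrow> int" where
  "chi d \<sigma> = (if d then sign \<sigma> else 1)"

lemma chi_id [simp]: "chi d id = 1"
  by (simp add: chi_def)

lemma chi_comp: "\<sigma> permutes {..<N} \<Longrightarrow> \<tau> permutes {..<N} \<Longrightarrow> chi d (\<sigma> \<circ> \<tau>) = chi d \<sigma> * chi d \<tau>"
  by (simp add: chi_def sign_compose permutes_imp_permutation[OF finite_lessThan])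

lemma chi_inv: "\<sigma> permutes {..<N} \<Longrightarrow> chi d (inv \<sigma>) = chi d \<sigma>"
  by (simp add: chi_def sign_inverse permutes_imp_permutation[OF finite_lessThan])

lemma chi_transpose: "a \<noteq> b \<Longrightarrow> chi d (Transposition.transpose a b) = (if d then - 1 else 1)"
  by (simp add: chi_def sign_swap_id)

lemma chi_square [simp]: "chi d \<sigma> * chi d \<sigma> = 1"
  by (simp add: chi_def)

lemma of_int_chi_square [simp]: "of_int (chi d \<sigma>) * of_int (chi d \<sigma>) = (1 :: 'a::comm_ring_1)"
  by (metis chi_square of_int_1 of_int_mult)

section \<open>The signed action on tensors\<close>

lemma act_eq: "act \<sigma> I = permute_list (inv \<sigma>) I"
  by (simp add: act_def permute_list_def)

lemma csign_inverse:
  assumes "\<sigma> permutes {..<length I}"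
  shows "csign (permute_list \<sigma> I) (inv \<sigma>) = (csign I \<sigma> :: 'a::comm_ring_1)"
proof -
  have "csign I \<sigma> * csign (permute_list \<sigma> I) (inv \<sigma>) = (1 :: 'a)"
    using csign_compose[OF assms permutes_inv[OF assms], where 'a = 'a] permutes_inv_o(1)[OF assms] by simp
  then have "csign I \<sigma> * (csign I \<sigma> * csign (permute_list \<sigma> I) (inv \<sigma>)) = (csign I \<sigma> :: 'a)" by simp
  then show ?thesis by simp
qed

text \<open>\<open>tact\<close> reads the sign off the source sequence. \<open>csign_inverse\<close>
  transfers it to the sequence at which the result is evaluated, and all inverses disappear.\<close>

lemma tact_apply:
  assumes "\<sigma> permutes {..<N}"
  shows "tact N \<sigma> v I = (if length I = N then csign I \<sigma> * v (permute_list \<sigma> I) else (0 :: 'a::comm_ring_1))"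
  using assms by (auto simp: tact_def act_eq permutes_inv_inv csign_inverse)

lemma tact_comp:
  assumes "\<sigma> permutes {..<N}" "\<tau> permutes {..<N}"
  shows "tact N (\<sigma> \<circ> \<tau>) v = (tact N \<sigma> (tact N \<tau> v) :: _ \<Rightarrow> 'a::comm_ring_1)"
proof
  fix I
  show "tact N (\<sigma> \<circ> \<tau>) v I = (tact N \<sigma> (tact N \<tau> v) I :: 'a)"
    using assms
    by (auto simp: tact_apply permutes_compose csign_compose permute_list_compose mult.assoc)
qed

lemma tact_add: "tact N \<sigma> (v + w) = tact N \<sigma> v + (tact N \<sigma> w :: _ \<Rightarrow> 'a::comm_ring_1)"
  by (auto simp: fun_eq_iff tact_def pointwise algebra_simps)

lemma tact_sc: "tact N \<sigma> (sc c v) = sc c (tact N \<sigma> v :: _ \<Rightarrow> 'a::comm_ring_1)"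
  by (auto simp: fun_eq_iff tact_def pointwise algebra_simps)

lemma tact_zero [simp]: "tact N \<sigma> 0 = (0 :: _ \<Rightarrow> 'a::comm_ring_1)"
  by (auto simp: fun_eq_iff tact_def pointwise)

lemma tact_sum: "tact N \<sigma> (\<Sum>a\<in>A. f a) = (\<Sum>a\<in>A. tact N \<sigma> (f a) :: _ \<Rightarrow> 'a::comm_ring_1)"
  by (induction A rule: infinite_finite_induct) (auto simp: tact_add)

definition tens :: "idx set \<Rightarrow> nat \<Rightarrow> (idx list \<Rightarrow> 'a::zero) set" where
  "tens R N = {v. \<forall>I. v I \<noteq> 0 \<longrightarrow> I \<in> seqs R N}"

lemma tensp_eq: "tensp k l N = tens (RR k l) N"
  by (simp add: tensp_def tens_def)

lemma tens_subspace: "fv.subspace (tens R N :: (idx list \<Rightarrow> 'a::field) set)"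
  by (rule fv.subspaceI) (auto simp: tens_def pointwise, metis add.right_neutral)

lemma permute_seqs:
  assumes "\<sigma> permutes {..<N}"
  shows "permute_list \<sigma> I \<in> seqs R N \<longleftrightarrow> I \<in> seqs R N"
proof (cases "length I = N")
  case True
  then show ?thesis using set_permute_list[of \<sigma> I] assms by (simp add: seqs_def)
qed (simp add: seqs_def)

lemma tact_tens:
  assumes "\<sigma> permutes {..<N}" "v \<in> tens R N"
  shows "tact N \<sigma> v \<in> (tens R N :: (idx list \<Rightarrow> 'a::comm_ring_1) set)"
  unfolding tens_def
proof clarify
  fix I assume "tact N \<sigma> v I \<noteq> 0"
  then have "v (permute_list \<sigma> I) \<noteq> 0"
    using assms(1) by (auto simp: tact_apply split: if_splits)
  then show "I \<in> seqs R N" using assms(2) permute_seqs[OF assms(1)] unfolding tens_def by blast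
qed

lemma tact_id:
  assumes "v \<in> tens R N"
  shows "tact N id v = (v :: _ \<Rightarrow> 'a::comm_ring_1)"
proof
  fix I
  have "length I = N" if "v I \<noteq> 0" using that assms by (auto simp: tens_def seqs_def)
  then show "tact N id v I = v I" by (auto simp: tact_apply)
qed

definition \<delta> :: "idx list \<Rightarrow> idx list \<Rightarrow> 'a::zero_neq_one" where
  "\<delta> I = (\<lambda>J. if J = I then 1 else 0)"

lemma \<delta>_tens [simp]: "I \<in> seqs R N \<Longrightarrow> \<delta> I \<in> tens R N"
  by (simp add: \<delta>_def tens_def)

lemma permute_list_inv1:
  assumes "\<sigma> permutes {..<length I}"
  shows "permute_list (inv \<sigma>) (permute_list \<sigma> I) = I"
  using permute_list_compose[OF permutes_inv[OF assms], of \<sigma>]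
  by (simp only: permutes_inv_o[OF assms] permute_list_id)

lemma permute_list_inv2:
  assumes "\<sigma> permutes {..<length I}"
  shows "permute_list \<sigma> (permute_list (inv \<sigma>) I) = I"
  using permute_list_compose[OF assms, of "inv \<sigma>"]
  by (simp only: permutes_inv_o[OF assms] permute_list_id)

text \<open>Recovers the rule on basis vectors that \<open>tact\<close> encodes through coefficient
  functions.\<close>

lemma tact_\<delta>:
  assumes "\<sigma> permutes {..<N}" "length I = N"
  shows "tact N \<sigma> (\<delta> I) = sc (csign I (inv \<sigma>)) (\<delta> (permute_list (inv \<sigma>) I) :: _ \<Rightarrow> 'a::comm_ring_1)"
proof
  fix J
  have eq: "permute_list \<sigma> J = I \<longleftrightarrow> J = permute_list (inv \<sigma>) I" if "length J = N"
    using that assms permute_list_inv1[of \<sigma> J] permute_list_inv2[of \<sigma> I] by auto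
  show "tact N \<sigma> (\<delta> I) J = (sc (csign I (inv \<sigma>)) (\<delta> (permute_list (inv \<sigma>) I)) J :: 'a)"
  proof (cases "length J = N \<and> permute_list \<sigma> J = I")
    case True
    then have "csign I (inv \<sigma>) = (csign J \<sigma> :: 'a)"
      using csign_inverse[of \<sigma> J, where 'a = 'a] assms by auto
    then show ?thesis using True eq assms by (simp add: tact_apply \<delta>_def pointwise)
  next
    case False
    then show ?thesis using eq assms by (auto simp: tact_apply \<delta>_def pointwise)
  qed
qed

lemma finite_seqs: "finite R \<Longrightarrow> finite (seqs R N)"
  unfolding seqs_def using finite_lists_length_eq[of R N] by (simp add: conj_commute)

lemma tens_expand:
  assumes "finite R" "v \<in> (tens R N :: (idx list \<Rightarrow> 'a::field) set)"
  shows "v = (\<Sum>I\<in>seqs R N. sc (v I) (\<delta> I))"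
proof
  fix J
  have "(\<Sum>I\<in>seqs R N. v I * \<delta> I J) = (\<Sum>I\<in>seqs R N. if I = J then v J else 0)"
    by (rule sum.cong) (auto simp: \<delta>_def)
  also have "\<dots> = v J" using assms finite_seqs[OF assms(1)] by (auto simp: tens_def)
  finally show "v J = (\<Sum>I\<in>seqs R N. sc (v I) (\<delta> I)) J" by (simp add: pointwise)
qed

section \<open>Signed sums over a stabilizer\<close>

definition symm :: "nat \<Rightarrow> (nat \<Rightarrow> 'b) \<Rightarrow> bool \<Rightarrow> (idx list \<Rightarrow> 'a::comm_ring_1) \<Rightarrow> idx list \<Rightarrow> 'a" where
  "symm N f d v = (\<Sum>\<sigma>\<in>stab N f. sc (of_int (chi d \<sigma>)) (tact N \<sigma> v))"

lemma symm_tact: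
  assumes "\<rho> \<in> stab N f"
  shows "symm N f d (tact N \<rho> v) = sc (of_int (chi d \<rho>)) (symm N f d v :: _ \<Rightarrow> 'a::field)"
proof -
  have "symm N f d (tact N \<rho> v) = (\<Sum>\<sigma>\<in>stab N f. sc (of_int (chi d \<rho>)) (sc (of_int (chi d (\<sigma> \<circ> \<rho>))) (tact N (\<sigma> \<circ> \<rho>) v)))"
    unfolding symm_def using assms
    by (intro sum.cong)
      (auto simp: tact_comp[OF stab_Sym stab_Sym] chi_comp[OF stab_Sym stab_Sym] algebra_simps)
  also have "\<dots> = (\<Sum>\<sigma>\<in>stab N f. sc (of_int (chi d \<rho>)) (sc (of_int (chi d \<sigma>)) (tact N \<sigma> v)))"
    by (rule sum.reindex_bij_betw[OF bij_stab_right[OF assms], of "\<lambda>\<sigma>. sc (of_int (chi d \<rho>)) (sc (of_int (chi d \<sigma>)) (tact N \<sigma> v))"])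
  also have "\<dots> = sc (of_int (chi d \<rho>)) (symm N f d v)"
    unfolding symm_def by (simp add: fv.scale_sum_right)
  finally show ?thesis .
qed

lemma tact_symm:
  assumes "\<rho> \<in> stab N f"
  shows "tact N \<rho> (symm N f d v) = sc (of_int (chi d \<rho>)) (symm N f d v :: _ \<Rightarrow> 'a::field)"
proof -
  have "tact N \<rho> (symm N f d v) = (\<Sum>\<sigma>\<in>stab N f. sc (of_int (chi d \<rho>)) (sc (of_int (chi d (\<rho> \<circ> \<sigma>))) (tact N (\<rho> \<circ> \<sigma>) v)))"
    unfolding symm_def tact_sum tact_sc using assms
    by (intro sum.cong)
      (auto simp: tact_comp[OF stab_Sym stab_Sym] chi_comp[OF stab_Sym stab_Sym] mult.assoc[symmetric])
  also have "\<dots> = (\<Sum>\<sigma>\<in>stab N f. sc (of_int (chi d \<rho>)) (sc (of_int (chi d \<sigma>)) (tact N \<sigma> v)))"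
    by (rule sum.reindex_bij_betw[OF bij_stab_left[OF assms], of "\<lambda>\<sigma>. sc (of_int (chi d \<rho>)) (sc (of_int (chi d \<sigma>)) (tact N \<sigma> v))"])
  also have "\<dots> = sc (of_int (chi d \<rho>)) (symm N f d v)"
    unfolding symm_def by (simp add: fv.scale_sum_right)
  finally show ?thesis .
qed

lemma symm_add: "symm N f d (v + w) = symm N f d v + (symm N f d w :: _ \<Rightarrow> 'a::field)"
  unfolding symm_def by (simp add: tact_add fv.scale_right_distrib sum.distrib)

lemma symm_sc: "symm N f d (sc c v) = sc c (symm N f d v :: _ \<Rightarrow> 'a::field)"
  unfolding symm_def by (simp add: tact_sc fv.scale_sum_right mult.commute)

lemma symm_zero [simp]: "symm N f d 0 = (0 :: _ \<Rightarrow> 'a::field)"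
  unfolding symm_def by simp

lemma symm_sum: "symm N f d (\<Sum>a\<in>A. g a) = (\<Sum>a\<in>A. symm N f d (g a) :: _ \<Rightarrow> 'a::field)"
  by (induction A rule: infinite_finite_induct) (auto simp: symm_add)

lemma symm_tens:
  assumes "v \<in> tens R N"
  shows "symm N f d v \<in> (tens R N :: (idx list \<Rightarrow> 'a::field) set)"
  unfolding symm_def using assms
  by (intro fv.subspace_sum fv.subspace_scale tens_subspace tact_tens) (auto dest: stab_Sym)


section \<open>Young symmetrizers\<close>

text \<open>Remove the maximum, which is at least \<open>card S - 1\<close>; equality of the sums
  forces this value and a minimal rest. In \<open>diagram_unique\<close> this singles out the Young
  diagram.\<close>

lemma sum_nat_set_minimal:
  fixes S :: "nat set"
  assumes "finite S"
  shows "\<Sum>{..<card S} \<le> \<Sum>S \<and> (\<Sum>S = \<Sum>{..<card S} \<longrightarrow> S = {..<card S})"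
  using assms
proof (induction "card S" arbitrary: S)
  case 0
  then show ?case by simp
next
  case (Suc n)
  let ?m = "Max S" and ?S = "S - {Max S}"
  have ne: "S \<noteq> {}" using Suc.hyps(2) by auto
  have m: "?m \<in> S" using ne Suc.prems by simp
  have c: "card ?S = n" using m Suc by simp
  have IH: "\<Sum>{..<n} \<le> \<Sum>?S" "\<Sum>?S = \<Sum>{..<n} \<longrightarrow> ?S = {..<n}"
    using Suc.hyps(1)[of ?S] c Suc.prems by auto
  have "S \<subseteq> {..?m}" using Suc.prems by auto
  then have "card S \<le> card {..?m}" by (rule card_mono[rotated]) simp
  then have mn: "n \<le> ?m" using Suc.hyps(2) by simp
  have sumS: "\<Sum>S = ?m + \<Sum>?S" using m Suc.prems by (simp add: sum.remove)
  have "S = {..<Suc n}" if "\<Sum>S = \<Sum>{..<Suc n}"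
  proof -
    have "?m = n" "\<Sum>?S = \<Sum>{..<n}" using that sumS IH(1) mn by auto
    then have "?S = {..<n}" using IH(2) by simp
    then have "S = insert n {..<n}" using m \<open>?m = n\<close> by (metis insert_Diff)
    then show ?thesis by auto
  qed
  then show ?case using sumS IH(1) mn Suc.hyps(2)[symmetric] by simp
qed

text \<open>The coefficient of \<open>\<pi>\<close> in the Young symmetrizer. Integer values allow
  the positivity of \<open>yscale\<close> to be proved in an ordered ring and transferred to the
  field by \<open>of_int\<close>.\<close>

definition wgt :: "nat \<Rightarrow> (nat \<Rightarrow> nat) \<Rightarrow> (nat \<Rightarrow> nat) \<Rightarrow> bool \<Rightarrow> (nat \<Rightarrow> nat) \<Rightarrow> int" where
  "wgt N x y d \<pi> = (\<Sum>\<sigma>\<in>stab N x. \<Sum>\<tau>\<in>stab N y.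
      if \<sigma> \<circ> \<tau> = \<pi> then chi (\<not> d) \<sigma> * chi d \<tau> else 0)"

definition ysym :: "nat \<Rightarrow> (nat \<Rightarrow> nat) \<Rightarrow> (nat \<Rightarrow> nat) \<Rightarrow> bool \<Rightarrow> (idx list \<Rightarrow> 'a::field) \<Rightarrow> idx list \<Rightarrow> 'a" where
  "ysym N x y d v = symm N x (\<not> d) (symm N y d v)"

definition yscale :: "nat \<Rightarrow> (nat \<Rightarrow> nat) \<Rightarrow> (nat \<Rightarrow> nat) \<Rightarrow> bool \<Rightarrow> int" where
  "yscale N x y d = (\<Sum>s\<in>Sym N. wgt N x y d s * wgt N x y d (inv s))"

lemma ysym_sc: "ysym N x y d (sc c v) = sc c (ysym N x y d v)"
  by (simp add: ysym_def symm_sc)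

lemma ysym_zero [simp]: "ysym N x y d 0 = 0"
  by (simp add: ysym_def)

lemma ysym_sum: "ysym N x y d (\<Sum>a\<in>A. g a) = (\<Sum>a\<in>A. ysym N x y d (g a))"
  by (simp add: ysym_def symm_sum)

lemma ysym_tens: "v \<in> tens R N \<Longrightarrow> ysym N x y d v \<in> tens R N"
  by (simp add: ysym_def symm_tens)

lemma ysym_eq_sum_wgt: "ysym N x y d v = (\<Sum>\<pi>\<in>Sym N. sc (of_int (wgt N x y d \<pi>)) (tact N \<pi> v))"
proof -
  have "(\<Sum>\<pi>\<in>Sym N. sc (of_int (wgt N x y d \<pi>)) (tact N \<pi> v))
     = (\<Sum>\<pi>\<in>Sym N. \<Sum>\<sigma>\<in>stab N x. \<Sum>\<tau>\<in>stab N y.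
          if \<sigma> \<circ> \<tau> = \<pi> then sc (of_int (chi (\<not> d) \<sigma> * chi d \<tau>)) (tact N \<pi> v) else 0)"
    unfolding wgt_def of_int_sum fv.scale_sum_left by (intro sum.cong) auto
  also have "\<dots> = (\<Sum>\<sigma>\<in>stab N x. \<Sum>\<tau>\<in>stab N y. \<Sum>\<pi>\<in>Sym N.
          if \<sigma> \<circ> \<tau> = \<pi> then sc (of_int (chi (\<not> d) \<sigma> * chi d \<tau>)) (tact N \<pi> v) else 0)"
    by (subst sum.swap, rule sum.cong[OF refl], rule sum.swap)
  also have "\<dots> = (\<Sum>\<sigma>\<in>stab N x. \<Sum>\<tau>\<in>stab N y. sc (of_int (chi (\<not> d) \<sigma> * chi d \<tau>)) (tact N (\<sigma> \<circ> \<tau>) v))"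
    by (intro sum.cong refl) (auto simp: permutes_compose dest!: stab_Sym)
  also have "\<dots> = ysym N x y d v"
    unfolding ysym_def symm_def tact_sum tact_sc fv.scale_sum_right
    by (intro sum.cong refl) (auto simp: tact_comp dest!: stab_Sym)
  finally show ?thesis ..
qed

lemma stab_comp_eq_iff:
  assumes "\<sigma> permutes S"
  shows "\<sigma> \<circ> \<alpha> = \<sigma> \<circ> \<beta> \<longleftrightarrow> \<alpha> = \<beta>" "\<alpha> \<circ> \<sigma> = \<beta> \<circ> \<sigma> \<longleftrightarrow> \<alpha> = \<beta>"
proof -
  have "\<alpha> = \<beta>" if "\<sigma> \<circ> \<alpha> = \<sigma> \<circ> \<beta>"
    using arg_cong[OF that, of "\<lambda>f. inv \<sigma> \<circ> f"] by (simp add: o_assoc permutes_inv_o[OF assms])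
  moreover have "\<alpha> = \<beta>" if "\<alpha> \<circ> \<sigma> = \<beta> \<circ> \<sigma>"
    using arg_cong[OF that, of "\<lambda>f. f \<circ> inv \<sigma>"] by (simp add: o_assoc[symmetric] permutes_inv_o[OF assms])
  ultimately show "\<sigma> \<circ> \<alpha> = \<sigma> \<circ> \<beta> \<longleftrightarrow> \<alpha> = \<beta>" "\<alpha> \<circ> \<sigma> = \<beta> \<circ> \<sigma> \<longleftrightarrow> \<alpha> = \<beta>" by auto
qed

lemma wgt_left:
  assumes "\<sigma> \<in> stab N x"
  shows "wgt N x y d (\<sigma> \<circ> \<pi>) = chi (\<not> d) \<sigma> * wgt N x y d \<pi>"
proof -
  let ?g = "\<lambda>\<sigma>'. \<Sum>\<tau>\<in>stab N y. if \<sigma>' \<circ> \<tau> = \<sigma> \<circ> \<pi> then chi (\<not> d) \<sigma>' * chi d \<tau> else 0"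
  have "wgt N x y d (\<sigma> \<circ> \<pi>) = (\<Sum>\<sigma>'\<in>stab N x. ?g (\<sigma> \<circ> \<sigma>'))"
    unfolding wgt_def by (rule sum.reindex_bij_betw[OF bij_stab_left[OF assms], of ?g, symmetric])
  also have "\<dots> = chi (\<not> d) \<sigma> * wgt N x y d \<pi>"
    unfolding wgt_def sum_distrib_left
    by (intro sum.cong refl)
      (auto simp: o_assoc[symmetric] stab_comp_eq_iff[OF stab_Sym[OF assms]] chi_comp[OF stab_Sym[OF assms] stab_Sym])
  finally show ?thesis .
qed

lemma wgt_right:
  assumes "\<tau> \<in> stab N y"
  shows "wgt N x y d (\<pi> \<circ> \<tau>) = chi d \<tau> * wgt N x y d \<pi>"
proof -
  let ?g = "\<lambda>\<sigma> \<tau>'. if \<sigma> \<circ> \<tau>' = \<pi> \<circ> \<tau> then chi (\<not> d) \<sigma> * chi d \<tau>' else 0"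
  have "wgt N x y d (\<pi> \<circ> \<tau>) = (\<Sum>\<sigma>\<in>stab N x. \<Sum>\<tau>'\<in>stab N y. ?g \<sigma> (\<tau>' \<circ> \<tau>))"
    unfolding wgt_def
    by (intro sum.cong refl sum.reindex_bij_betw[OF bij_stab_right[OF assms], symmetric])
  also have "\<dots> = chi d \<tau> * wgt N x y d \<pi>"
    unfolding wgt_def sum_distrib_left
    by (intro sum.cong refl)
      (auto simp: o_assoc stab_comp_eq_iff[OF stab_Sym[OF assms]] chi_comp[OF stab_Sym stab_Sym[OF assms]])
  finally show ?thesis .
qed

lemma inv_comp: "\<sigma> permutes S \<Longrightarrow> \<tau> permutes S \<Longrightarrow> inv (\<sigma> \<circ> \<tau>) = inv \<tau> \<circ> inv \<sigma>"
  by (rule o_inv_distrib) (auto dest: permutes_bij)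

text \<open>Inverting \<open>\<sigma> \<circ> \<tau>\<close> exchanges the order of the two
  stabilizers and preserves the characters. This makes \<open>ysym N y x (\<not> d)\<close> the
  operator \<open>E\<^sup>*\<close> of the overview.\<close>

lemma wgt_dual:
  assumes "\<pi> \<in> Sym N"
  shows "wgt N y x (\<not> d) \<pi> = wgt N x y d (inv \<pi>)"
proof -
  have "wgt N x y d (inv \<pi>) = (\<Sum>\<sigma>\<in>stab N x. \<Sum>\<tau>\<in>stab N y.
      if inv \<sigma> \<circ> inv \<tau> = inv \<pi> then chi (\<not> d) (inv \<sigma>) * chi d (inv \<tau>) else 0)"
    unfolding wgt_def
    by (subst sum.reindex_bij_betw[OF bij_stab_inv, symmetric], rule sum.cong[OF refl],
        rule sum.reindex_bij_betw[OF bij_stab_inv, symmetric])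
  also have "\<dots> = (\<Sum>\<sigma>\<in>stab N x. \<Sum>\<tau>\<in>stab N y. if \<tau> \<circ> \<sigma> = \<pi> then chi (\<not> d) \<sigma> * chi d \<tau> else 0)"
  proof (intro sum.cong refl)
    fix \<sigma> \<tau> assume "\<sigma> \<in> stab N x" "\<tau> \<in> stab N y"
    then have p: "\<sigma> permutes {..<N}" "\<tau> permutes {..<N}" by (auto dest: stab_Sym)
    have "inv \<sigma> \<circ> inv \<tau> = inv \<pi> \<longleftrightarrow> \<tau> \<circ> \<sigma> = \<pi>"
      using inv_comp[OF p(2,1)] permutes_inv_inv[OF permutes_compose[OF p]] permutes_inv_inv[of \<pi>] assms
      by (metis mem_Collect_eq)
    then show "(if inv \<sigma> \<circ> inv \<tau> = inv \<pi> then chi (\<not> d) (inv \<sigma>) * chi d (inv \<tau>) else 0)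
        = (if \<tau> \<circ> \<sigma> = \<pi> then chi (\<not> d) \<sigma> * chi d \<tau> else 0)"
      using p by (simp add: chi_inv)
  qed
  also have "\<dots> = wgt N y x (\<not> d) \<pi>"
    unfolding wgt_def by (subst sum.swap) (simp add: mult.commute cong: if_cong)
  finally show ?thesis ..
qed

text \<open>The positions \<open>0, \<dots>, N - 1\<close> carry the coordinates of the cells of a Young diagram, and \<open>d\<close> says
  whether the fibres of \<open>y\<close> or those of \<open>x\<close> carry the sign character.  With \<open>x\<close> the row, \<open>y\<close> the
  column and \<open>d\<close> true this is the symmetrizer of \<open>P\<^sub>t\<close>; exchanging \<open>x\<close> and \<open>y\<close> and negating \<open>d\<close>
  gives the product in the other order.\<close>

locale young =
  fixes N :: nat and x y :: "nat \<Rightarrow> nat" and d :: bool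
  assumes coord_inj: "a < N \<Longrightarrow> b < N \<Longrightarrow> x a = x b \<Longrightarrow> y a = y b \<Longrightarrow> a = b"
    and coord_down: "a < N \<Longrightarrow> r \<le> x a \<Longrightarrow> c \<le> y a \<Longrightarrow> \<exists>b<N. x b = r \<and> y b = c"

lemma young_dual: "young N x y \<Longrightarrow> young N y x"
  unfolding young_def by blast

context young
begin

abbreviation "W \<equiv> wgt N x y d"

lemma stab_inter: "\<sigma> \<in> stab N x \<Longrightarrow> \<sigma> \<in> stab N y \<Longrightarrow> \<sigma> = id"
proof
  fix a
  assume s: "\<sigma> \<in> stab N x" "\<sigma> \<in> stab N y"
  show "\<sigma> a = id a"
  proof (cases "a < N")
    case True
    then show ?thesis
      using coord_inj[of "\<sigma> a" a] stab_apply[OF s(1)] stab_apply[OF s(2)] permutes_lt[OF stab_Sym[OF s(1)]] by simp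
  next
    case False
    then show ?thesis using permutes_not_in[OF stab_Sym[OF s(1)]] by simp
  qed
qed

text \<open>A permutation of one stabilizer that undoes one of the other lies in both and is
  trivial, so the identity has a single factorization. This is the normalization behind
  \<open>eq_multiple_wgt\<close>.\<close>

lemma wgt_id: "W id = 1"
proof -
  have "(if \<sigma> \<circ> \<tau> = id then chi (\<not> d) \<sigma> * chi d \<tau> else 0) = (if \<sigma> = id then if \<tau> = id then 1 else 0 else 0)"
    if "\<sigma> \<in> stab N x" "\<tau> \<in> stab N y" for \<sigma> \<tau>
  proof (cases "\<sigma> \<circ> \<tau> = id")
    case True
    have "\<sigma> = \<sigma> \<circ> \<tau> \<circ> inv \<tau>" by (simp add: o_assoc[symmetric] permutes_inv_o[OF stab_Sym[OF that(2)]])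
    then have "\<sigma> = inv \<tau>" using True by simp
    then have "\<sigma> = id" using stab_inter that stab_inv by blast
    then show ?thesis using True by simp
  qed auto
  then have "W id = (\<Sum>\<sigma>\<in>stab N x. \<Sum>\<tau>\<in>stab N y. if \<sigma> = id then if \<tau> = id then 1 else 0 else 0)"
    unfolding wgt_def by (intro sum.cong refl) auto
  also have "\<dots> = (\<Sum>\<sigma>\<in>stab N x. if \<sigma> = id then 1 else 0)"
    by (intro sum.cong refl) auto
  also have "\<dots> = 1" by simp
  finally show ?thesis .
qed

text \<open>A 0-1 matrix with the row and column sums of a Young diagram is that diagram, since among the
  matrices with these column sums it alone minimizes the sum of the row indices.\<close>

lemma diagram_unique:
  assumes \<pi>: "\<pi> permutes {..<N}"
    and inj: "\<And>a b. a < N \<Longrightarrow> b < N \<Longrightarrow> x (\<pi> a) = x (\<pi> b) \<Longrightarrow> y a = y b \<Longrightarrow> a = b"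
    and b: "b < N"
  shows "\<exists>c<N. x c = x (\<pi> b) \<and> y c = y b"
proof -
  define L where "L c = {a. a < N \<and> y a = c}" for c
  have fin: "finite (L c)" for c by (simp add: L_def)
  have injx: "inj_on x (L c)" for c by (rule inj_onI) (auto simp: L_def intro: coord_inj)
  have injp: "inj_on (\<lambda>a. x (\<pi> a)) (L c)" for c by (rule inj_onI) (auto simp: L_def intro: inj)
  \<comment> \<open>Downward closure makes the \<open>x\<close>-coordinates of a fibre of
    \<open>y\<close> an initial segment, the set of least sum among those of its size.\<close>
  have xL: "x ` L c = {..<card (L c)}" for c
  proof -
    have down: "r \<in> x ` L c" if s: "r \<le> s" "s \<in> x ` L c" for r s
    proof -
      obtain a' where "a' < N" "y a' = c" "s = x a'" using s by (auto simp: L_def)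
      then show ?thesis using coord_down[of a' r c] s by (auto simp: L_def image_iff)
    qed
    have "\<exists>n. x ` L c = {..<n}"
    proof (cases "x ` L c = {}")
      case False
      have "x ` L c = {..Max (x ` L c)}"
        using False fin down[OF _ Max_in] by auto
      then show ?thesis by (metis lessThan_Suc_atMost)
    qed (metis lessThan_0)
    then obtain n where "x ` L c = {..<n}" by blast
    moreover from this have "card (L c) = n" using card_image[OF injx[of c]] by simp
    ultimately show ?thesis by simp
  qed
  have le: "(\<Sum>a\<in>L c. x a) \<le> (\<Sum>a\<in>L c. x (\<pi> a))"
    and eq: "(\<Sum>a\<in>L c. x (\<pi> a)) = (\<Sum>a\<in>L c. x a) \<Longrightarrow> (\<lambda>a. x (\<pi> a)) ` L c = x ` L c" for c
  proof -
    let ?S = "(\<lambda>a. x (\<pi> a)) ` L c"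
    have 1: "\<Sum>?S = (\<Sum>a\<in>L c. x (\<pi> a))" using sum.reindex[OF injp[of c], of "\<lambda>a. a"] by simp
    have 2: "\<Sum>{..<card ?S} = (\<Sum>a\<in>L c. x a)"
      using sum.reindex[OF injx[of c], of "\<lambda>a. a"] by (simp add: xL card_image[OF injp])
    show "(\<Sum>a\<in>L c. x a) \<le> (\<Sum>a\<in>L c. x (\<pi> a))"
      using sum_nat_set_minimal[of ?S] fin 1 2 by simp
    show "?S = x ` L c" if "(\<Sum>a\<in>L c. x (\<pi> a)) = (\<Sum>a\<in>L c. x a)"
    proof -
      have "?S = {..<card ?S}" using sum_nat_set_minimal[of ?S] fin 1 2 that by simp
      then show ?thesis using xL card_image[OF injp] by metis
    qed
  qed
  have part: "(\<Sum>c\<in>y ` {..<N}. \<Sum>a\<in>L c. g a) = (\<Sum>a<N. g a)" for g :: "nat \<Rightarrow> nat"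
    using sum.group[of "{..<N}" "y ` {..<N}" y g] by (simp add: L_def)
  \<comment> \<open>\<open>\<pi>\<close> only rearranges the positions, so the total is unchanged,
    and the inequalities \<open>le\<close> on the single fibres must all be equalities.\<close>
  have "(\<Sum>a<N. x (\<pi> a)) = (\<Sum>a<N. x a)"
    using sum.permute[OF \<pi>, of x] by (simp add: o_def)
  then have tot: "(\<Sum>c\<in>y ` {..<N}. \<Sum>a\<in>L c. x (\<pi> a)) = (\<Sum>c\<in>y ` {..<N}. \<Sum>a\<in>L c. x a)"
    unfolding part .
  have "(\<Sum>a\<in>L (y b). x (\<pi> a)) = (\<Sum>a\<in>L (y b). x a)"
  proof (rule ccontr)
    assume "\<not> ?thesis"
    then have "(\<Sum>c\<in>y ` {..<N}. \<Sum>a\<in>L c. x a) < (\<Sum>c\<in>y ` {..<N}. \<Sum>a\<in>L c. x (\<pi> a))"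
      using le b by (intro sum_strict_mono_ex1) (auto simp: le_neq_implies_less intro!: bexI[of _ b])
    then show False using tot by simp
  qed
  then have "x (\<pi> b) \<in> x ` L (y b)" using eq[of "y b"] b by (auto simp: L_def)
  then show ?thesis by (auto simp: L_def)
qed

text \<open>By \<open>diagram_unique\<close> there is a position with the
  \<open>x\<close>-coordinate of \<open>\<pi> b\<close> and the \<open>y\<close>-coordinate of
  \<open>b\<close>. Sending \<open>b\<close> to it is \<open>\<tau>\<close>, and
  \<open>\<pi> \<circ> inv \<tau>\<close> then preserves \<open>x\<close>.\<close>

lemma factorization:
  assumes \<pi>: "\<pi> permutes {..<N}"
    and inj: "\<And>a b. a < N \<Longrightarrow> b < N \<Longrightarrow> x (\<pi> a) = x (\<pi> b) \<Longrightarrow> y a = y b \<Longrightarrow> a = b"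
  obtains \<sigma> \<tau> where "\<sigma> \<in> stab N x" "\<tau> \<in> stab N y" "\<pi> = \<sigma> \<circ> \<tau>"
proof -
  have "\<forall>b. \<exists>c. b < N \<longrightarrow> c < N \<and> x c = x (\<pi> b) \<and> y c = y b"
    using diagram_unique[OF assms] by blast
  then have "\<exists>t. \<forall>b. b < N \<longrightarrow> t b < N \<and> x (t b) = x (\<pi> b) \<and> y (t b) = y b"
    by (rule choice)
  then obtain t where "\<forall>b. b < N \<longrightarrow> t b < N \<and> x (t b) = x (\<pi> b) \<and> y (t b) = y b" ..
  then have t: "b < N \<Longrightarrow> t b < N \<and> x (t b) = x (\<pi> b) \<and> y (t b) = y b" for b
    by simp
  define \<tau> where "\<tau> b = (if b < N then t b else b)" for b
  have "inj_on \<tau> {..<N}"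
  proof (rule inj_onI)
    fix a b assume "a \<in> {..<N}" "b \<in> {..<N}" "\<tau> a = \<tau> b"
    then have ab: "a < N" "b < N" "t a = t b" by (simp_all add: \<tau>_def)
    have "x (\<pi> a) = x (t b)" "y a = y (t b)" using t[OF ab(1)] unfolding ab(3) by simp_all
    then show "a = b" using t[OF ab(2)] by (intro inj[OF ab(1,2)]) simp_all
  qed
  moreover have "\<tau> ` {..<N} \<subseteq> {..<N}" using t by (auto simp: \<tau>_def)
  ultimately have "bij_betw \<tau> {..<N} {..<N}"
    by (simp add: bij_betw_def endo_inj_surj)
  then have \<tau>: "\<tau> permutes {..<N}"
    by (rule bij_imp_permutes) (simp add: \<tau>_def)
  then have 1: "\<tau> \<in> stab N y" using t by (simp add: stab_def \<tau>_def)
  have "x ((\<pi> \<circ> inv \<tau>) a) = x a" if "a < N" for a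
  proof -
    have "inv \<tau> a < N" using that permutes_lt[OF permutes_inv[OF \<tau>]] by simp
    then have "x (\<tau> (inv \<tau> a)) = x (\<pi> (inv \<tau> a))" using t by (simp add: \<tau>_def)
    then show ?thesis using permutes_inverses(1)[OF \<tau>] by simp
  qed
  then have "\<pi> \<circ> inv \<tau> \<in> stab N x"
    using \<pi> \<tau> by (simp add: stab_def permutes_compose permutes_inv)
  moreover have "\<pi> = (\<pi> \<circ> inv \<tau>) \<circ> \<tau>"
    by (simp add: o_assoc[symmetric] permutes_inv_o[OF \<tau>])
  ultimately show ?thesis using 1 that by blast
qed

text \<open>Von Neumann's lemma: if \<open>\<pi>\<close> does not factor, a transposition from the left and its conjugate
  on the right act on \<open>f \<pi>\<close> with opposite signs.\<close>

lemma eq_multiple_wgt: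
  fixes f :: "(nat \<Rightarrow> nat) \<Rightarrow> int"
  assumes left: "\<And>\<sigma> \<pi>. \<sigma> \<in> stab N x \<Longrightarrow> \<pi> \<in> Sym N \<Longrightarrow> f (\<sigma> \<circ> \<pi>) = chi (\<not> d) \<sigma> * f \<pi>"
    and right: "\<And>\<tau> \<pi>. \<tau> \<in> stab N y \<Longrightarrow> \<pi> \<in> Sym N \<Longrightarrow> f (\<pi> \<circ> \<tau>) = chi d \<tau> * f \<pi>"
    and \<pi>: "\<pi> \<in> Sym N"
  shows "f \<pi> = f id * W \<pi>"
proof (cases "\<exists>\<sigma>\<in>stab N x. \<exists>\<tau>\<in>stab N y. \<pi> = \<sigma> \<circ> \<tau>")
  case True
  then obtain \<sigma> \<tau> where st: "\<sigma> \<in> stab N x" "\<tau> \<in> stab N y" "\<pi> = \<sigma> \<circ> \<tau>" by blast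
  have "f \<pi> = chi (\<not> d) \<sigma> * chi d \<tau> * f id"
    using left[OF st(1), of \<tau>] right[OF st(2), of id] st stab_Sym[OF st(2)] by simp
  moreover have "W \<pi> = chi (\<not> d) \<sigma> * chi d \<tau>"
    using wgt_left[OF st(1), of y d \<tau>] wgt_right[OF st(2), of x d id] st wgt_id by simp
  ultimately show ?thesis by simp
next
  case False
  then obtain a b where ab: "a < N" "b < N" "x (\<pi> a) = x (\<pi> b)" "y a = y b" "a \<noteq> b"
    using factorization[of \<pi>] \<pi> by (metis mem_Collect_eq)
  let ?s = "Transposition.transpose (\<pi> a) (\<pi> b)" and ?t = "Transposition.transpose a b"
  have p: "\<pi> permutes {..<N}" using \<pi> by simp
  have s: "?s \<in> stab N x" using ab permutes_lt[OF p] by (intro stab_transpose) auto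
  have t: "?t \<in> stab N y" using ab by (intro stab_transpose) auto
  have "?s \<circ> \<pi> = \<pi> \<circ> ?t"
    using inj_eq[OF permutes_inj[OF p]] by (auto simp: fun_eq_iff Transposition.transpose_def)
  then have "chi (\<not> d) ?s * f \<pi> = chi d ?t * f \<pi>"
    by (simp only: left[OF s \<pi>, symmetric] right[OF t \<pi>, symmetric])
  moreover have "\<pi> a \<noteq> \<pi> b" using inj_eq[OF permutes_inj[OF p]] ab by simp
  ultimately have "f \<pi> = 0" using ab by (cases d) (auto simp: chi_transpose)
  moreover have "W \<pi> = 0" unfolding wgt_def using False by (intro sum.neutral ballI) auto
  ultimately show ?thesis by simp
qed

text \<open>Coefficient form of von Neumann's identity. Substituting
  \<open>\<sigma> \<circ> r\<close> or \<open>r \<circ> \<tau>\<close> for \<open>s\<close> shows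
  that the sum transforms like \<open>W\<close> in \<open>\<rho>\<close> and in \<open>\<pi>\<close>
  separately; \<open>eq_multiple_wgt\<close>, applied once for each, reduces it to its value at two
  identities.\<close>

lemma wgt_convolution:
  assumes \<pi>: "\<pi> \<in> Sym N" and \<rho>: "\<rho> \<in> Sym N"
  shows "(\<Sum>s\<in>Sym N. W s * W (\<pi> \<circ> inv s \<circ> \<rho>)) = yscale N x y d * W \<pi> * W \<rho>"
proof -
  define F where "F \<pi> \<rho> = (\<Sum>s\<in>Sym N. W s * W (\<pi> \<circ> inv s \<circ> \<rho>))" for \<pi> \<rho>
  have mid1: "F \<pi> (\<sigma> \<circ> \<rho>) = chi (\<not> d) \<sigma> * F \<pi> \<rho>"
    if s: "\<sigma> \<in> stab N x" for \<sigma> \<pi> \<rho>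
  proof -
    have S: "\<sigma> \<in> Sym N" using stab_Sym[OF s] by simp
    have "F \<pi> (\<sigma> \<circ> \<rho>) = (\<Sum>r\<in>Sym N. W (\<sigma> \<circ> r) * W (\<pi> \<circ> inv (\<sigma> \<circ> r) \<circ> (\<sigma> \<circ> \<rho>)))"
      unfolding F_def
      by (rule sum.reindex_bij_betw[OF bij_Sym_left[OF S], symmetric])
    also have "\<dots> = (\<Sum>r\<in>Sym N. chi (\<not> d) \<sigma> * (W r * W (\<pi> \<circ> inv r \<circ> \<rho>)))"
    proof (rule sum.cong[OF refl])
      fix r assume r: "r \<in> Sym N"
      have "\<pi> \<circ> inv (\<sigma> \<circ> r) \<circ> (\<sigma> \<circ> \<rho>) = \<pi> \<circ> inv r \<circ> (inv \<sigma> \<circ> \<sigma>) \<circ> \<rho>"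
        using inv_comp[of \<sigma> "{..<N}" r] S r by (simp add: o_assoc)
      also have "\<dots> = \<pi> \<circ> inv r \<circ> \<rho>" using permutes_inv_o[of \<sigma>] S by auto
      finally show "W (\<sigma> \<circ> r) * W (\<pi> \<circ> inv (\<sigma> \<circ> r) \<circ> (\<sigma> \<circ> \<rho>)) = chi (\<not> d) \<sigma> * (W r * W (\<pi> \<circ> inv r \<circ> \<rho>))"
        by (simp add: wgt_left[OF s])
    qed
    finally show ?thesis by (simp add: F_def sum_distrib_left)
  qed
  have right1: "F \<pi> (\<rho> \<circ> \<tau>) = chi d \<tau> * F \<pi> \<rho>" if t: "\<tau> \<in> stab N y" for \<tau> \<pi> \<rho>
    unfolding F_def o_assoc wgt_right[OF t] sum_distrib_left by (simp add: mult_ac)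
  have left1: "F (\<sigma> \<circ> \<pi>) \<rho> = chi (\<not> d) \<sigma> * F \<pi> \<rho>" if s: "\<sigma> \<in> stab N x" for \<sigma> \<pi> \<rho>
    unfolding F_def o_assoc[symmetric] wgt_left[OF s] sum_distrib_left by (simp add: mult_ac)
  have mid2: "F (\<pi> \<circ> \<tau>) \<rho> = chi d \<tau> * F \<pi> \<rho>"
    if t: "\<tau> \<in> stab N y" for \<tau> \<pi> \<rho>
  proof -
    have T: "\<tau> \<in> Sym N" using stab_Sym[OF t] by simp
    have "F (\<pi> \<circ> \<tau>) \<rho> = (\<Sum>r\<in>Sym N. W (r \<circ> \<tau>) * W (\<pi> \<circ> \<tau> \<circ> inv (r \<circ> \<tau>) \<circ> \<rho>))"
      unfolding F_def
      by (rule sum.reindex_bij_betw[OF bij_Sym_right[OF T], symmetric])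
    also have "\<dots> = (\<Sum>r\<in>Sym N. chi d \<tau> * (W r * W (\<pi> \<circ> inv r \<circ> \<rho>)))"
    proof (rule sum.cong[OF refl])
      fix r assume r: "r \<in> Sym N"
      have "\<pi> \<circ> \<tau> \<circ> inv (r \<circ> \<tau>) \<circ> \<rho> = \<pi> \<circ> (\<tau> \<circ> inv \<tau>) \<circ> inv r \<circ> \<rho>"
        using inv_comp[of r "{..<N}" \<tau>] T r by (simp add: o_assoc)
      also have "\<dots> = \<pi> \<circ> inv r \<circ> \<rho>" using permutes_inv_o[of \<tau>] T by auto
      finally show "W (r \<circ> \<tau>) * W (\<pi> \<circ> \<tau> \<circ> inv (r \<circ> \<tau>) \<circ> \<rho>) = chi d \<tau> * (W r * W (\<pi> \<circ> inv r \<circ> \<rho>))"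
        by (simp add: wgt_right[OF t])
    qed
    finally show ?thesis by (simp add: F_def sum_distrib_left)
  qed
  have "F \<pi> \<rho> = F \<pi> id * W \<rho>"
    by (rule eq_multiple_wgt) (use \<rho> in \<open>simp_all only: mid1 right1\<close>)
  also have "F \<pi> id = F id id * W \<pi>"
    by (rule eq_multiple_wgt[where f = "\<lambda>\<pi>. F \<pi> id"]) (use \<pi> in \<open>simp_all only: mid2 left1\<close>)
  also have "F id id = yscale N x y d" by (simp add: F_def yscale_def)
  finally show ?thesis unfolding F_def by simp
qed

text \<open>With \<open>E\<close> the Young symmetrizer and \<open>A = E E\<^sup>*\<close>, one has \<open>A A = h S A\<close> where \<open>S\<close> is the sum of
  the squared coefficients of \<open>E\<close>; comparing coefficients at the identity gives \<open>h > 0\<close>.\<close>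

lemma yscale_pos: "yscale N x y d > 0"
proof -
  \<comment> \<open>\<open>g\<close> lists the coefficients of \<open>A\<close>. As \<open>g\<close>
    is invariant under inversion, the sum of its squares is the coefficient of the identity in
    \<open>A A\<close>, and \<open>S\<close> is that in \<open>A\<close>.\<close>
  define g where "g \<pi> = (\<Sum>s\<in>Sym N. W (\<pi> \<circ> s) * W s)" for \<pi>
  define S where "S = (\<Sum>s\<in>Sym N. W s * W s)"
  have idS: "id \<in> Sym N" by simp
  have S: "S > 0"
    unfolding S_def by (rule sum_pos2[OF finite_Sym idS]) (auto simp: wgt_id)
  have g_inv: "g (inv \<pi>) = g \<pi>" if "\<pi> \<in> Sym N" for \<pi>
  proof -
    have "g (inv \<pi>) = (\<Sum>s\<in>Sym N. W (inv \<pi> \<circ> (\<pi> \<circ> s)) * W (\<pi> \<circ> s))"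
      unfolding g_def by (rule sum.reindex_bij_betw[OF bij_Sym_left[OF that], symmetric])
    also have "\<dots> = g \<pi>"
      unfolding g_def using permutes_inv_o[of \<pi> "{..<N}"] that by (simp add: o_assoc mult.commute)
    finally show ?thesis .
  qed
  have "(\<Sum>\<pi>\<in>Sym N. g \<pi> * g \<pi>) = (\<Sum>\<pi>\<in>Sym N. g \<pi> * g (inv \<pi>))"
    by (rule sum.cong) (auto simp: g_inv)
  also have "\<dots> = (\<Sum>\<pi>\<in>Sym N. \<Sum>s\<in>Sym N. \<Sum>r\<in>Sym N. W (\<pi> \<circ> s) * W s * (W (inv \<pi> \<circ> r) * W r))"
    unfolding g_def sum_product ..
  also have "\<dots> = (\<Sum>s\<in>Sym N. \<Sum>r\<in>Sym N. \<Sum>\<pi>\<in>Sym N. W (\<pi> \<circ> s) * W s * (W (inv \<pi> \<circ> r) * W r))"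
    by (subst sum.swap, rule sum.cong[OF refl], rule sum.swap)
  also have "\<dots> = (\<Sum>s\<in>Sym N. \<Sum>r\<in>Sym N. yscale N x y d * (W s * W s * (W r * W r)))"
  proof (intro sum.cong refl)
    fix s r assume sr: "s \<in> Sym N" "r \<in> Sym N"
    have "(\<Sum>\<pi>\<in>Sym N. W (\<pi> \<circ> s) * W s * (W (inv \<pi> \<circ> r) * W r))
        = (\<Sum>a\<in>Sym N. W (a \<circ> inv s \<circ> s) * W s * (W (inv (a \<circ> inv s) \<circ> r) * W r))"
      by (rule sum.reindex_bij_betw[OF bij_Sym_right[OF Sym_inv[OF sr(1)]], symmetric])
    also have "\<dots> = (\<Sum>a\<in>Sym N. W s * W r * (W a * W (s \<circ> inv a \<circ> r)))"
    proof (rule sum.cong[OF refl])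
      fix a assume a: "a \<in> Sym N"
      have "inv (a \<circ> inv s) = s \<circ> inv a"
        using inv_comp[of a "{..<N}" "inv s"] permutes_inv_inv[of s] permutes_inv[of s] sr a by auto
      moreover have "a \<circ> inv s \<circ> s = a"
        using permutes_inv_o[of s "{..<N}"] sr by (simp add: o_assoc[symmetric])
      ultimately show "W (a \<circ> inv s \<circ> s) * W s * (W (inv (a \<circ> inv s) \<circ> r) * W r) = W s * W r * (W a * W (s \<circ> inv a \<circ> r))"
        by simp
    qed
    also have "\<dots> = yscale N x y d * (W s * W s * (W r * W r))"
      unfolding sum_distrib_left[symmetric] wgt_convolution[OF sr] by simp
    finally show "(\<Sum>\<pi>\<in>Sym N. W (\<pi> \<circ> s) * W s * (W (inv \<pi> \<circ> r) * W r)) = yscale N x y d * (W s * W s * (W r * W r))" .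
  qed
  also have "\<dots> = yscale N x y d * (S * S)"
    unfolding S_def sum_product by (simp only: sum_distrib_left)
  finally have "yscale N x y d * (S * S) = (\<Sum>\<pi>\<in>Sym N. g \<pi> * g \<pi>)" ..
  also have "\<dots> > 0"
  proof (rule sum_pos2[OF finite_Sym idS])
    have "g id = S" by (simp add: g_def S_def)
    then show "0 < g id * g id" using S by simp
  qed auto
  finally show ?thesis using S by (simp add: zero_less_mult_iff)
qed

lemma ysym_tact_ysym:
  assumes \<pi>: "\<pi> \<in> Sym N"
  shows "ysym N x y d (tact N \<pi> (ysym N x y d v))
       = sc (of_int (yscale N x y d * W (inv \<pi>))) (ysym N x y d v :: _ \<Rightarrow> 'a::field)"
proof -
  let ?T = "\<lambda>\<rho>. tact N \<rho> v"
  have "ysym N x y d (tact N \<pi> (ysym N x y d v))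
     = (\<Sum>s\<in>Sym N. \<Sum>r\<in>Sym N. sc (of_int (W s * W r)) (?T (s \<circ> \<pi> \<circ> r)))"
    unfolding ysym_eq_sum_wgt tact_sum tact_sc fv.scale_sum_right
    by (intro sum.cong refl) (use \<pi> in \<open>simp add: tact_comp permutes_compose\<close>)
  also have "\<dots> = (\<Sum>s\<in>Sym N. \<Sum>\<rho>\<in>Sym N. sc (of_int (W s * W (inv \<pi> \<circ> inv s \<circ> \<rho>))) (?T \<rho>))"
  proof (rule sum.cong[OF refl])
    fix s assume s: "s \<in> Sym N"
    have sp: "s \<circ> \<pi> \<in> Sym N" by (rule Sym_comp[OF s \<pi>])
    have "(\<Sum>\<rho>\<in>Sym N. sc (of_int (W s * W (inv \<pi> \<circ> inv s \<circ> \<rho>))) (?T \<rho>))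
        = (\<Sum>r\<in>Sym N. sc (of_int (W s * W (inv \<pi> \<circ> inv s \<circ> (s \<circ> \<pi> \<circ> r)))) (?T (s \<circ> \<pi> \<circ> r)))"
      by (rule sum.reindex_bij_betw[OF bij_Sym_left[OF sp], symmetric])
    also have "\<dots> = (\<Sum>r\<in>Sym N. sc (of_int (W s * W r)) (?T (s \<circ> \<pi> \<circ> r)))"
    proof (rule sum.cong[OF refl])
      fix r :: "nat \<Rightarrow> nat"
      have "inv \<pi> \<circ> inv s \<circ> (s \<circ> \<pi> \<circ> r) = (inv \<pi> \<circ> (inv s \<circ> s) \<circ> \<pi>) \<circ> r" by (simp only: o_assoc)
      also have "\<dots> = r" using permutes_inv_o[of s "{..<N}"] permutes_inv_o[of \<pi> "{..<N}"] s \<pi> by simp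
      finally show "sc (of_int (W s * W (inv \<pi> \<circ> inv s \<circ> (s \<circ> \<pi> \<circ> r)))) (?T (s \<circ> \<pi> \<circ> r)) = sc (of_int (W s * W r)) (?T (s \<circ> \<pi> \<circ> r))"
        by simp
    qed
    finally show "(\<Sum>r\<in>Sym N. sc (of_int (W s * W r)) (?T (s \<circ> \<pi> \<circ> r)))
        = (\<Sum>\<rho>\<in>Sym N. sc (of_int (W s * W (inv \<pi> \<circ> inv s \<circ> \<rho>))) (?T \<rho>))" ..
  qed
  also have "\<dots> = (\<Sum>\<rho>\<in>Sym N. sc (of_int (\<Sum>s\<in>Sym N. W s * W (inv \<pi> \<circ> inv s \<circ> \<rho>))) (?T \<rho>))"
    unfolding of_int_sum fv.scale_sum_left by (rule sum.swap)
  also have "\<dots> = (\<Sum>\<rho>\<in>Sym N. sc (of_int (yscale N x y d * W (inv \<pi>))) (sc (of_int (W \<rho>)) (?T \<rho>)))"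
    by (rule sum.cong[OF refl]) (simp add: wgt_convolution[OF Sym_inv[OF \<pi>]])
  finally show ?thesis by (simp add: ysym_eq_sum_wgt fv.scale_sum_right)
qed

lemma ysym_ysym:
  assumes "v \<in> tens R N"
  shows "ysym N x y d (ysym N x y d v) = sc (of_int (yscale N x y d)) (ysym N x y d v :: _ \<Rightarrow> 'a::field)"
  using ysym_tact_ysym[of id v] tact_id[OF ysym_tens[OF assms]] by (simp add: wgt_id)

end


section \<open>Independence of the semistandard family\<close>

definition rank :: "idx set \<Rightarrow> idx \<Rightarrow> nat" where
  "rank R i = card {j \<in> R. j < i}"

lemma rank_less: "finite R \<Longrightarrow> i \<in> R \<Longrightarrow> i < j \<Longrightarrow> rank R i < rank R j"
  unfolding rank_def by (rule psubset_card_mono) auto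

lemma rank_mono: "finite R \<Longrightarrow> i \<le> j \<Longrightarrow> rank R i \<le> rank R j"
  unfolding rank_def by (rule card_mono) auto

lemma rank_inj: "finite R \<Longrightarrow> i \<in> R \<Longrightarrow> j \<in> R \<Longrightarrow> rank R i = rank R j \<Longrightarrow> i = j"
  using rank_less[of R i j] rank_less[of R j i] by (cases i j rule: linorder_cases) auto

text \<open>The weight \<open>f\<close> will be a coordinate. Permutations along the fibres of
  \<open>f\<close> preserve the key, and moving larger entries to larger coordinates raises it. It
  orders the sequences both for triangularity and for straightening.\<close>

definition key :: "idx set \<Rightarrow> nat \<Rightarrow> (nat \<Rightarrow> nat) \<Rightarrow> idx list \<Rightarrow> nat" where
  "key R N f I = (\<Sum>a<N. f a * rank R (I ! a))"

lemma key_le: "finite R \<Longrightarrow> key R N f I \<le> (\<Sum>a<N. f a * card R)"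
  unfolding key_def rank_def by (intro sum_mono mult_left_mono card_mono) auto

lemma key_stab:
  assumes "\<sigma> \<in> stab N f" "length I = N"
  shows "key R N f (permute_list \<sigma> I) = key R N f I"
proof -
  note \<sigma> = stab_Sym[OF assms(1)]
  have "key R N f (permute_list \<sigma> I) = (\<Sum>a<N. f (\<sigma> a) * rank R (I ! \<sigma> a))"
    unfolding key_def
    by (rule sum.cong) (use assms \<sigma> in \<open>auto simp: permute_list_nth stab_apply\<close>)
  also have "\<dots> = key R N f I"
    unfolding key_def using sum.permute[OF \<sigma>, of "\<lambda>a. f a * rank R (I ! a)"] by (simp add: o_def)
  finally show ?thesis .
qed

definition fsorted :: "nat \<Rightarrow> (nat \<Rightarrow> nat) \<Rightarrow> (nat \<Rightarrow> nat) \<Rightarrow> idx list \<Rightarrow> bool" where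
  "fsorted N x y I \<longleftrightarrow> (\<forall>a<N. \<forall>b<N. y a = y b \<longrightarrow> x a < x b \<longrightarrow> I ! a \<le> I ! b)"

definition sstd :: "nat \<Rightarrow> (nat \<Rightarrow> nat) \<Rightarrow> (nat \<Rightarrow> nat) \<Rightarrow> bool \<Rightarrow> idx list \<Rightarrow> bool" where
  "sstd N x y d I \<longleftrightarrow> fsorted N x y I \<and> fsorted N y x I \<and>
     (\<forall>a<N. \<forall>b<N. a \<noteq> b \<longrightarrow> y a = y b \<longrightarrow> I ! a = I ! b \<longrightarrow> par (I ! a) = d) \<and>
     (\<forall>a<N. \<forall>b<N. a \<noteq> b \<longrightarrow> x a = x b \<longrightarrow> I ! a = I ! b \<longrightarrow> par (I ! a) = (\<not> d))"

lemma sstd_dual: "sstd N y x (\<not> d) I \<longleftrightarrow> sstd N x y d I"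
  by (auto simp: sstd_def)

text \<open>Transpositions generate the stabilizer, and on equal entries of parity \<open>e\<close>
  each of them has Koszul sign \<open>chi e\<close>.\<close>

lemma csign_stab:
  assumes "\<sigma> \<in> stab N f" "length I = N"
    and eq: "\<And>a b. a < N \<Longrightarrow> b < N \<Longrightarrow> a \<noteq> b \<Longrightarrow> f a = f b \<Longrightarrow> I ! a = I ! b \<and> par (I ! a) = e"
  shows "csign I \<sigma> = (of_int (chi e \<sigma>) :: 'a::comm_ring_1) \<and> permute_list \<sigma> I = I"
  using assms(1)
proof (induction rule: stab_induct)
  case id
  show ?case by (simp only: csign_id chi_id of_int_1 permute_list_id simp_thms)
next
  case (swap a b \<rho>)
  let ?t = "Transposition.transpose a b"
  have t: "?t permutes {..<N}" using swap by (simp add: permutes_swap_id)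
  note \<rho> = stab_Sym[OF swap.hyps(5)]
  have e: "I ! a = I ! b" "par (I ! a) = e" using eq swap.hyps by blast+
  have 1: "permute_list ?t I = I"
    using swap.hyps e assms(2) by (intro permute_list_transpose) auto
  have "csign I (?t \<circ> \<rho>) = (csign I ?t * csign I \<rho> :: 'a)"
    using csign_compose[of ?t I \<rho>, where 'a = 'a] t \<rho> assms(2) 1 by simp
  also have "csign I ?t = (of_int (chi e ?t) :: 'a)"
    using csign_transpose'[of a b I, where 'a = 'a] swap.hyps e assms(2) by (simp add: chi_transpose)
  finally have "csign I (?t \<circ> \<rho>) = (of_int (chi e (?t \<circ> \<rho>)) :: 'a)"
    using swap.IH by (simp only: chi_comp[OF t \<rho>] of_int_mult)
  moreover have "permute_list (?t \<circ> \<rho>) I = I"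
    using permute_list_compose[of \<rho> I ?t] \<rho> assms(2) 1 swap.IH by simp
  ultimately show ?case ..
qed

context young
begin

text \<open>Counting in the fibre of \<open>y\<close> through \<open>a\<close>. Sortedness of
  \<open>I\<close> gives at least as many entries up to \<open>I ! a\<close> as there are positions
  up to \<open>a\<close>. If the rearranged entry at \<open>a\<close> were larger, sortedness would
  leave such entries only at positions strictly before \<open>a\<close>. Yet \<open>\<tau>\<close>
  preserves their number.\<close>

lemma fsorted_permute_not_less:
  assumes \<tau>: "\<tau> \<in> stab N y" and len: "length I = N"
    and s: "fsorted N x y I" "fsorted N x y (permute_list \<tau> I)" and a: "a < N"
  shows "\<not> I ! a < permute_list \<tau> I ! a"
proof
  let ?J = "permute_list \<tau> I"
  assume less: "I ! a < ?J ! a"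
  define L where "L = {b. b < N \<and> y b = y a}"
  have fin: "finite L" by (simp add: L_def)
  note \<tau>p = stab_Sym[OF \<tau>]
  have nth: "?J ! b = I ! \<tau> b" if "b < N" for b
    using that \<tau>p len by (simp add: permute_list_nth)
  have sub1: "{b \<in> L. ?J ! b \<le> I ! a} \<subseteq> {b \<in> L. x b < x a}"
  proof clarify
    fix b assume b: "b \<in> L" "?J ! b \<le> I ! a"
    show "x b < x a"
    proof (rule ccontr)
      assume "\<not> x b < x a"
      then consider "x a < x b" | "x a = x b" by linarith
      then show False
      proof cases
        case 1
        then have "?J ! a \<le> ?J ! b" using s(2) a b(1) unfolding fsorted_def L_def by simp
        then show False using less b(2) by simp
      next
        case 2
        then have "a = b" using coord_inj a b(1) by (simp add: L_def)
        then show False using less b(2) by simp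
      qed
    qed
  qed
  have sub2: "{b \<in> L. x b \<le> x a} \<subseteq> {b \<in> L. I ! b \<le> I ! a}"
  proof clarify
    fix b assume b: "b \<in> L" "x b \<le> x a"
    then consider "x b < x a" | "x a = x b" by linarith
    then show "I ! b \<le> I ! a"
    proof cases
      case 1
      then show ?thesis using s(1) a b(1) unfolding fsorted_def L_def by simp
    next
      case 2
      then have "a = b" using coord_inj a b(1) by (simp add: L_def)
      then show ?thesis by simp
    qed
  qed
  have img: "\<tau> ` {b \<in> L. ?J ! b \<le> I ! a} = {b \<in> L. I ! b \<le> I ! a}"
  proof
    show "\<tau> ` {b \<in> L. ?J ! b \<le> I ! a} \<subseteq> {b \<in> L. I ! b \<le> I ! a}"
      using nth permutes_lt[OF \<tau>p] stab_apply[OF \<tau>] by (auto simp: L_def)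
    show "{b \<in> L. I ! b \<le> I ! a} \<subseteq> \<tau> ` {b \<in> L. ?J ! b \<le> I ! a}"
    proof clarify
      fix b assume b: "b \<in> L" "I ! b \<le> I ! a"
      have "inv \<tau> b < N" "y (inv \<tau> b) = y b"
        using b permutes_lt[OF permutes_inv[OF \<tau>p]] stab_apply[OF stab_inv[OF \<tau>]] by (auto simp: L_def)
      then have "inv \<tau> b \<in> {b \<in> L. ?J ! b \<le> I ! a}"
        using b nth permutes_inverses(1)[OF \<tau>p] by (simp add: L_def)
      then show "b \<in> \<tau> ` {b \<in> L. ?J ! b \<le> I ! a}"
        using permutes_inverses(1)[OF \<tau>p] by (metis imageI)
    qed
  qed
  have "card {b \<in> L. x b \<le> x a} \<le> card {b \<in> L. I ! b \<le> I ! a}"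
    using sub2 fin by (intro card_mono) auto
  also have "\<dots> = card {b \<in> L. ?J ! b \<le> I ! a}"
    unfolding img[symmetric] by (rule card_image[OF permutes_inj_on[OF \<tau>p]])
  also have "\<dots> \<le> card {b \<in> L. x b < x a}"
    using sub1 fin by (intro card_mono) auto
  also have "\<dots> < card {b \<in> L. x b \<le> x a}"
    using fin a by (intro psubset_card_mono) (auto simp: L_def)
  finally show False by simp
qed

lemma fsorted_unique:
  assumes \<tau>: "\<tau> \<in> stab N y" and len: "length I = N"
    and s: "fsorted N x y I" "fsorted N x y (permute_list \<tau> I)"
  shows "permute_list \<tau> I = I"
proof (rule nth_equalityI)
  fix a assume "a < length (permute_list \<tau> I)"
  then have a: "a < N" using len by simp
  have i: "permute_list (inv \<tau>) (permute_list \<tau> I) = I"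
    using permute_list_inv1 stab_Sym[OF \<tau>] len by blast
  have "\<not> permute_list \<tau> I ! a < I ! a"
    using fsorted_permute_not_less[OF stab_inv[OF \<tau>], of "permute_list \<tau> I" a] len s a unfolding i by simp
  then show "permute_list \<tau> I ! a = I ! a"
    using fsorted_permute_not_less[OF \<tau> len s a] by simp
qed simp

text \<open>Rearrangement inequality for two terms: the gain is \<open>f b - f a\<close> times the
  difference of the ranks of \<open>I ! a\<close> and \<open>I ! b\<close>, a product of positive
  numbers.\<close>

lemma key_swap:
  assumes R: "finite R" and I: "I \<in> seqs R N"
    and ab: "a < N" "b < N" "f a < f b" "I ! b < I ! a"
  shows "key R N f I < key R N f (permute_list (Transposition.transpose a b) I)"
proof -
  let ?J = "permute_list (Transposition.transpose a b) I"
  have len: "length I = N" and mem: "I ! b \<in> R" using I ab by (auto simp: seqs_def)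
  have ne: "a \<noteq> b" using ab by auto
  have nth: "?J ! c = I ! Transposition.transpose a b c" if "c < N" for c
    using that ab len by (simp add: permute_list_nth permutes_swap_id)
  have split: "key R N f K = f a * rank R (K ! a) + f b * rank R (K ! b) + (\<Sum>c\<in>{..<N} - {a} - {b}. f c * rank R (K ! c))" for K
    unfolding key_def using ab ne by (simp add: sum.remove[of _ a] sum.remove[of _ b])
  have "(\<Sum>c\<in>{..<N} - {a} - {b}. f c * rank R (?J ! c)) = (\<Sum>c\<in>{..<N} - {a} - {b}. f c * rank R (I ! c))"
    by (rule sum.cong) (auto simp: nth)
  moreover have "f a * rank R (I ! a) + f b * rank R (I ! b) < f a * rank R (I ! b) + f b * rank R (I ! a)"
  proof -
    obtain k m where "f b = f a + Suc k" "rank R (I ! a) = rank R (I ! b) + Suc m"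
      using ab rank_less[OF R mem ab(4)] less_imp_Suc_add by (metis add_Suc_right)
    then show ?thesis by (simp add: algebra_simps)
  qed
  ultimately show ?thesis unfolding split nth[OF ab(1)] nth[OF ab(2)] by simp
qed

text \<open>Rearrangement: a maximizer of the key in the orbit is sorted, and the sorted element is unique.\<close>

lemma key_rearrange:
  assumes R: "finite R" and I: "I \<in> seqs R N" and s: "fsorted N x y I" and \<tau>: "\<tau> \<in> stab N y"
  shows "key R N x (permute_list \<tau> I) \<le> key R N x I"
    and "key R N x (permute_list \<tau> I) = key R N x I \<Longrightarrow> permute_list \<tau> I = I"
proof -
  have len: "length I = N" using I by (simp add: seqs_def)
  let ?k = "\<lambda>\<tau>. key R N x (permute_list \<tau> I)"
  have max_sorted: "permute_list \<rho> I = I" if \<rho>: "\<rho> \<in> stab N y" and max: "\<And>\<tau>. \<tau> \<in> stab N y \<Longrightarrow> ?k \<tau> \<le> ?k \<rho>" for \<rho>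
  proof (rule fsorted_unique[OF \<rho> len s])
    let ?J = "permute_list \<rho> I"
    have J: "?J \<in> seqs R N" using I permute_seqs[OF stab_Sym[OF \<rho>]] by blast
    show "fsorted N x y ?J" unfolding fsorted_def
    proof (intro allI impI)
      fix a b assume ab: "a < N" "b < N" "y a = y b" "x a < x b"
      let ?t = "Transposition.transpose a b"
      have t: "?t \<in> stab N y" using ab by (intro stab_transpose) auto
      have "permute_list ?t ?J = permute_list (\<rho> \<circ> ?t) I"
        using permute_list_compose[of ?t I \<rho>] stab_Sym[OF t] len by simp
      then have "key R N x (permute_list ?t ?J) \<le> key R N x ?J"
        using max[OF stab_comp[OF \<rho> t]] by simp
      then show "?J ! a \<le> ?J ! b" using key_swap[OF R J ab(1,2), of x] ab by fastforce
    qed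
  qed
  have "Max (?k ` stab N y) \<in> ?k ` stab N y" by (rule Max_in) (simp, use stab_id[of N y] in blast)
  then obtain \<rho> where \<rho>: "\<rho> \<in> stab N y" "?k \<rho> = Max (?k ` stab N y)" by auto
  have max: "?k \<tau> \<le> ?k \<rho>" if "\<tau> \<in> stab N y" for \<tau> using that \<rho> by simp
  have kI: "?k \<rho> = key R N x I" using max_sorted[OF \<rho>(1) max] by simp
  then show "?k \<tau> \<le> key R N x I" using max[OF \<tau>] by simp
  show "permute_list \<tau> I = I" if "?k \<tau> = key R N x I"
    using max_sorted[OF \<tau>] max kI that by simp
qed

lemma ysym_\<delta>_apply:
  assumes "length J = N"
  shows "ysym N x y d (\<delta> I) J = (\<Sum>\<sigma>\<in>stab N x. \<Sum>\<tau>\<in>stab N y.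
     if permute_list \<tau> (permute_list \<sigma> J) = I
     then of_int (chi (\<not> d) \<sigma>) * of_int (chi d \<tau>) * (csign J \<sigma> * csign (permute_list \<sigma> J) \<tau>) else (0 :: 'a::field))"
proof -
  have "ysym N x y d (\<delta> I) J = (\<Sum>\<sigma>\<in>stab N x. \<Sum>\<tau>\<in>stab N y.
     of_int (chi (\<not> d) \<sigma>) * of_int (chi d \<tau>) * tact N (\<sigma> \<circ> \<tau>) (\<delta> I :: _ \<Rightarrow> 'a) J)"
    unfolding ysym_def symm_def tact_sum tact_sc fv.scale_sum_right pointwise
    by (intro sum.cong refl) (auto simp: tact_comp pointwise dest!: stab_Sym)
  also have "\<dots> = (\<Sum>\<sigma>\<in>stab N x. \<Sum>\<tau>\<in>stab N y.
     if permute_list \<tau> (permute_list \<sigma> J) = I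
     then of_int (chi (\<not> d) \<sigma>) * of_int (chi d \<tau>) * (csign J \<sigma> * csign (permute_list \<sigma> J) \<tau>) else (0 :: 'a))"
  proof (intro sum.cong refl)
    fix \<sigma> \<tau> assume "\<sigma> \<in> stab N x" "\<tau> \<in> stab N y"
    then have p: "\<sigma> permutes {..<N}" "\<tau> permutes {..<N}" by (auto dest: stab_Sym)
    show "of_int (chi (\<not> d) \<sigma>) * of_int (chi d \<tau>) * tact N (\<sigma> \<circ> \<tau>) (\<delta> I :: _ \<Rightarrow> 'a) J =
      (if permute_list \<tau> (permute_list \<sigma> J) = I
     then of_int (chi (\<not> d) \<sigma>) * of_int (chi d \<tau>) * (csign J \<sigma> * csign (permute_list \<sigma> J) \<tau>) else (0 :: 'a))"
      using p assms
      by (simp add: tact_apply[OF permutes_compose[OF p(2,1)]] csign_compose permute_list_compose \<delta>_def)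
  qed
  finally show ?thesis .
qed

text \<open>Triangularity of the matrix of \<open>ysym\<close>. The \<open>x\<close>-key ignores
  \<open>\<sigma>\<close>, and by rearrangement \<open>inv \<tau>\<close> cannot raise the key of
  the sorted \<open>I\<close>. If the keys agree, rearrangement gives
  \<open>permute_list \<sigma> J = I\<close>; as both sequences are sorted along the fibres of
  \<open>x\<close>, \<open>\<sigma>\<close> changes nothing either.\<close>

lemma sstd_reach:
  assumes R: "finite R" and I: "I \<in> seqs R N" "sstd N x y d I" and J: "J \<in> seqs R N" "sstd N x y d J"
    and st: "\<sigma> \<in> stab N x" "\<tau> \<in> stab N y" "permute_list \<tau> (permute_list \<sigma> J) = I"
  shows "key R N x J \<le> key R N x I"
    and "key R N x J = key R N x I \<Longrightarrow> J = I \<and> permute_list \<sigma> I = I \<and> permute_list \<tau> I = I"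
proof -
  have len: "length I = N" "length J = N" using I J by (auto simp: seqs_def)
  let ?J = "permute_list \<sigma> J"
  have k: "key R N x ?J = key R N x J" by (rule key_stab[OF st(1) len(2)])
  have i: "?J = permute_list (inv \<tau>) I"
    using permute_list_inv1[of \<tau> ?J] stab_Sym[OF st(2)] st(3) len by simp
  have s: "fsorted N x y I" "fsorted N y x I" "fsorted N y x J" using I J by (auto simp: sstd_def)
  show "key R N x J \<le> key R N x I"
    using key_rearrange(1)[OF R I(1) s(1) stab_inv[OF st(2)]] k i by simp
  assume "key R N x J = key R N x I"
  then have JI: "?J = I"
    using key_rearrange(2)[OF R I(1) s(1) stab_inv[OF st(2)]] k i by simp
  interpret D: young N y x "\<not> d" using young_dual young_axioms by blast
  have "?J = J" by (rule D.fsorted_unique[OF st(1) len(2) s(3)]) (use JI s in simp)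
  then show "J = I \<and> permute_list \<sigma> I = I \<and> permute_list \<tau> I = I"
    using JI st(3) by simp
qed

lemma ysym_diagonal:
  assumes R: "finite R" and I: "I \<in> seqs R N" "sstd N x y d I"
  shows "ysym N x y d (\<delta> I) I \<noteq> (0 :: 'a::field_char_0)"
proof -
  have len: "length I = N" using I by (simp add: seqs_def)
  define Q where "Q = {(\<sigma>, \<tau>). \<sigma> \<in> stab N x \<and> \<tau> \<in> stab N y \<and> permute_list \<tau> (permute_list \<sigma> I) = I}"
  have "ysym N x y d (\<delta> I) I = (\<Sum>\<sigma>\<in>stab N x. \<Sum>\<tau>\<in>stab N y. if (\<sigma>, \<tau>) \<in> Q then 1 else (0 :: 'a))"
    unfolding ysym_\<delta>_apply[OF len]
  proof (intro sum.cong refl)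
    fix \<sigma> \<tau> assume st: "\<sigma> \<in> stab N x" "\<tau> \<in> stab N y"
    show "(if permute_list \<tau> (permute_list \<sigma> I) = I
     then of_int (chi (\<not> d) \<sigma>) * of_int (chi d \<tau>) * (csign I \<sigma> * csign (permute_list \<sigma> I) \<tau>) else (0 :: 'a)) = (if (\<sigma>, \<tau>) \<in> Q then 1 else 0)"
    proof (cases "permute_list \<tau> (permute_list \<sigma> I) = I")
      case True
      have fix_st: "permute_list \<sigma> I = I" "permute_list \<tau> I = I"
        using sstd_reach(2)[OF R I I st True] by auto
      have "I ! \<sigma> a = I ! a" "I ! \<tau> a = I ! a" if "a < N" for a
        using fix_st that permute_list_nth[of \<sigma> I a] permute_list_nth[of \<tau> I a] stab_Sym[OF st(1)] stab_Sym[OF st(2)] len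
        by simp_all
      then have "\<sigma> \<in> stab N (\<lambda>a. (x a, I ! a))" "\<tau> \<in> stab N (\<lambda>a. (y a, I ! a))"
        using st by (auto simp: stab_def)
      then have "csign I \<sigma> = (of_int (chi (\<not> d) \<sigma>) :: 'a)" "csign I \<tau> = (of_int (chi d \<tau>) :: 'a)"
        using I(2) unfolding sstd_def by (auto intro!: conjunct1[OF csign_stab] len)
      then have "of_int (chi (\<not> d) \<sigma>) * of_int (chi d \<tau>) * (csign I \<sigma> * csign (permute_list \<sigma> I) \<tau>)
          = (of_int (chi (\<not> d) \<sigma>) * of_int (chi (\<not> d) \<sigma>)) * (of_int (chi d \<tau>) * of_int (chi d \<tau>) :: 'a)"
        unfolding fix_st by (simp only: mult_ac)
      then show ?thesis using True st by (simp add: Q_def)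
    qed (simp add: Q_def)
  qed
  also have "\<dots> = (\<Sum>z\<in>stab N x \<times> stab N y. if z \<in> Q then 1 else 0)"
    by (simp add: sum.cartesian_product)
  also have "\<dots> = (\<Sum>z\<in>Q. 1)"
    by (rule sum.mono_neutral_cong_right) (auto simp: Q_def)
  also have "\<dots> = of_nat (card Q)" by simp
  also have "\<dots> \<noteq> 0"
  proof -
    have "finite Q" by (rule finite_subset[of _ "stab N x \<times> stab N y"]) (auto simp: Q_def)
    moreover have "(id, id) \<in> Q" by (simp add: Q_def)
    ultimately have "card Q \<noteq> 0" by auto
    then show ?thesis by simp
  qed
  finally show ?thesis .
qed

text \<open>Evaluate the relation at a \<open>K\<close> of maximal key among the sequences with
  nonzero coefficient: triangularity leaves only the diagonal term.\<close>

lemma ysym_independent: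
  assumes R: "finite R"
    and zero: "(\<Sum>I\<in>{I \<in> seqs R N. sstd N x y d I}. sc (c I) (ysym N x y d (\<delta> I))) = (0 :: _ \<Rightarrow> 'a::field_char_0)"
    and I: "I \<in> seqs R N" "sstd N x y d I"
  shows "c I = 0"
proof (rule ccontr)
  let ?A = "{I \<in> seqs R N. sstd N x y d I}"
  assume cI: "c I \<noteq> 0"
  have fin: "finite ?A" using finite_seqs[OF R] by simp
  let ?B = "{I \<in> ?A. c I \<noteq> 0}"
  have finB: "finite ?B" using fin by (rule finite_subset[rotated]) auto
  then have "Max (key R N x ` ?B) \<in> key R N x ` ?B"
    using cI I by (intro Max_in finite_imageI) blast+
  then obtain K where K: "K \<in> ?B" "key R N x K = Max (key R N x ` ?B)" by auto
  have max: "key R N x I \<le> key R N x K" if "I \<in> ?B" for I using finB that unfolding K(2) by (intro Max_ge) blast+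
  have len: "length K = N" using K by (simp add: seqs_def)
  have zero': "c I * ysym N x y d (\<delta> I) K = 0" if "I \<in> ?A" "I \<noteq> K" for I
  proof (rule ccontr)
    assume nz: "c I * ysym N x y d (\<delta> I) K \<noteq> 0"
    have "\<exists>\<sigma>\<in>stab N x. \<exists>\<tau>\<in>stab N y. permute_list \<tau> (permute_list \<sigma> K) = I"
    proof (rule ccontr)
      assume "\<not> ?thesis"
      then have "ysym N x y d (\<delta> I) K = (0 :: 'a)"
        unfolding ysym_\<delta>_apply[OF len] by (intro sum.neutral ballI) auto
      then show False using nz by simp
    qed
    then obtain \<sigma> \<tau> where st: "\<sigma> \<in> stab N x" "\<tau> \<in> stab N y" "permute_list \<tau> (permute_list \<sigma> K) = I" by blast
    have "I \<in> ?B" using that nz by auto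
    then have "key R N x I \<le> key R N x K" by (rule max)
    then have "K = I"
      using sstd_reach[OF R _ _ _ _ st, of] that K by auto
    then show False using that by simp
  qed
  have "0 = (\<Sum>I\<in>?A. c I * ysym N x y d (\<delta> I) K)"
    using fun_cong[OF zero, of K] by (simp add: pointwise)
  also have "\<dots> = c K * ysym N x y d (\<delta> K) K"
  proof -
    have "(\<Sum>I\<in>?A - {K}. c I * ysym N x y d (\<delta> I) K) = 0"
      by (rule sum.neutral) (use zero' in blast)
    moreover have "K \<in> ?A" using K by blast
    ultimately show ?thesis using sum.remove[OF fin, of K "\<lambda>I. c I * ysym N x y d (\<delta> I) K"] by simp
  qed
  finally show False using ysym_diagonal[OF R, of K, where 'a = 'a] K by simp
qed

end


section \<open>Garnir straightening\<close>

context young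
begin

lemma ysym_tact:
  "\<tau> \<in> stab N y \<Longrightarrow> ysym N x y d (tact N \<tau> v) = sc (of_int (chi d \<tau>)) (ysym N x y d v)"
  by (simp add: ysym_def symm_tact symm_sc)

text \<open>The contribution of each \<open>\<tau>\<close> vanishes separately. A transposition in
  the stabilizer of \<open>f\<close> multiplies by its \<open>chi d\<close>, its conjugate by
  \<open>\<tau>\<close> lies in the stabilizer of \<open>x\<close> and multiplies by its
  \<open>chi (\<not> d)\<close>, and these signs are opposite.\<close>

lemma ysym_symm_zero:
  assumes clash: "\<And>\<tau>. \<tau> \<in> stab N y \<Longrightarrow> \<exists>a<N. \<exists>b<N. a \<noteq> b \<and> f a = f b \<and> x (\<tau> a) = x (\<tau> b)"
  shows "ysym N x y d (symm N f d v) = (0 :: _ \<Rightarrow> 'a::field_char_0)"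
proof -
  let ?v = "symm N f d v"
  have "symm N x (\<not> d) (tact N \<tau> ?v) = (0 :: _ \<Rightarrow> 'a)" if \<tau>: "\<tau> \<in> stab N y" for \<tau>
  proof -
    obtain a b where ab: "a < N" "b < N" "a \<noteq> b" "f a = f b" "x (\<tau> a) = x (\<tau> b)"
      using clash[OF \<tau>] by blast
    note p = stab_Sym[OF \<tau>]
    let ?s = "Transposition.transpose (\<tau> a) (\<tau> b)" and ?t = "Transposition.transpose a b"
    have s: "?s \<in> stab N x" using ab permutes_lt[OF p] by (intro stab_transpose) auto
    have t: "?t \<in> stab N f" using ab by (intro stab_transpose) auto
    have ne: "\<tau> a \<noteq> \<tau> b" using inj_eq[OF permutes_inj[OF p]] ab by simp
    have comm: "?s \<circ> \<tau> = \<tau> \<circ> ?t"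
      using inj_eq[OF permutes_inj[OF p]] by (auto simp: fun_eq_iff Transposition.transpose_def)
    let ?z = "symm N x (\<not> d) (tact N \<tau> ?v)"
    have "sc (of_int (chi (\<not> d) ?s)) ?z = symm N x (\<not> d) (tact N ?s (tact N \<tau> ?v))"
      by (rule symm_tact[OF s, symmetric])
    also have "tact N ?s (tact N \<tau> ?v) = tact N \<tau> (tact N ?t ?v)"
      unfolding tact_comp[OF stab_Sym[OF s] p, symmetric] comm by (rule tact_comp[OF p stab_Sym[OF t]])
    also have "\<dots> = sc (of_int (chi d ?t)) (tact N \<tau> ?v)"
      by (simp only: tact_symm[OF t] tact_sc)
    finally have "sc (of_int (chi (\<not> d) ?s)) ?z = sc (of_int (chi d ?t)) ?z"
      by (simp only: symm_sc)
    then have "sc 1 ?z = sc (- 1) ?z"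
      unfolding chi_transpose[OF ne] chi_transpose[OF ab(3)] by (cases d) simp_all
    then have "?z I = - ?z I" for I by (simp add: fun_eq_iff pointwise)
    then show ?thesis by (simp add: fun_eq_iff pointwise)
  qed
  then show ?thesis
    unfolding ysym_def symm_def[of N y] symm_sum symm_sc by (intro sum.neutral) simp
qed

context
  fixes R :: "idx set" and I :: "idx list" and r c p q :: nat
  assumes R: "finite R" and I: "I \<in> seqs R N" and sorted: "fsorted N x y I"
    and p: "p < N" "x p = r" "y p = c" and q: "q < N" "x q = r" "y q = Suc c"
    and viol: "I ! q < I ! p \<or> (I ! q = I ! p \<and> par (I ! p) = d)"
begin

text \<open>With \<open>x\<close> as row and \<open>y\<close> as column, \<open>garA\<close> and
  \<open>garB\<close> are the part of column \<open>c\<close> from row \<open>r\<close> downward and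
  the part of column \<open>Suc c\<close> down to row \<open>r\<close>, the cells around the
  violation.\<close>

definition "garA = {a. a < N \<and> y a = c \<and> r \<le> x a}"
definition "garB = {a. a < N \<and> y a = Suc c \<and> x a \<le> r}"
text \<open>Constant on the Garnir set and injective outside it, where the values
  \<open>Suc a\<close> also avoid 0. Its stabilizer is therefore the symmetric group of the Garnir
  set.\<close>

definition "garF a = (if a \<in> garA \<union> garB then 0 else Suc a)"

lemma garF_eq_iff: "a \<noteq> b \<Longrightarrow> garF a = garF b \<longleftrightarrow> a \<in> garA \<union> garB \<and> b \<in> garA \<union> garB"
  by (auto simp: garF_def)

lemma gar_finite: "finite garA" "finite garB" "garA \<inter> garB = {}"
  by (auto simp: garA_def garB_def)

text \<open>Pigeonhole: the Garnir set has one element more than the fibre of \<open>y\<close> over \<open>c\<close>.\<close>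

lemma garnir_clash:
  assumes \<tau>: "\<tau> \<in> stab N y"
  shows "\<exists>a<N. \<exists>b<N. a \<noteq> b \<and> garF a = garF b \<and> x (\<tau> a) = x (\<tau> b)"
proof (rule ccontr)
  assume no: "\<not> ?thesis"
  let ?D = "garA \<union> garB"
  define L where "L = {a. a < N \<and> y a = c}"
  have fin: "finite L" by (simp add: L_def)
  have inj: "inj_on (\<lambda>a. x (\<tau> a)) ?D"
  proof (rule inj_onI, rule ccontr)
    fix a b assume ab: "a \<in> ?D" "b \<in> ?D" "x (\<tau> a) = x (\<tau> b)" "a \<noteq> b"
    then have "a < N" "b < N" by (auto simp: garA_def garB_def)
    then show False using no ab garF_eq_iff by blast
  qed
  have "(\<lambda>a. x (\<tau> a)) ` ?D \<subseteq> x ` L"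
  proof clarify
    fix a assume a: "a \<in> ?D"
    then have aN: "a < N" by (auto simp: garA_def garB_def)
    have "\<tau> a < N" "y (\<tau> a) = y a" using aN permutes_lt[OF stab_Sym[OF \<tau>]] stab_apply[OF \<tau>] by auto
    moreover have "c \<le> y a" using a by (auto simp: garA_def garB_def)
    ultimately obtain b where "b < N" "x b = x (\<tau> a)" "y b = c"
      using coord_down[of "\<tau> a" "x (\<tau> a)" c] by auto
    then show "x (\<tau> a) \<in> x ` L" by (auto simp: L_def image_iff intro!: bexI[of _ b])
  qed
  then have "card ?D \<le> card (x ` L)"
    using card_mono[OF finite_imageI[OF fin]] card_image[OF inj] by metis
  also have "\<dots> \<le> card L" by (rule card_image_le[OF fin])
  finally have le: "card garA + card garB \<le> card L"
    using card_Un_disjoint[OF gar_finite] by simp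
  have "L = garA \<union> {a \<in> L. x a < r}" by (auto simp: L_def garA_def)
  then have "card L \<le> card garA + card {a \<in> L. x a < r}" by (metis card_Un_le)
  moreover have "card {a \<in> L. x a < r} \<le> card {..<r}"
    by (rule card_inj_on_le[of x]) (auto simp: L_def inj_on_def intro: coord_inj)
  moreover have "{..r} \<subseteq> x ` garB"
  proof
    fix s assume "s \<in> {..r}"
    then obtain b where "b < N" "x b = s" "y b = Suc c"
      using coord_down[OF q(1), of s "Suc c"] q by auto
    then show "s \<in> x ` garB" using \<open>s \<in> {..r}\<close> by (auto simp: garB_def)
  qed
  then have "card {..r} \<le> card garB"
    using card_mono[OF finite_imageI[OF gar_finite(2)]] card_image_le[OF gar_finite(2), of x] le_trans by blast
  ultimately show False using le by simp
qed

text \<open>With \<open>garB_le\<close> and the violation, the entries on \<open>garB\<close> are at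
  most \<open>I ! p\<close> and those on \<open>garA\<close> at least \<open>I ! p\<close>, so
  exchanging entries between the two sets cannot lower the \<open>y\<close>-key.\<close>

lemma garA_ge: "a \<in> garA \<Longrightarrow> I ! p \<le> I ! a"
proof -
  assume "a \<in> garA"
  then have a: "a < N" "y a = c" "r \<le> x a" by (auto simp: garA_def)
  show "I ! p \<le> I ! a"
  proof (cases "x a = r")
    case True
    then have "a = p" using a p coord_inj by simp
    then show ?thesis by simp
  next
    case False
    then show ?thesis using sorted a p unfolding fsorted_def by simp
  qed
qed

lemma garB_le: "a \<in> garB \<Longrightarrow> I ! a \<le> I ! q"
proof -
  assume "a \<in> garB"
  then have a: "a < N" "y a = Suc c" "x a \<le> r" by (auto simp: garB_def)
  show "I ! a \<le> I ! q"
  proof (cases "x a = r")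
    case True
    then have "a = q" using a q coord_inj by simp
    then show ?thesis by simp
  next
    case False
    then show ?thesis using sorted a q unfolding fsorted_def by simp
  qed
qed

text \<open>The weight on \<open>garB\<close> is one more than on \<open>garA\<close>, so the key
  changes by the entries on \<open>D1\<close>, which enter \<open>garB\<close>, minus those on
  \<open>D2\<close>, which leave it. The two sets have equal size, and their entries lie on the two
  sides of \<open>I ! p\<close>; an unchanged key leaves no room on either side.\<close>

lemma garnir_key:
  assumes g: "g \<in> stab N garF"
  defines "D1 \<equiv> g ` garB - garB" and "D2 \<equiv> garB - g ` garB"
  shows "key R N y I \<le> key R N y (permute_list g I)"
    and "key R N y (permute_list g I) = key R N y I \<Longrightarrow> a \<in> D1 \<union> D2 \<Longrightarrow> I ! a = I ! p"
    and "D1 \<subseteq> garA" "card D1 = card D2"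
proof -
  let ?D = "garA \<union> garB" and ?w = "\<lambda>a. rank R (I ! a)"
  note gp = stab_Sym[OF g]
  have len: "length I = N" and mem: "\<And>a. a < N \<Longrightarrow> I ! a \<in> R" using I by (auto simp: seqs_def)
  have DN: "?D \<subseteq> {..<N}" by (auto simp: garA_def garB_def)
  have gD: "g a \<in> ?D \<longleftrightarrow> a \<in> ?D" if "a < N" for a
    using stab_apply[OF g that] by (auto simp: garF_def split: if_splits)
  have gout: "g a = a" if "a \<notin> ?D" for a
  proof (cases "a < N")
    case True
    then show ?thesis using stab_apply[OF g True] gD[OF True] that by (simp add: garF_def)
  qed (use permutes_not_in[OF gp] in simp)
  have gimg: "g ` ?D = ?D"
  proof
    show sub: "g ` ?D \<subseteq> ?D" using gD DN by blast
    show "?D \<subseteq> g ` ?D"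
      using card_image[OF permutes_inj_on[OF gp], of ?D] sub gar_finite
      by (metis card_subset_eq finite_Un order_refl)
  qed
  have D1A: "D1 \<subseteq> garA" using gimg unfolding D1_def by blast
  then show "D1 \<subseteq> garA" .
  have fins: "finite (g ` garB)" "finite D1" "finite D2" using gar_finite by (auto simp: D1_def D2_def)
  have cimg: "card (g ` garB) = card garB" by (rule card_image[OF permutes_inj_on[OF gp]])
  show card12: "card D1 = card D2"
    using card_le_sym_Diff[of "g ` garB" garB] card_le_sym_Diff[of garB "g ` garB"] fins gar_finite cimg
    unfolding D1_def D2_def by simp
  \<comment> \<open>Weight \<open>c\<close> on the whole Garnir set and one more on
    \<open>garB\<close>. The first two summands are untouched by \<open>g\<close>, so only the sum
    over \<open>garB\<close> counts.\<close>
  have k: "key R N y J = (\<Sum>a\<in>{..<N} - ?D. y a * rank R (J ! a)) + (c * (\<Sum>a\<in>?D. rank R (J ! a)) + (\<Sum>a\<in>garB. rank R (J ! a)))" for J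
  proof -
    have "key R N y J = (\<Sum>a\<in>{..<N} - ?D. y a * rank R (J ! a)) + (\<Sum>a\<in>?D. y a * rank R (J ! a))"
      unfolding key_def by (rule sum.subset_diff[OF DN]) simp
    also have "(\<Sum>a\<in>?D. y a * rank R (J ! a)) = (\<Sum>a\<in>garA. y a * rank R (J ! a)) + (\<Sum>a\<in>garB. y a * rank R (J ! a))"
      by (rule sum.union_disjoint[OF gar_finite])
    also have "(\<Sum>a\<in>garA. y a * rank R (J ! a)) = c * (\<Sum>a\<in>garA. rank R (J ! a))"
      unfolding sum_distrib_left by (rule sum.cong) (auto simp: garA_def)
    also have "(\<Sum>a\<in>garB. y a * rank R (J ! a)) = Suc c * (\<Sum>a\<in>garB. rank R (J ! a))"
      unfolding sum_distrib_left by (rule sum.cong) (auto simp: garB_def)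
    finally show ?thesis by (simp add: sum.union_disjoint[OF gar_finite] algebra_simps)
  qed
  have nth: "permute_list g I ! a = I ! g a" if "a < N" for a using that gp len by (simp add: permute_list_nth)
  have 1: "(\<Sum>a\<in>{..<N} - ?D. y a * rank R (permute_list g I ! a)) = (\<Sum>a\<in>{..<N} - ?D. y a * ?w a)"
    by (rule sum.cong) (auto simp: nth gout)
  have reidx: "(\<Sum>a\<in>S. rank R (permute_list g I ! a)) = (\<Sum>a\<in>g ` S. ?w a)" if "S \<subseteq> ?D" for S
  proof -
    have "(\<Sum>a\<in>g ` S. ?w a) = (\<Sum>a\<in>S. ?w (g a))"
      using sum.reindex[OF permutes_inj_on[OF gp], of ?w S] by (simp add: o_def)
    also have "\<dots> = (\<Sum>a\<in>S. rank R (permute_list g I ! a))"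
      by (rule sum.cong) (use that DN in \<open>auto simp: nth subset_iff\<close>)
    finally show ?thesis ..
  qed
  have eq1: "key R N y (permute_list g I) + (\<Sum>a\<in>garB. ?w a) = key R N y I + (\<Sum>a\<in>g ` garB. ?w a)"
    unfolding k 1 using reidx[of ?D] reidx[of garB] gimg by simp
  have sB: "(\<Sum>a\<in>garB. ?w a) = (\<Sum>a\<in>garB \<inter> g ` garB. ?w a) + (\<Sum>a\<in>D2. ?w a)"
    unfolding D2_def by (rule sum.Int_Diff[OF gar_finite(2)])
  have sG: "(\<Sum>a\<in>g ` garB. ?w a) = (\<Sum>a\<in>garB \<inter> g ` garB. ?w a) + (\<Sum>a\<in>D1. ?w a)"
    unfolding D1_def using sum.Int_Diff[OF fins(1), of ?w garB] by (simp add: Int_commute)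
  have eq: "key R N y (permute_list g I) + (\<Sum>a\<in>D2. ?w a) = key R N y I + (\<Sum>a\<in>D1. ?w a)"
    using eq1 sB sG by simp
  let ?v = "?w p"
  have ge: "?v \<le> ?w a" if "a \<in> D1" for a
    using rank_mono[OF R garA_ge] that D1A by blast
  have qp: "I ! q \<le> I ! p" using viol by auto
  have le: "?w a \<le> ?v" if "a \<in> D2" for a
    using rank_mono[OF R order_trans[OF garB_le qp]] that unfolding D2_def by blast
  have s1: "card D1 * ?v \<le> (\<Sum>a\<in>D1. ?w a)" using sum_mono[of D1 "\<lambda>_. ?v" ?w] ge by simp
  have s2: "(\<Sum>a\<in>D2. ?w a) \<le> card D2 * ?v" using sum_mono[of D2 ?w "\<lambda>_. ?v"] le by simp
  show "key R N y I \<le> key R N y (permute_list g I)" using eq s1 s2 card12 by simp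
  show "I ! a = I ! p" if ke: "key R N y (permute_list g I) = key R N y I" and a: "a \<in> D1 \<union> D2"
  proof -
    have e1: "(\<Sum>a\<in>D1. ?w a) = card D1 * ?v" and e2: "(\<Sum>a\<in>D2. ?w a) = card D2 * ?v"
      using eq s1 s2 card12 ke by simp_all
    have "?w a = ?v"
    proof (cases "a \<in> D1")
      case True
      show ?thesis
      proof (rule ccontr)
        assume "?w a \<noteq> ?v"
        then have "(\<Sum>b\<in>D1. ?v) < (\<Sum>b\<in>D1. ?w b)"
          using ge True fins by (intro sum_strict_mono_ex1) (auto intro!: bexI[of _ a] le_neq_trans)
        then show False using e1 by simp
      qed
    next
      case False
      then have aD: "a \<in> D2" using a by blast
      show ?thesis
      proof (rule ccontr)
        assume "?w a \<noteq> ?v"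
        then have "(\<Sum>b\<in>D2. ?w b) < (\<Sum>b\<in>D2. ?v)"
          using le aD fins by (intro sum_strict_mono_ex1) (auto intro!: bexI[of _ a] le_neq_trans)
        then show False using e2 by simp
      qed
    qed
    moreover have "a < N" using a D1A unfolding D2_def garA_def garB_def by auto
    ultimately show ?thesis using rank_inj[OF R] mem p(1) by blast
  qed
qed

text \<open>If the key does not change, \<open>g\<close> only exchanges entries equal to \<open>I ! p\<close> between the two fibres, so
  up to a permutation \<open>h\<close> of equal entries it lies in the stabilizer of \<open>y\<close>.\<close>

lemma garnir_equal_term:
  assumes g: "g \<in> stab N garF" and ke: "key R N y (permute_list g I) = key R N y I"
  shows "sc (of_int (chi d (inv g))) (ysym N x y d (tact N (inv g) (\<delta> I))) = (ysym N x y d (\<delta> I) :: _ \<Rightarrow> 'a::field)"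
proof -
  define D1 where "D1 = g ` garB - garB"
  define D2 where "D2 = garB - g ` garB"
  note gk = garnir_key[OF g, folded D1_def D2_def]
  note gp = stab_Sym[OF g]
  have len: "length I = N" using I by (simp add: seqs_def)
  have dis: "D1 \<inter> D2 = {}" and fin: "finite D1" "finite D2"
    using gar_finite by (auto simp: D1_def D2_def)
  have DN: "D1 \<union> D2 \<subseteq> {..<N}" using gk(3) by (auto simp: D2_def garA_def garB_def)
  obtain \<phi> where \<phi>: "bij_betw \<phi> D1 D2" using bij_betw_iff_card[OF fin] gk(4) by blast
  let ?\<psi> = "inv_into D1 \<phi>"
  have \<psi>: "bij_betw ?\<psi> D2 D1" by (rule bij_betw_inv_into[OF \<phi>])
  \<comment> \<open>The involution that exchanges \<open>D1\<close> and \<open>D2\<close> along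
    \<open>\<phi>\<close>. Composed with \<open>g\<close> it maps \<open>garB\<close> to itself,
    hence also \<open>garA\<close>.\<close>
  define h where "h a = (if a \<in> D1 then \<phi> a else if a \<in> D2 then ?\<psi> a else a)" for a
  have h1: "h a \<in> D2" if "a \<in> D1" for a using that bij_betwE[OF \<phi>] by (simp add: h_def)
  have h2: "h a \<in> D1" if "a \<in> D2" for a using that bij_betwE[OF \<psi>] dis by (auto simp: h_def)
  have h0: "h a = a" if "a \<notin> D1" "a \<notin> D2" for a using that by (simp add: h_def)
  have hh: "h (h a) = a" for a
  proof -
    consider "a \<in> D1" | "a \<in> D2" | "a \<notin> D1" "a \<notin> D2" by blast
    then show ?thesis
    proof cases
      case 1
      then have "\<phi> a \<in> D2" using bij_betwE[OF \<phi>] by blast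
      then show ?thesis using 1 dis bij_betw_inv_into_left[OF \<phi>] by (auto simp: h_def)
    next
      case 2
      then have "?\<psi> a \<in> D1" using bij_betwE[OF \<psi>] by blast
      then show ?thesis using 2 dis bij_betw_inv_into_right[OF \<phi>] by (auto simp: h_def)
    next
      case 3
      then show ?thesis by (simp add: h0)
    qed
  qed
  have bij: "bij h" by (rule o_bij[of h]) (auto simp: fun_eq_iff hh)
  have hp: "h permutes {..<N}"
    unfolding permutes_def
  proof (intro conjI allI impI)
    fix a assume "a \<notin> {..<N}"
    then show "h a = a" using DN h0 by blast
  next
    fix b show "\<exists>!a. h a = b" using bij by (simp add: bij_iff)
  qed
  have hinv: "inv h = h" using hh by (intro inv_equality) auto
  define f where "f a = (if a \<in> D1 \<union> D2 then 0 else Suc a)" for a :: nat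
  have hf: "h \<in> stab N f"
    using hp h1 h2 h0 by (auto simp: stab_def f_def)
  have "csign I h = (of_int (chi d h) :: 'a) \<and> permute_list h I = I"
  proof (rule csign_stab[OF hf len])
    fix a b assume ab: "a < N" "b < N" "a \<noteq> b" "f a = f b"
    then have D: "a \<in> D1 \<union> D2" "b \<in> D1 \<union> D2" by (auto simp: f_def split: if_splits)
    have vals: "I ! a = I ! p" "I ! b = I ! p" using gk(2)[OF ke] D by blast+
    \<comment> \<open>An entry on \<open>D2\<close> equals \<open>I ! p\<close> and is at most
      \<open>I ! q\<close>, so the violation must be an equality of entries of parity
      \<open>d\<close>, the parity for which the Koszul sign of \<open>h\<close> is
      \<open>chi d h\<close>.\<close>
    have "D2 \<noteq> {}" using D bij_betwE[OF \<phi>] by blast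
    then obtain e where e: "e \<in> D2" by blast
    then have "I ! p \<le> I ! q" using gk(2)[OF ke, of e] garB_le[of e] by (auto simp: D2_def)
    then have "par (I ! p) = d" using viol by auto
    then show "I ! a = I ! b \<and> par (I ! a) = d" using vals by simp
  qed
  then have cs: "csign I h = (of_int (chi d h) :: 'a)" "permute_list h I = I" by auto
  let ?k = "h \<circ> g"
  have kp: "?k permutes {..<N}" by (rule permutes_compose[OF gp hp])
  have hg: "h ` (g ` garB) \<subseteq> garB"
  proof clarify
    fix a assume a: "a \<in> garB"
    show "h (g a) \<in> garB"
    proof (cases "g a \<in> garB")
      case True
      then have "g a \<notin> D1" "g a \<notin> D2" using a by (auto simp: D1_def D2_def)
      then show ?thesis using h0 True by simp
    next
      case False
      then have "g a \<in> D1" using a by (auto simp: D1_def)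
      then show ?thesis using h1 by (auto simp: D2_def)
    qed
  qed
  have k_img: "?k ` garB = garB"
    using hg card_image[OF permutes_inj_on[OF kp], of garB] gar_finite(2)
    by (metis card_subset_eq image_comp)
  have ky: "?k \<in> stab N y"
  proof -
    have "y (?k a) = y a" if aN: "a < N" for a
    proof (cases "a \<in> garB")
      case True
      then have "?k a \<in> garB" using k_img by blast
      then show ?thesis using True by (simp add: garB_def)
    next
      case False
      have kB: "?k a \<notin> garB"
      proof
        assume "?k a \<in> garB"
        then have "?k a \<in> ?k ` garB" by (simp only: k_img)
        then obtain b where b: "?k a = ?k b" "b \<in> garB" by (rule imageE)
        have "a = b" by (rule injD[OF permutes_inj[OF kp] b(1)])
        then show False using False b by simp
      qed
      have gF: "garF (g a) = garF a" by (rule stab_apply[OF g aN])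
      show ?thesis
      proof (cases "a \<in> garA")
        case True
        then have "g a \<in> garA \<union> garB" using gF by (auto simp: garF_def split: if_splits)
        then have "?k a \<in> garA \<union> garB"
          using h1 h2 h0 gk(3) by (cases "g a \<in> D1"; cases "g a \<in> D2") (auto simp: D2_def)
        then show ?thesis using True kB by (simp add: garA_def)
      next
        case nA: False
        then have "g a = a" using gF False by (auto simp: garF_def split: if_splits)
        moreover have "a \<notin> D1" "a \<notin> D2" using nA False gk(3) by (auto simp: D2_def)
        ultimately show ?thesis using h0 by simp
      qed
    qed
    then show ?thesis using kp by (simp add: stab_def)
  qed
  \<comment> \<open>\<open>h\<close> acts on \<open>I\<close> by its character and
    \<open>inv ?k\<close> is absorbed by the symmetrizer with its own; the product of the two is the
    character of \<open>inv g\<close>, which cancels.\<close>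
  have ig: "inv g = inv ?k \<circ> h"
  proof -
    have "inv ?k \<circ> h = inv g \<circ> (inv h \<circ> h)" using inv_comp[OF hp gp] by (simp only: o_assoc)
    then show ?thesis using permutes_inv_o[OF hp] by simp
  qed
  have T: "tact N (inv g) (\<delta> I) = sc (of_int (chi d h)) (tact N (inv ?k) (\<delta> I :: _ \<Rightarrow> 'a))"
    unfolding ig tact_comp[OF permutes_inv[OF kp] hp] tact_\<delta>[OF hp len] hinv cs tact_sc ..
  have "chi d (inv g) = chi d (inv ?k) * chi d h"
    unfolding ig by (rule chi_comp[OF permutes_inv[OF kp] hp])
  then show ?thesis
    unfolding T ysym_sc ysym_tact[OF stab_inv[OF ky]]
    by (simp add: mult_ac)
qed

text \<open>In the Garnir relation all terms with unchanged key coincide by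
  \<open>garnir_equal_term\<close>. Their number is positive, as the identity is among them, and
  every other term has a larger key.\<close>

lemma garnir_straighten:
  assumes sub: "\<And>J. J \<in> seqs R N \<Longrightarrow> key R N y I < key R N y J \<Longrightarrow> ysym N x y d (\<delta> J) \<in> fv.span S"
  shows "ysym N x y d (\<delta> I) \<in> fv.span (S :: (_ \<Rightarrow> 'a::field_char_0) set)"
proof -
  have len: "length I = N" using I by (simp add: seqs_def)
  let ?G = "stab N garF"
  let ?t = "\<lambda>g. sc (of_int (chi d (inv g))) (ysym N x y d (tact N (inv g) (\<delta> I))) :: _ \<Rightarrow> 'a"
  let ?Q = "{g \<in> ?G. key R N y (permute_list g I) = key R N y I}"
  have "0 = ysym N x y d (symm N garF d (\<delta> I) :: _ \<Rightarrow> 'a)"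
    by (rule ysym_symm_zero[symmetric]) (rule garnir_clash)
  also have "\<dots> = (\<Sum>g\<in>?G. sc (of_int (chi d g)) (ysym N x y d (tact N g (\<delta> I))))"
    unfolding symm_def ysym_sum ysym_sc ..
  \<comment> \<open>Passing to inverses makes \<open>permute_list g I\<close> the index of each
    term, the form in which \<open>garnir_key\<close> compares keys.\<close>
  also have "\<dots> = (\<Sum>g\<in>?G. ?t g)"
    by (rule sum.reindex_bij_betw[OF bij_stab_inv, symmetric])
  also have "\<dots> = (\<Sum>g\<in>?Q. ?t g) + (\<Sum>g\<in>?G - ?Q. ?t g)"
    by (subst sum.subset_diff[of ?Q]) (auto simp: add.commute)
  also have "(\<Sum>g\<in>?Q. ?t g) = (\<Sum>g\<in>?Q. sc 1 (ysym N x y d (\<delta> I)))"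
    by (rule sum.cong) (simp_all add: garnir_equal_term)
  also have "\<dots> = sc (of_nat (card ?Q)) (ysym N x y d (\<delta> I))"
    by (simp only: fv.scale_sum_left[symmetric] sum_constant mult_1_right)
  finally have "sc (of_nat (card ?Q)) (ysym N x y d (\<delta> I)) + (\<Sum>g\<in>?G - ?Q. ?t g) = 0"
    by (rule sym)
  then have eq: "sc (of_nat (card ?Q)) (ysym N x y d (\<delta> I)) = - (\<Sum>g\<in>?G - ?Q. ?t g)"
    by (simp only: eq_neg_iff_add_eq_0)
  have "(\<Sum>g\<in>?G - ?Q. ?t g) \<in> fv.span S"
  proof (intro fv.span_sum fv.span_scale)
    fix g assume g: "g \<in> ?G - ?Q"
    then have gG: "g \<in> ?G" by blast
    note gp = stab_Sym[OF gG]
    have "key R N y I < key R N y (permute_list g I)"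
      using garnir_key(1)[OF gG] g by auto
    moreover have "permute_list g I \<in> seqs R N" using permute_seqs[OF gp] I by blast
    ultimately have "ysym N x y d (\<delta> (permute_list g I)) \<in> fv.span S" using sub by blast
    then show "ysym N x y d (tact N (inv g) (\<delta> I)) \<in> fv.span S"
      unfolding tact_\<delta>[OF permutes_inv[OF gp] len] permutes_inv_inv[OF gp] ysym_sc by (rule fv.span_scale)
  qed
  then have "sc (of_nat (card ?Q)) (ysym N x y d (\<delta> I)) \<in> fv.span S"
    unfolding eq by (rule fv.span_neg)
  then have in_span: "sc (inverse (of_nat (card ?Q))) (sc (of_nat (card ?Q)) (ysym N x y d (\<delta> I))) \<in> fv.span S"
    by (rule fv.span_scale)
  have "id \<in> ?Q" by (simp only: mem_Collect_eq stab_id permute_list_id simp_thms)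
  moreover have "finite ?Q" by (rule finite_subset[OF _ finite_stab[of N garF]]) blast
  ultimately have "card ?Q \<noteq> 0" by (subst card_0_eq) blast+
  then have "of_nat (card ?Q) \<noteq> (0 :: 'a)" by (simp only: of_nat_eq_0_iff simp_thms)
  then show ?thesis using in_span unfolding fv.scale_scale by (simp only: left_inverse fv.scale_one simp_thms)
qed

end

text \<open>Take the cell \<open>c\<close> just before \<open>b\<close>. If \<open>c\<close> and
  \<open>b\<close> do not violate, the entry at \<open>c\<close> is smaller than that at
  \<open>b\<close>, or equal to it with the harmless parity; hence \<open>a\<close> and
  \<open>c\<close> violate, at a smaller distance.\<close>

lemma adjacent_violation:
  assumes ab: "a < N" "b < N" "x a = x b" "y a < y b"
    and viol: "I ! b < I ! a \<or> (I ! b = I ! a \<and> par (I ! a) = d)"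
  obtains p q where "p < N" "q < N" "x p = x q" "y q = Suc (y p)"
    "I ! q < I ! p \<or> (I ! q = I ! p \<and> par (I ! p) = d)"
proof -
  have "\<exists>p q. p < N \<and> q < N \<and> x p = x q \<and> y q = Suc (y p) \<and> (I ! q < I ! p \<or> (I ! q = I ! p \<and> par (I ! p) = d))"
    using assms
  proof (induction "y b - y a" arbitrary: b rule: less_induct)
    case less
    show ?case
    proof (cases "y b = Suc (y a)")
      case True
      then show ?thesis using less.prems by blast
    next
      case False
      then obtain c where c: "c < N" "x c = x b" "y c = y b - 1"
        using coord_down[of b "x b" "y b - 1"] less.prems by auto
      have yc: "y a < y c" "y b = Suc (y c)" using c False less.prems by auto
      show ?thesis
      proof (cases "I ! b < I ! c \<or> (I ! b = I ! c \<and> par (I ! c) = d)")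
        case True
        then show ?thesis using c yc less.prems by blast
      next
        case nv: False
        have v: "I ! c < I ! a \<or> (I ! c = I ! a \<and> par (I ! a) = d)"
          using nv less.prems(5) by (cases "I ! b" "I ! c" rule: linorder_cases) auto
        show ?thesis
        proof (rule less.hyps[OF _ less.prems(1) c(1) _ yc(1) v])
          show "y c - y a < y b - y a" using yc by simp
          show "x a = x c" using c(2) less.prems(3) by simp
        qed
      qed
    qed
  qed
  then show ?thesis using that by blast
qed

text \<open>Straightening terminates because the pair of keys grows lexicographically and is bounded
  by \<open>key_le\<close>: a Garnir step raises the \<open>y\<close>-key, and sorting a fibre of
  \<open>y\<close> preserves it and raises the \<open>x\<close>-key. A Garnir step is taken only
  once the fibres of \<open>y\<close> are sorted, as its estimates require.\<close>

lemma ysym_\<delta>_span: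
  assumes R: "finite R" and I: "I \<in> seqs R N"
  shows "ysym N x y d (\<delta> I) \<in> fv.span ((\<lambda>J. ysym N x y d (\<delta> J) :: _ \<Rightarrow> 'a::field_char_0) ` {J \<in> seqs R N. sstd N x y d J})"
    (is "_ \<in> fv.span ?S")
  using I
proof (induction "((\<Sum>a<N. y a * card R) - key R N y I, (\<Sum>a<N. x a * card R) - key R N x I)" arbitrary: I
    rule: wf_induct_rule[OF wf_lex_prod[OF wf_less_than wf_less_than]])
  case (1 I)
  have IH: "ysym N x y d (\<delta> J) \<in> fv.span ?S" if "J \<in> seqs R N"
    and "key R N y I < key R N y J \<or> (key R N y I = key R N y J \<and> key R N x I < key R N x J)" for J
  proof (rule 1(1)[OF _ that(1)])
    show "(((\<Sum>a<N. y a * card R) - key R N y J, (\<Sum>a<N. x a * card R) - key R N x J),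
        ((\<Sum>a<N. y a * card R) - key R N y I, (\<Sum>a<N. x a * card R) - key R N x I)) \<in> less_than <*lex*> less_than"
      using that(2) key_le[OF R, of N y J] key_le[OF R, of N x J] by auto
  qed
  have len: "length I = N" using 1(2) by (simp add: seqs_def)
  have swap: "ysym N x y d (\<delta> (permute_list (Transposition.transpose a b) I)) =
      sc (csign I (Transposition.transpose a b) * of_int (chi d (Transposition.transpose a b))) (ysym N x y d (\<delta> I) :: _ \<Rightarrow> 'a)"
    if "a < N" "b < N" "y a = y b" for a b
  proof -
    let ?t = "Transposition.transpose a b"
    have t: "?t \<in> stab N y" using that by (intro stab_transpose) auto
    have "ysym N x y d (tact N ?t (\<delta> I)) = sc (csign I ?t) (ysym N x y d (\<delta> (permute_list ?t I)) :: _ \<Rightarrow> 'a)"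
      unfolding tact_\<delta>[OF stab_Sym[OF t] len] ysym_sc by simp
    then have "sc (csign I ?t) (ysym N x y d (\<delta> (permute_list ?t I))) = sc (of_int (chi d ?t)) (ysym N x y d (\<delta> I) :: _ \<Rightarrow> 'a)"
      unfolding ysym_tact[OF t] by simp
    then have "sc (csign I ?t) (sc (csign I ?t) (ysym N x y d (\<delta> (permute_list ?t I)))) = sc (csign I ?t) (sc (of_int (chi d ?t)) (ysym N x y d (\<delta> I) :: _ \<Rightarrow> 'a))"
      by simp
    then show ?thesis by simp
  qed
  consider (unsorted) a b where "a < N" "b < N" "y a = y b" "x a < x b" "I ! b < I ! a"
    | (parity) a b where "a < N" "b < N" "y a = y b" "a \<noteq> b" "I ! a = I ! b" "par (I ! a) \<noteq> d"
    | (garnir) a b where "fsorted N x y I" "a < N" "b < N" "x a = x b" "y a < y b" "I ! b < I ! a \<or> (I ! b = I ! a \<and> par (I ! a) = d)"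
    | (sstd) "sstd N x y d I"
  proof (cases "fsorted N x y I")
    case False
    then show ?thesis using unsorted unfolding fsorted_def by (metis not_le)
  next
    case s1: True
    show ?thesis
    proof (cases "fsorted N y x I")
      case False
      then show ?thesis using garnir[OF s1] unfolding fsorted_def by (metis not_le)
    next
      case s2: True
      show ?thesis
      proof (cases "sstd N x y d I")
        case False
        then consider a b where "a < N" "b < N" "a \<noteq> b" "y a = y b" "I ! a = I ! b" "par (I ! a) \<noteq> d"
          | a b where "a < N" "b < N" "a \<noteq> b" "x a = x b" "I ! a = I ! b" "par (I ! a) = d"
          using s1 s2 unfolding sstd_def by blast
        then show ?thesis
        proof cases
          case 1
          then show ?thesis using parity by blast
        next
          case (2 a b)
          then have "y a \<noteq> y b" using coord_inj by blast
          then show ?thesis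
            using garnir[OF s1, of a b] garnir[OF s1, of b a] 2 by (cases "y a < y b") auto
        qed
      qed (use sstd in blast)
    qed
  qed
  then show ?case
  proof cases
    case (unsorted a b)
    let ?t = "Transposition.transpose a b" and ?J = "permute_list (Transposition.transpose a b) I"
    have t: "?t \<in> stab N y" using unsorted by (intro stab_transpose) auto
    have "?J \<in> seqs R N" using 1(2) permute_seqs[OF stab_Sym[OF t]] by blast
    moreover have "key R N y I = key R N y ?J" using key_stab[OF t len] by simp
    moreover have "key R N x I < key R N x ?J" by (rule key_swap[OF R 1(2)]) (use unsorted in auto)
    ultimately have "ysym N x y d (\<delta> ?J) \<in> fv.span ?S" using IH by blast
    then have "sc (csign I ?t * of_int (chi d ?t)) (ysym N x y d (\<delta> ?J)) \<in> fv.span ?S"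
      by (rule fv.span_scale)
    moreover have "csign I ?t * of_int (chi d ?t) * (csign I ?t * of_int (chi d ?t)) = (1 :: 'a)"
    proof -
      have "csign I ?t * of_int (chi d ?t) * (csign I ?t * of_int (chi d ?t))
         = (csign I ?t * csign I ?t) * (of_int (chi d ?t) * of_int (chi d ?t) :: 'a)" by (simp only: mult_ac)
      then show ?thesis by simp
    qed
    ultimately show ?thesis unfolding swap[OF unsorted(1-3)] by (simp only: fv.scale_scale fv.scale_one)
  next
    case (parity a b)
    let ?t = "Transposition.transpose a b"
    \<comment> \<open>For equal entries of the wrong parity in a fibre of \<open>y\<close>, the
      transposition fixes \<open>I\<close> but reverses the sign, so the vector is its own
      negative.\<close>
    have "permute_list ?t I = I" using parity len by (intro permute_list_transpose) auto
    moreover have "csign I ?t * of_int (chi d ?t) = (- 1 :: 'a)"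
      using csign_transpose'[of a b I, where 'a = 'a] parity len by (auto simp: chi_transpose)
    ultimately have "ysym N x y d (\<delta> I) = sc (- 1) (ysym N x y d (\<delta> I) :: _ \<Rightarrow> 'a)"
      using swap[OF parity(1-3)] by simp
    then have "ysym N x y d (\<delta> I) J = - (ysym N x y d (\<delta> I) J :: 'a)" for J
      by (metis mult_minus1 sc_apply)
    then have "ysym N x y d (\<delta> I) = (0 :: _ \<Rightarrow> 'a)" by (simp add: fun_eq_iff pointwise)
    then show ?thesis by (simp add: fv.span_zero)
  next
    case (garnir a b)
    obtain p q where pq: "p < N" "q < N" "x p = x q" "y q = Suc (y p)"
      "I ! q < I ! p \<or> (I ! q = I ! p \<and> par (I ! p) = d)"
      by (rule adjacent_violation[OF garnir(2-6)])
    show ?thesis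
      by (rule garnir_straighten[OF R 1(2) garnir(1) pq(1) refl refl pq(2) pq(3)[symmetric] pq(4,5)])
        (use IH in blast)
  next
    case sstd
    then show ?thesis using 1(2) by (intro fv.span_base) blast
  qed
qed

lemma ysym_span:
  assumes R: "finite R" and v: "v \<in> tens R N"
  shows "ysym N x y d v \<in> fv.span ((\<lambda>J. ysym N x y d (\<delta> J) :: _ \<Rightarrow> 'a::field_char_0) ` {J \<in> seqs R N. sstd N x y d J})"
proof -
  have "ysym N x y d v = (\<Sum>I\<in>seqs R N. sc (v I) (ysym N x y d (\<delta> I)))"
    using arg_cong[OF tens_expand[OF R v], of "ysym N x y d"] by (simp only: ysym_sum ysym_sc)
  then show ?thesis
    using ysym_\<delta>_span[OF R] by (auto intro!: fv.span_sum fv.span_scale)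
qed

end


section \<open>The multiplication map to the symmetric algebra\<close>

text \<open>The bilinear extension of \<open>Z\<close>. In contrast to \<open>mmap\<close>, the
  second argument is a tensor too, so that operators can be moved to it.\<close>

definition bmap :: "idx set \<Rightarrow> idx set \<Rightarrow> nat \<Rightarrow> (idx list \<Rightarrow> 'a::field) \<Rightarrow> (idx list \<Rightarrow> 'a)
     \<Rightarrow> (idx \<times> idx) multiset \<Rightarrow> 'a" where
  "bmap U V N v w = (\<lambda>m. \<Sum>I\<in>seqs U N. \<Sum>J\<in>seqs V N. v I * w J * Z I J m)"

lemma bmap_add_left: "bmap U V N (v + v') w = bmap U V N v w + bmap U V N v' w"
  by (simp add: bmap_def fun_eq_iff pointwise algebra_simps sum.distrib)

lemma bmap_add_right: "bmap U V N v (w + w') = bmap U V N v w + bmap U V N v w'"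
  by (simp add: bmap_def fun_eq_iff pointwise algebra_simps sum.distrib)

lemma bmap_sc_left: "bmap U V N (sc c v) w = sc c (bmap U V N v w)"
  by (simp add: bmap_def fun_eq_iff pointwise sum_distrib_left mult_ac)

lemma bmap_sc_right: "bmap U V N v (sc c w) = sc c (bmap U V N v w)"
  by (simp add: bmap_def fun_eq_iff pointwise sum_distrib_left mult_ac)

lemma bmap_zero_left [simp]: "bmap U V N 0 w = 0"
  by (simp add: bmap_def fun_eq_iff pointwise)

lemma bmap_zero_right [simp]: "bmap U V N v 0 = 0"
  by (simp add: bmap_def fun_eq_iff pointwise)

lemma bmap_sum_left: "bmap U V N (\<Sum>a\<in>A. g a) w = (\<Sum>a\<in>A. bmap U V N (g a) w)"
  by (induction A rule: infinite_finite_induct) (auto simp: bmap_add_left)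

lemma bmap_sum_right: "bmap U V N v (\<Sum>a\<in>A. g a) = (\<Sum>a\<in>A. bmap U V N v (g a))"
  by (induction A rule: infinite_finite_induct) (auto simp: bmap_add_right)

lemma bmap_span:
  assumes "a \<in> fv.span S" "b \<in> fv.span T" "\<And>s t. s \<in> S \<Longrightarrow> t \<in> T \<Longrightarrow> bmap U V N s t \<in> fv.span X"
  shows "bmap U V N a b \<in> fv.span X"
proof -
  have *: "bmap U V N s b \<in> fv.span X" if "s \<in> S" for s
    using assms(2)
  proof (rule fv.span_induct)
    show "fv.subspace {b. bmap U V N s b \<in> fv.span X}"
      by (rule fv.subspaceI)
        (simp_all add: bmap_add_right bmap_sc_right fv.span_zero fv.span_add fv.span_scale)
  qed (use assms(3) that in blast)
  show ?thesis using assms(1)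
  proof (rule fv.span_induct)
    show "fv.subspace {a. bmap U V N a b \<in> fv.span X}"
      by (rule fv.subspaceI)
        (simp_all add: bmap_add_left bmap_sc_left fv.span_zero fv.span_add fv.span_scale)
  qed (use * in blast)
qed

lemma bij_permute_seqs:
  assumes "\<pi> permutes {..<N}"
  shows "bij_betw (permute_list \<pi>) (seqs R N) (seqs R N)"
proof (rule bij_betw_byWitness[where f' = "permute_list (inv \<pi>)"])
  show "\<forall>I\<in>seqs R N. permute_list (inv \<pi>) (permute_list \<pi> I) = I"
    using permute_list_inv1 assms by (auto simp: seqs_def)
  show "\<forall>I\<in>seqs R N. permute_list \<pi> (permute_list (inv \<pi>) I) = I"
    using permute_list_inv2 assms by (auto simp: seqs_def)
  show "permute_list \<pi> ` seqs R N \<subseteq> seqs R N" "permute_list (inv \<pi>) ` seqs R N \<subseteq> seqs R N"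
    using permute_seqs[OF assms] permute_seqs[OF permutes_inv[OF assms]] by blast+
qed

lemma bmap_\<delta>:
  assumes "finite U" "finite V" "I \<in> seqs U N" "J \<in> seqs V N"
  shows "bmap U V N (\<delta> I) (\<delta> J) = (Z I J :: _ \<Rightarrow> 'a::field)"
proof
  fix m
  have "bmap U V N (\<delta> I) (\<delta> J) m = (\<Sum>I'\<in>seqs U N. \<Sum>J'\<in>seqs V N. if J' = J then (if I' = I then Z I J m else 0) else (0 :: 'a))"
    unfolding bmap_def by (intro sum.cong refl) (auto simp: \<delta>_def)
  also have "\<dots> = Z I J m"
    using assms by (simp add: finite_seqs)
  finally show "bmap U V N (\<delta> I) (\<delta> J) m = (Z I J m :: 'a)" .
qed

text \<open>\<open>Z_permute\<close> in bilinear form: the map factors through the coinvariants of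
  the diagonal action.\<close>

lemma bmap_tact:
  assumes \<pi>: "\<pi> permutes {..<N}"
  shows "bmap U V N (tact N \<pi> v) (tact N \<pi> w) = bmap U V N v w"
proof
  fix m
  have "bmap U V N (tact N \<pi> v) (tact N \<pi> w) m
     = (\<Sum>I\<in>seqs U N. \<Sum>J\<in>seqs V N. v (permute_list \<pi> I) * w (permute_list \<pi> J) * Z (permute_list \<pi> I) (permute_list \<pi> J) m)"
    unfolding bmap_def
    by (intro sum.cong refl) (auto simp: seqs_def tact_apply[OF \<pi>] Z_permute[OF _ _ \<pi>])
  also have "\<dots> = (\<Sum>I\<in>seqs U N. \<Sum>J\<in>seqs V N. v (permute_list \<pi> I) * w J * Z (permute_list \<pi> I) J m)"
    by (intro sum.cong refl sum.reindex_bij_betw[OF bij_permute_seqs[OF \<pi>]])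
  also have "\<dots> = bmap U V N v w m"
    unfolding bmap_def by (rule sum.reindex_bij_betw[OF bij_permute_seqs[OF \<pi>], of "\<lambda>I. \<Sum>J\<in>seqs V N. v I * w J * Z I J m"])
  finally show "bmap U V N (tact N \<pi> v) (tact N \<pi> w) m = bmap U V N v w m" .
qed

lemma bmap_tact_inv:
  assumes \<pi>: "\<pi> permutes {..<N}" and w: "w \<in> tens V N"
  shows "bmap U V N (tact N \<pi> v) w = bmap U V N v (tact N (inv \<pi>) w)"
proof -
  have "tact N \<pi> (tact N (inv \<pi>) w) = w"
    unfolding tact_comp[OF \<pi> permutes_inv[OF \<pi>], symmetric] permutes_inv_o[OF \<pi>] by (rule tact_id[OF w])
  then show ?thesis using bmap_tact[OF \<pi>, of U V v "tact N (inv \<pi>) w"] by simp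
qed

text \<open>Signed sums are self-adjoint, because a stabilizer is closed under inversion and
  \<open>chi\<close> is unchanged by it.\<close>

lemma bmap_symm:
  assumes w: "w \<in> tens V N"
  shows "bmap U V N (symm N f d v) w = bmap U V N v (symm N f d w)"
proof -
  have "bmap U V N (symm N f d v) w = (\<Sum>\<sigma>\<in>stab N f. sc (of_int (chi d (inv \<sigma>))) (bmap U V N v (tact N (inv \<sigma>) w)))"
    unfolding symm_def bmap_sum_left bmap_sc_left
    by (intro sum.cong refl) (simp add: bmap_tact_inv[OF stab_Sym w] chi_inv[OF stab_Sym])
  also have "\<dots> = (\<Sum>\<sigma>\<in>stab N f. sc (of_int (chi d \<sigma>)) (bmap U V N v (tact N \<sigma> w)))"
    by (rule sum.reindex_bij_betw[OF bij_stab_inv])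
  finally show ?thesis unfolding symm_def bmap_sum_right bmap_sc_right .
qed

text \<open>The two factors cross one at a time and arrive in the opposite order, so the adjoint of
  \<open>E\<close> is \<open>E\<^sup>*\<close>.\<close>

lemma bmap_ysym:
  assumes w: "w \<in> tens V N"
  shows "bmap U V N (ysym N x y d v) w = bmap U V N v (ysym N y x (\<not> d) w)"
  unfolding ysym_def not_not bmap_symm[OF w] bmap_symm[OF symm_tens[OF w]] ..

lemma Z_nonzero:
  assumes "length I = N" "length J = N" "\<not> repeats_odd (zip I J)"
  shows "Z I J (mset (zip I J)) \<noteq> (0 :: 'a::field_char_0)"
proof -
  have "zsign i j i' j' \<noteq> (0 :: 'a)" for i j i' j' by (simp add: zsign_def)
  then show ?thesis unfolding Z_eq[OF assms(1,2)] using assms(3) by (auto simp: case_prod_unfold)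
qed

text \<open>The nonzero monomials correspond to orbits of pairs of sequences, so their coefficients are signed
  orbit sums; on the other orbits the signs make the average vanish.\<close>

lemma average_zero:
  fixes X :: "idx list \<Rightarrow> idx list \<Rightarrow> 'a::field_char_0"
  assumes fin: "finite U" "finite V"
    and zero: "\<And>m. (\<Sum>I\<in>seqs U N. \<Sum>J\<in>seqs V N. X I J * Z I J m) = 0"
    and I: "I \<in> seqs U N" and J: "J \<in> seqs V N"
  shows "(\<Sum>\<pi>\<in>Sym N. csign I \<pi> * csign J \<pi> * X (permute_list \<pi> I) (permute_list \<pi> J)) = 0"
    (is "(\<Sum>\<pi>\<in>Sym N. ?F \<pi>) = 0")
proof -
  have len: "length I = N" "length J = N" using I J by (auto simp: seqs_def)
  show ?thesis
  proof (cases "repeats_odd (zip I J)")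
    case True
    then obtain a b where ab: "a < N" "b < N" "a \<noteq> b" "zip I J ! a = zip I J ! b" "gpar (zip I J ! a)"
      unfolding repeats_odd_def using len by auto
    then have eq: "I ! a = I ! b" "J ! a = J ! b" "par (I ! a) \<noteq> par (J ! a)"
      using len by (auto simp: gpar_def)
    let ?t = "Transposition.transpose a b"
    have t: "?t permutes {..<N}" using ab by (simp add: permutes_swap_id)
    have fix_t: "permute_list ?t I = I" "permute_list ?t J = J"
      using ab eq len by (auto intro: permute_list_transpose)
    \<comment> \<open>An odd generator has exactly one odd index, so exactly one of the two signs is
      negative.\<close>
    have "csign I ?t * csign J ?t = (- 1 :: 'a)"
      using csign_transpose'[of a b I, where 'a = 'a] csign_transpose'[of a b J, where 'a = 'a] ab eq len by auto
    then have "?F (?t \<circ> \<pi>) = - ?F \<pi>" if "\<pi> \<in> Sym N" for \<pi>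
    proof -
      have p: "\<pi> permutes {..<N}" using that by simp
      have "?F (?t \<circ> \<pi>) = (csign I ?t * csign J ?t) * (csign I \<pi> * csign J \<pi> * X (permute_list \<pi> I) (permute_list \<pi> J))"
        using csign_compose[of ?t I \<pi>, where 'a = 'a] csign_compose[of ?t J \<pi>, where 'a = 'a]
          permute_list_compose[of \<pi> I ?t] permute_list_compose[of \<pi> J ?t] t p len
        by (simp only: fix_t mult_ac)
      then show ?thesis using \<open>csign I ?t * csign J ?t = (- 1 :: 'a)\<close> by simp
    qed
    then have "(\<Sum>\<pi>\<in>Sym N. ?F (?t \<circ> \<pi>)) = - (\<Sum>\<pi>\<in>Sym N. ?F \<pi>)"
      unfolding sum_negf[symmetric] by (rule sum.cong[OF refl])
    moreover have "(\<Sum>\<pi>\<in>Sym N. ?F (?t \<circ> \<pi>)) = (\<Sum>\<pi>\<in>Sym N. ?F \<pi>)"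
      by (rule sum.reindex_bij_betw[OF bij_Sym_left]) (use t in simp)
    ultimately show ?thesis by simp
  next
    case False
    let ?m = "mset (zip I J)"
    define G where "G K L = X K L * Z K L ?m" for K L
    \<comment> \<open>\<open>T\<close> sums \<open>G\<close> over the orbit of a pair, with
      multiplicity. \<open>Q\<close> is a single orbit, so \<open>T\<close> is constant there, while
      its total over \<open>Q\<close> is a multiple of the coefficient of \<open>?m\<close> in the
      relation.\<close>
    define T where "T K L = (\<Sum>\<pi>\<in>Sym N. G (permute_list \<pi> K) (permute_list \<pi> L))" for K L
    define P where "P = seqs U N \<times> seqs V N"
    define Q where "Q = {(K, L) \<in> P. mset (zip K L) = ?m}"
    have finP: "finite P" using fin by (simp add: P_def finite_seqs)
    have QP: "Q \<subseteq> P" by (auto simp: Q_def)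
    then have finQ: "finite Q" using finP by (rule finite_subset)
    have "(\<Sum>(K, L)\<in>Q. G K L) = (\<Sum>(K, L)\<in>P. G K L)"
    proof (rule sum.mono_neutral_left[OF finP QP], clarify)
      fix K L assume KL: "(K, L) \<in> P" "(K, L) \<notin> Q"
      then have "length K = N" "length L = N" "?m \<noteq> mset (zip K L)" by (auto simp: P_def Q_def seqs_def)
      then show "G K L = 0" using Z_eq[of K N L ?m, where 'a = 'a] by (simp add: G_def)
    qed
    also have "\<dots> = 0" unfolding P_def G_def sum.cartesian_product[symmetric] by (rule zero)
    finally have GQ: "(\<Sum>(K, L)\<in>Q. G K L) = 0" .
    have bijQ: "bij_betw (\<lambda>(K, L). (permute_list \<pi> K, permute_list \<pi> L)) Q Q" if p: "\<pi> permutes {..<N}" for \<pi>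
    proof (rule bij_betw_byWitness[where f' = "\<lambda>(K, L). (permute_list (inv \<pi>) K, permute_list (inv \<pi>) L)"])
      have i1: "permute_list (inv \<pi>) (permute_list \<pi> K) = K" "permute_list \<pi> (permute_list (inv \<pi>) K) = K" if "length K = N" for K :: "idx list"
        using permute_list_inv1 permute_list_inv2 p that by auto
      show "\<forall>z\<in>Q. (\<lambda>(K, L). (permute_list (inv \<pi>) K, permute_list (inv \<pi>) L)) ((\<lambda>(K, L). (permute_list \<pi> K, permute_list \<pi> L)) z) = z"
        "\<forall>z\<in>Q. (\<lambda>(K, L). (permute_list \<pi> K, permute_list \<pi> L)) ((\<lambda>(K, L). (permute_list (inv \<pi>) K, permute_list (inv \<pi>) L)) z) = z"
        by (auto simp: Q_def P_def seqs_def i1)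
      have im: "(\<lambda>(K, L). (permute_list \<rho> K, permute_list \<rho> L)) ` Q \<subseteq> Q" if r: "\<rho> permutes {..<N}" for \<rho>
      proof clarify
        fix K L assume KL: "(K, L) \<in> Q"
        then have l: "length K = N" "length L = N" by (auto simp: Q_def P_def seqs_def)
        have "zip (permute_list \<rho> K) (permute_list \<rho> L) = permute_list \<rho> (zip K L)"
          by (rule permute_list_zip[symmetric]) (use l r in auto)
        moreover have "mset (permute_list \<rho> (zip K L)) = mset (zip K L)"
          by (rule mset_permute_list) (use l r in auto)
        ultimately show "(permute_list \<rho> K, permute_list \<rho> L) \<in> Q"
          using KL permute_seqs[OF r] by (simp add: Q_def P_def)
      qed
      show "(\<lambda>(K, L). (permute_list \<pi> K, permute_list \<pi> L)) ` Q \<subseteq> Q"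
        "(\<lambda>(K, L). (permute_list (inv \<pi>) K, permute_list (inv \<pi>) L)) ` Q \<subseteq> Q"
        using im[OF p] im[OF permutes_inv[OF p]] by auto
    qed
    have "(\<Sum>(K, L)\<in>Q. T K L) = (\<Sum>\<pi>\<in>Sym N. \<Sum>(K, L)\<in>Q. G (permute_list \<pi> K) (permute_list \<pi> L))"
      unfolding T_def case_prod_unfold by (rule sum.swap)
    also have "\<dots> = (\<Sum>\<pi>\<in>Sym N. 0)"
    proof (rule sum.cong[OF refl])
      fix \<pi> assume "\<pi> \<in> Sym N"
      then have "(\<Sum>(K, L)\<in>Q. G (permute_list \<pi> K) (permute_list \<pi> L)) = (\<Sum>(K, L)\<in>Q. G K L)"
        using sum.reindex_bij_betw[OF bijQ, of \<pi> "\<lambda>(K, L). G K L"] by (simp add: case_prod_unfold)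
      then show "(\<Sum>(K, L)\<in>Q. G (permute_list \<pi> K) (permute_list \<pi> L)) = 0" using GQ by simp
    qed
    finally have TQ: "(\<Sum>(K, L)\<in>Q. T K L) = 0" by simp
    have TI: "T K L = T I J" if KL: "(K, L) \<in> Q" for K L
    proof -
      have l: "length K = N" "length L = N" "mset (zip K L) = mset (zip I J)"
        using KL by (auto simp: Q_def P_def seqs_def)
      obtain \<rho> where r: "\<rho> permutes {..<length (zip I J)}" "permute_list \<rho> (zip I J) = zip K L"
        using mset_eq_permutation[OF l(3)] by blast
      have rN: "\<rho> permutes {..<N}" using r len by simp
      have "zip (permute_list \<rho> I) (permute_list \<rho> J) = permute_list \<rho> (zip I J)"
        by (rule permute_list_zip[symmetric]) (use rN len in auto)
      then have "zip (permute_list \<rho> I) (permute_list \<rho> J) = zip K L" by (simp only: r(2))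
      then have "map fst (zip (permute_list \<rho> I) (permute_list \<rho> J)) = map fst (zip K L)"
        "map snd (zip (permute_list \<rho> I) (permute_list \<rho> J)) = map snd (zip K L)" by simp_all
      then have KL_eq: "K = permute_list \<rho> I" "L = permute_list \<rho> J" using len l by simp_all
      have "T K L = (\<Sum>\<pi>\<in>Sym N. G (permute_list (\<rho> \<circ> \<pi>) I) (permute_list (\<rho> \<circ> \<pi>) J))"
        unfolding T_def KL_eq by (rule sum.cong[OF refl]) (simp add: permute_list_compose len)
      also have "\<dots> = T I J"
        unfolding T_def by (rule sum.reindex_bij_betw[OF bij_Sym_left]) (use rN in simp)
      finally show ?thesis .
    qed
    have "(\<Sum>(K, L)\<in>Q. T K L) = (\<Sum>z\<in>Q. T I J)"
      by (rule sum.cong[OF refl]) (use TI in auto)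
    then have "of_nat (card Q) * T I J = 0" using TQ by simp
    moreover have "(I, J) \<in> Q" using I J by (simp add: Q_def P_def)
    then have "card Q \<noteq> 0" using finQ by auto
    ultimately have "T I J = 0" by simp
    moreover have "T I J = (\<Sum>\<pi>\<in>Sym N. ?F \<pi>) * Z I J ?m"
      unfolding T_def G_def sum_distrib_right
      by (rule sum.cong[OF refl]) (simp add: Z_permute[OF len] mult_ac)
    ultimately show ?thesis using Z_nonzero[OF len False, where 'a = 'a] by simp
  qed
qed

context young
begin

text \<open>Independence is used twice: for the \<open>E u_I\<close> at every fixed index
  \<open>L\<close> of the right factor, and then for the \<open>E\<^sup>* w_J\<close>, which is the
  dual instance of the same lemma because \<open>sstd\<close> is self-dual.\<close>

lemma bmap_independent:
  fixes c :: "idx list \<Rightarrow> idx list \<Rightarrow> 'a::field_char_0"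
  assumes fin: "finite U" "finite V"
  defines "A \<equiv> {I \<in> seqs U N. sstd N x y d I}" and "B \<equiv> {J \<in> seqs V N. sstd N x y d J}"
  assumes zero: "(\<Sum>I\<in>A. \<Sum>J\<in>B. sc (c I J) (bmap U V N (ysym N x y d (\<delta> I)) (\<delta> J))) = 0"
    and I: "I \<in> A" and J: "J \<in> B"
  shows "c I J = 0"
proof -
  interpret D: young N y x "\<not> d" using young_dual young_axioms by blast
  have finAB: "finite A" "finite B" using fin by (auto simp: A_def B_def finite_seqs)
  let ?E = "\<lambda>I. ysym N x y d (\<delta> I) :: _ \<Rightarrow> 'a"
  let ?h = "of_int (yscale N x y d) :: 'a"
  define X where "X K L = (\<Sum>I\<in>A. \<Sum>J\<in>B. c I J * ?E I K * \<delta> J L)" for K L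
  have Xz: "(\<Sum>K\<in>seqs U N. \<Sum>L\<in>seqs V N. X K L * Z K L m) = 0" for m
  proof -
    have "0 = (\<Sum>I\<in>A. \<Sum>J\<in>B. c I J * (\<Sum>K\<in>seqs U N. \<Sum>L\<in>seqs V N. ?E I K * \<delta> J L * Z K L m))"
      using fun_cong[OF zero, of m] by (simp add: pointwise bmap_def)
    also have "\<dots> = (\<Sum>I\<in>A. \<Sum>J\<in>B. \<Sum>K\<in>seqs U N. \<Sum>L\<in>seqs V N. c I J * ?E I K * \<delta> J L * Z K L m)"
      by (simp only: sum_distrib_left mult.assoc)
    also have "\<dots> = (\<Sum>K\<in>seqs U N. \<Sum>L\<in>seqs V N. \<Sum>I\<in>A. \<Sum>J\<in>B. c I J * ?E I K * \<delta> J L * Z K L m)"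
      by (simp only: sum.swap[of _ "seqs U N" B] sum.swap[of _ "seqs V N" B] sum.swap[of _ "seqs U N" A] sum.swap[of _ "seqs V N" A])
    also have "\<dots> = (\<Sum>K\<in>seqs U N. \<Sum>L\<in>seqs V N. X K L * Z K L m)"
      unfolding X_def sum_distrib_right ..
    finally show ?thesis ..
  qed
  \<comment> \<open>The averaged relation, read as a vector of the left factor for each index
    \<open>L\<close> of the right one, so that \<open>ysym\<close> can be applied to the left factor
    alone.\<close>
  have avg: "(\<Sum>\<pi>\<in>Sym N. \<Sum>I\<in>A. \<Sum>J\<in>B. sc (c I J * tact N \<pi> (\<delta> J) L) (tact N \<pi> (?E I))) = 0" if L: "L \<in> seqs V N" for L
  proof
    fix K
    show "(\<Sum>\<pi>\<in>Sym N. \<Sum>I\<in>A. \<Sum>J\<in>B. sc (c I J * tact N \<pi> (\<delta> J) L) (tact N \<pi> (?E I))) K = 0 K"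
    proof (cases "K \<in> seqs U N")
      case True
      have len: "length K = N" "length L = N" using True L by (auto simp: seqs_def)
      have "(\<Sum>\<pi>\<in>Sym N. \<Sum>I\<in>A. \<Sum>J\<in>B. c I J * tact N \<pi> (\<delta> J) L * tact N \<pi> (?E I) K)
         = (\<Sum>\<pi>\<in>Sym N. csign K \<pi> * csign L \<pi> * X (permute_list \<pi> K) (permute_list \<pi> L))"
        unfolding X_def sum_distrib_left
        by (intro sum.cong refl) (simp add: tact_apply len mult_ac)
      also have "\<dots> = 0" by (rule average_zero[OF fin Xz True L])
      finally show ?thesis by (simp add: pointwise)
    next
      case False
      have "tact N \<pi> (?E I) K = 0" if "\<pi> \<in> Sym N" "I \<in> A" for \<pi> I
      proof -
        have "tact N \<pi> (?E I) \<in> tens U N"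
          using that by (intro tact_tens ysym_tens \<delta>_tens) (auto simp: A_def)
        then show ?thesis using False unfolding tens_def by blast
      qed
      then show ?thesis by (simp add: pointwise)
    qed
  qed
  \<comment> \<open>The factors \<open>W (inv \<pi>)\<close> supplied by
    \<open>ysym_tact_ysym\<close> are, by \<open>wgt_dual\<close>, the coefficients of the opposite
    symmetrizer.\<close>
  have dual: "(\<Sum>\<pi>\<in>Sym N. of_int (W (inv \<pi>)) * tact N \<pi> (\<delta> J) L) = (ysym N y x (\<not> d) (\<delta> J) L :: 'a)" for J L
    unfolding ysym_eq_sum_wgt pointwise by (intro sum.cong refl) (simp add: wgt_dual)
  have key: "(\<Sum>J\<in>B. c I J * ysym N y x (\<not> d) (\<delta> J) L) = 0" if L: "L \<in> seqs V N" and I: "I \<in> A" for I L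
  proof -
    have "0 = ysym N x y d (\<Sum>\<pi>\<in>Sym N. \<Sum>I\<in>A. \<Sum>J\<in>B. sc (c I J * tact N \<pi> (\<delta> J) L) (tact N \<pi> (?E I)))"
      unfolding avg[OF L] by simp
    also have "\<dots> = (\<Sum>\<pi>\<in>Sym N. \<Sum>I\<in>A. \<Sum>J\<in>B. sc (c I J * tact N \<pi> (\<delta> J) L * (?h * of_int (W (inv \<pi>)))) (?E I))"
      unfolding ysym_sum ysym_sc by (intro sum.cong refl) (simp add: ysym_tact_ysym)
    also have "\<dots> = (\<Sum>I\<in>A. \<Sum>J\<in>B. \<Sum>\<pi>\<in>Sym N. sc (c I J * tact N \<pi> (\<delta> J) L * (?h * of_int (W (inv \<pi>)))) (?E I))"
      by (subst sum.swap, rule sum.cong[OF refl], rule sum.swap)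
    also have "\<dots> = (\<Sum>I\<in>A. sc (\<Sum>J\<in>B. ?h * (c I J * ysym N y x (\<not> d) (\<delta> J) L)) (?E I))"
      unfolding fv.scale_sum_left[symmetric] dual[symmetric] sum_distrib_left
      by (intro sum.cong refl) (simp add: mult_ac)
    finally have "(\<Sum>I\<in>A. sc (\<Sum>J\<in>B. ?h * (c I J * ysym N y x (\<not> d) (\<delta> J) L)) (?E I)) = 0" ..
    then have "(\<Sum>J\<in>B. ?h * (c I J * ysym N y x (\<not> d) (\<delta> J) L)) = 0"
      using ysym_independent[OF fin(1), of "\<lambda>I. \<Sum>J\<in>B. ?h * (c I J * ysym N y x (\<not> d) (\<delta> J) L)" I] I
      unfolding A_def by blast
    then show ?thesis unfolding sum_distrib_left[symmetric] using yscale_pos by simp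
  qed
  have "(\<Sum>J\<in>B. sc (c I J) (ysym N y x (\<not> d) (\<delta> J))) = 0"
  proof
    fix L
    show "(\<Sum>J\<in>B. sc (c I J) (ysym N y x (\<not> d) (\<delta> J))) L = 0 L"
    proof (cases "L \<in> seqs V N")
      case True
      then show ?thesis using key[OF True I] by (simp add: pointwise)
    next
      case False
      have "ysym N y x (\<not> d) (\<delta> J) L = (0 :: 'a)" if "J \<in> B" for J
      proof -
        have "ysym N y x (\<not> d) (\<delta> J :: _ \<Rightarrow> 'a) \<in> tens V N"
          using that by (intro ysym_tens \<delta>_tens) (auto simp: B_def)
        then show ?thesis using False unfolding tens_def by blast
      qed
      then show ?thesis by (simp add: pointwise)
    qed
  qed
  then show ?thesis
    using D.ysym_independent[OF fin(2), of "c I" J] J unfolding B_def sstd_dual by blast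
qed

text \<open>That \<open>E v \<otimes> E\<^sup>* w\<close> has \<open>h\<close> times the image of
  \<open>E v \<otimes> w\<close> is used in both directions: to make the right factor accessible to
  straightening, and to turn the straightened \<open>E\<^sup>* w_J\<close> back into
  \<open>w_J\<close>.\<close>

lemma bmap_ysym_span:
  assumes fin: "finite U" "finite V"
  shows "fv.span ((\<lambda>(I, J). bmap U V N (ysym N x y d (\<delta> I)) (\<delta> J) :: _ \<Rightarrow> 'a::field_char_0) `
       ({I \<in> seqs U N. sstd N x y d I} \<times> {J \<in> seqs V N. sstd N x y d J}))
     = fv.span {bmap U V N (ysym N x y d v) w | v w. v \<in> tens U N \<and> w \<in> tens V N}"
    (is "fv.span (?f ` (?A \<times> ?B)) = fv.span ?X")
proof (rule antisym)
  show "fv.span (?f ` (?A \<times> ?B)) \<subseteq> fv.span ?X"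
    by (rule fv.span_mono) (auto intro!: exI \<delta>_tens)
  interpret D: young N y x "\<not> d" using young_dual young_axioms by blast
  let ?h = "of_int (yscale N x y d) :: 'a"
  show "fv.span ?X \<subseteq> fv.span (?f ` (?A \<times> ?B))"
  proof (rule fv.span_minimal[OF _ fv.subspace_span], clarify)
    fix v w :: "idx list \<Rightarrow> 'a" assume v: "v \<in> tens U N" and w: "w \<in> tens V N"
    have "bmap U V N (ysym N x y d v) (ysym N y x (\<not> d) w) \<in> fv.span (?f ` (?A \<times> ?B))"
    proof (rule bmap_span[OF ysym_span[OF fin(1) v] D.ysym_span[OF fin(2) w]], clarify)
      fix I J assume IJ: "I \<in> seqs U N" "sstd N x y d I" "J \<in> seqs V N" "sstd N y x (\<not> d) J"
      have "bmap U V N (ysym N x y d (\<delta> I)) (ysym N y x (\<not> d) (\<delta> J))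
          = bmap U V N (ysym N x y d (ysym N x y d (\<delta> I))) (\<delta> J :: _ \<Rightarrow> 'a)"
        by (rule bmap_ysym[symmetric]) (use IJ in simp)
      also have "\<dots> = sc ?h (?f (I, J))"
        using ysym_ysym[of "\<delta> I :: _ \<Rightarrow> 'a" U] IJ by (simp add: bmap_sc_left)
      also have "\<dots> \<in> fv.span (?f ` (?A \<times> ?B))"
        using IJ sstd_dual by (intro fv.span_scale fv.span_base imageI) auto
      finally show "bmap U V N (ysym N x y d (\<delta> I)) (ysym N y x (\<not> d) (\<delta> J :: _ \<Rightarrow> 'a)) \<in> fv.span (?f ` (?A \<times> ?B))" .
    qed
    then have "sc (inverse ?h) (bmap U V N (ysym N x y d v) (ysym N y x (\<not> d) w)) \<in> fv.span (?f ` (?A \<times> ?B))"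
      by (rule fv.span_scale)
    also have "bmap U V N (ysym N x y d v) (ysym N y x (\<not> d) w) = sc ?h (bmap U V N (ysym N x y d v) w)"
      using bmap_ysym[OF w, of U x y d "ysym N x y d v"] ysym_ysym[OF v] by (simp add: bmap_sc_left)
    finally show "bmap U V N (ysym N x y d v) w \<in> fv.span (?f ` (?A \<times> ?B))"
      using yscale_pos by simp
  qed
qed

lemma basis_family_bmap:
  assumes fin: "finite U" "finite V"
  shows "basis_family (\<lambda>(I, J). bmap U V N (ysym N x y d (\<delta> I)) (\<delta> J) :: _ \<Rightarrow> 'a::field_char_0)
     ({I \<in> seqs U N. sstd N x y d I} \<times> {J \<in> seqs V N. sstd N x y d J})
     (fv.span {bmap U V N (ysym N x y d v) w | v w. v \<in> tens U N \<and> w \<in> tens V N})"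
  unfolding basis_family_def lspan_eq_span bmap_ysym_span[OF fin]
proof (intro conjI refl allI impI)
  let ?A = "{I \<in> seqs U N. sstd N x y d I}" and ?B = "{J \<in> seqs V N. sstd N x y d J}"
  show "finite (?A \<times> ?B)" using fin by (simp add: finite_seqs)
  fix c :: "idx list \<times> idx list \<Rightarrow> 'a"
  assume z: "(\<lambda>m. \<Sum>a\<in>?A \<times> ?B. c a * (case a of (I, J) \<Rightarrow> bmap U V N (ysym N x y d (\<delta> I)) (\<delta> J)) m) = (\<lambda>m. 0)"
  have "(\<Sum>I\<in>?A. \<Sum>J\<in>?B. sc (c (I, J)) (bmap U V N (ysym N x y d (\<delta> I)) (\<delta> J))) = 0"
    using z by (simp add: fun_eq_iff pointwise sum.cartesian_product case_prod_unfold)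
  then show "\<forall>a\<in>?A \<times> ?B. c a = 0"
    using bmap_independent[OF fin, of "\<lambda>I J. c (I, J)"] by auto
qed

end


section \<open>Specht modules and the isotypic component\<close>

text \<open>Regroup \<open>E E\<close> as the factor over \<open>x\<close>, then
  \<open>E\<^sup>*\<close>, then the factor over \<open>y\<close>. The first crosses to
  \<open>w\<close>, the last is absorbed into \<open>v\<close>, and \<open>E E = h E\<close> with
  \<open>h\<close> invertible does the rest.\<close>

lemma (in young) bmap_ysym_span_dual:
  "fv.span {bmap U V N (ysym N x y d v) w | v w. v \<in> tens U N \<and> w \<in> tens V N}
   \<subseteq> fv.span {bmap U V N (ysym N y x (\<not> d) v) w :: _ \<Rightarrow> 'a::field_char_0 | v w. v \<in> tens U N \<and> w \<in> tens V N}"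
    (is "_ \<subseteq> fv.span ?X")
proof (rule fv.span_minimal[OF _ fv.subspace_span], clarify)
  fix v w :: "idx list \<Rightarrow> 'a" assume v: "v \<in> tens U N" and w: "w \<in> tens V N"
  let ?h = "of_int (yscale N x y d) :: 'a"
  let ?v = "symm N y d v" and ?w = "symm N x (\<not> d) w"
  have "sc ?h (bmap U V N (ysym N x y d v) w) = bmap U V N (ysym N x y d (ysym N x y d v)) w"
    unfolding ysym_ysym[OF v] bmap_sc_left ..
  also have "ysym N x y d (ysym N x y d v) = symm N x (\<not> d) (ysym N y x (\<not> d) ?v)"
    by (simp add: ysym_def)
  also have "bmap U V N \<dots> w = bmap U V N (ysym N y x (\<not> d) ?v) ?w"
    by (rule bmap_symm[OF w])
  also have "\<dots> \<in> ?X" using symm_tens[OF v] symm_tens[OF w] by blast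
  finally have "sc (inverse ?h) (sc ?h (bmap U V N (ysym N x y d v) w)) \<in> fv.span ?X"
    by (intro fv.span_scale fv.span_base)
  then show "bmap U V N (ysym N x y d v) w \<in> fv.span ?X" using yscale_pos by simp
qed

lemma (in young) bmap_ysym_span_dual_eq:
  "fv.span {bmap U V N (ysym N x y d v) w | v w. v \<in> tens U N \<and> w \<in> tens V N}
   = fv.span {bmap U V N (ysym N y x (\<not> d) v) w :: _ \<Rightarrow> 'a::field_char_0 | v w. v \<in> tens U N \<and> w \<in> tens V N}"
proof -
  interpret D: young N y x "\<not> d" using young_dual young_axioms by blast
  show ?thesis using bmap_ysym_span_dual[of U V, where 'a = 'a] D.bmap_ysym_span_dual[of U V, where 'a = 'a] by auto
qed

lemma finite_RR [simp]: "finite (RR k l)"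
proof -
  have "RR k l \<subseteq> Pair False ` {..k} \<union> Pair True ` {..l}" by (auto simp: RR_def)
  then show ?thesis by (rule finite_subset) simp
qed

lemma cells_down:
  assumes "is_partition lam N" "(r, c) \<in> cells lam" "r' \<le> r" "c' \<le> c"
  shows "(r', c') \<in> cells lam"
proof -
  have "r < length lam" "c < lam ! r" using assms by (auto simp: cells_def)
  moreover have "lam ! r \<le> lam ! r'"
    using assms(1,3) \<open>r < length lam\<close> unfolding is_partition_def sorted_wrt_iff_nth_less
    by (cases "r' = r") auto
  ultimately show ?thesis using assms(3,4) by (auto simp: cells_def)
qed

text \<open>Tableaux are total functions, and \<open>tableau_exists\<close> relates two of them only
  on the cells; this identifies their polytabloids nevertheless.\<close>

lemma polytabloid_cong:
  assumes "\<And>z. z \<in> cells lam \<Longrightarrow> t z = t' z"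
  shows "polytabloid lam N t = polytabloid lam N t'"
proof -
  have inv_eq: "inv_into (cells lam) (\<tau> \<circ> t) = inv_into (cells lam) (\<tau> \<circ> t')" for \<tau> :: "nat \<Rightarrow> nat"
    unfolding inv_into_def using assms by (intro ext arg_cong[where f = Eps]) auto
  have "rowf lam N (\<tau> \<circ> t) = rowf lam N (\<tau> \<circ> t')" for \<tau>
    by (simp only: rowf_def inv_eq)
  moreover have "colstab lam N t = colstab lam N t'"
    unfolding colstab_def using assms by auto
  ultimately show ?thesis unfolding polytabloid_def by simp
qed

text \<open>\<open>equivariant\<close> grants linearity only for arguments in the Specht module, so
  the induction carries the membership of partial sums along.\<close>

lemma equivariant_sum:
  assumes eq: "equivariant k l lam N \<phi>" and "finite A" "\<And>a. a \<in> A \<Longrightarrow> g a \<in> specht lam N" "A \<noteq> {}"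
  shows "\<phi> (\<Sum>a\<in>A. sc (c a) (g a)) = (\<Sum>a\<in>A. sc (c a) (\<phi> (g a)))
    \<and> (\<Sum>a\<in>A. sc (c a) (g a)) \<in> specht lam N"
proof -
  have lin: "\<phi> (sc a v + sc b w) = sc a (\<phi> v) + sc b (\<phi> w)"
    if "v \<in> specht lam N" "w \<in> specht lam N" for v w a b
    using eq that unfolding equivariant_def by (simp add: sc_def plus_fun_def)
  have sub: "fv.subspace (specht lam N)" unfolding specht_def lspan_eq_span by (rule fv.subspace_span)
  show ?thesis using assms(2,4,3)
  proof (induction A rule: finite_ne_induct)
    case (singleton a)
    have "\<phi> (sc (c a) (g a)) = sc (c a) (\<phi> (g a))" using lin[of "g a" "g a" "c a" 0] singleton by simp
    then show ?case using singleton fv.subspace_scale[OF sub] by simp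
  next
    case (insert a A)
    let ?s = "\<Sum>a\<in>A. sc (c a) (g a)"
    have IH: "\<phi> ?s = (\<Sum>a\<in>A. sc (c a) (\<phi> (g a)))" "?s \<in> specht lam N" using insert by auto
    have ga: "g a \<in> specht lam N" using insert by simp
    have "\<phi> (sc (c a) (g a) + ?s) = sc (c a) (\<phi> (g a)) + \<phi> ?s" using lin[OF ga IH(2), of "c a" 1] by simp
    moreover have "sc (c a) (g a) + ?s \<in> specht lam N"
      by (rule fv.subspace_add[OF sub fv.subspace_scale[OF sub ga] IH(2)])
    ultimately show ?case using insert.hyps IH by simp
  qed
qed

section \<open>Tableaux as coordinates of positions\<close>

locale tab =
  fixes lam :: "nat list" and N :: nat and t :: "nat \<times> nat \<Rightarrow> nat"
  assumes part: "is_partition lam N" and tab: "is_tableau lam N t"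
begin

definition "cell = inv_into (cells lam) t"
definition "row a = fst (cell a)"
definition "col a = snd (cell a)"

lemma t_bij: "bij_betw t (cells lam) {..<N}"
  using tab by (simp add: is_tableau_def lessThan_atLeast0)

lemma t_cell: "a < N \<Longrightarrow> t (cell a) = a"
  using bij_betw_inv_into_right[OF t_bij] by (simp add: cell_def)

lemma cell_mem: "a < N \<Longrightarrow> cell a \<in> cells lam"
  using bij_betwE[OF bij_betw_inv_into[OF t_bij]] by (simp add: cell_def)

lemma t_lt: "z \<in> cells lam \<Longrightarrow> t z < N"
  using bij_betwE[OF t_bij] by auto

lemma cell_t: "z \<in> cells lam \<Longrightarrow> cell (t z) = z"
  using bij_betw_inv_into_left[OF t_bij] by (simp add: cell_def)

lemma row_t: "z \<in> cells lam \<Longrightarrow> row (t z) = fst z" and col_t: "z \<in> cells lam \<Longrightarrow> col (t z) = snd z"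
  by (simp_all add: row_def col_def cell_t)

lemma young: "young N row col"
proof
  fix a b assume ab: "a < N" "b < N" "row a = row b" "col a = col b"
  then have "cell a = cell b" by (simp add: row_def col_def prod_eq_iff)
  then show "a = b" using t_cell ab by metis
next
  fix a r c assume a: "a < N" "r \<le> row a" "c \<le> col a"
  have "(row a, col a) \<in> cells lam" using cell_mem[OF a(1)] by (simp add: row_def col_def)
  then have "(r, c) \<in> cells lam" using cells_down[OF part] a by blast
  then show "\<exists>b<N. row b = r \<and> col b = c"
    using t_lt row_t col_t by (intro exI[of _ "t (r, c)"]) auto
qed

text \<open>\<open>rowstab\<close> and \<open>colstab\<close> differ only in the coordinate
  \<open>g\<close> of a cell, and \<open>f\<close> is that coordinate transported to
  positions.\<close>

lemma stab_cells:
  assumes "\<And>z. z \<in> cells lam \<Longrightarrow> f (t z) = g z"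
  shows "{\<sigma>. \<sigma> permutes {0..<N} \<and> (\<forall>z\<in>cells lam. \<exists>z'\<in>cells lam. g z' = g z \<and> \<sigma> (t z) = t z')} = stab N f"
proof -
  have "(\<forall>z\<in>cells lam. \<exists>z'\<in>cells lam. g z' = g z \<and> \<sigma> (t z) = t z') \<longleftrightarrow> (\<forall>a<N. f (\<sigma> a) = f a)"
    if p: "\<sigma> permutes {..<N}" for \<sigma>
  proof
    assume L: "\<forall>z\<in>cells lam. \<exists>z'\<in>cells lam. g z' = g z \<and> \<sigma> (t z) = t z'"
    show "\<forall>a<N. f (\<sigma> a) = f a"
    proof (intro allI impI)
      fix a assume a: "a < N"
      obtain z' where z': "z' \<in> cells lam" "g z' = g (cell a)" "\<sigma> (t (cell a)) = t z'"
        using L cell_mem[OF a] by blast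
      then show "f (\<sigma> a) = f a"
        using assms[OF z'(1)] assms[OF cell_mem[OF a]] t_cell[OF a] by simp
    qed
  next
    assume Rt: "\<forall>a<N. f (\<sigma> a) = f a"
    show "\<forall>z\<in>cells lam. \<exists>z'\<in>cells lam. g z' = g z \<and> \<sigma> (t z) = t z'"
    proof
      fix z assume z: "z \<in> cells lam"
      have lt: "\<sigma> (t z) < N" using permutes_lt[OF p] t_lt[OF z] by simp
      have "g (cell (\<sigma> (t z))) = g z"
        using assms[OF cell_mem[OF lt]] t_cell[OF lt] Rt t_lt[OF z] assms[OF z] by simp
      then show "\<exists>z'\<in>cells lam. g z' = g z \<and> \<sigma> (t z) = t z'"
        using cell_mem[OF lt] t_cell[OF lt] by (intro bexI[of _ "cell (\<sigma> (t z))"]) auto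
    qed
  qed
  then show ?thesis unfolding stab_def lessThan_atLeast0 by blast
qed

lemma rowstab_eq: "rowstab lam N t = stab N row"
  unfolding rowstab_def by (rule stab_cells[where g = fst]) (rule row_t)

lemma colstab_eq: "colstab lam N t = stab N col"
  unfolding colstab_def by (rule stab_cells[where g = snd]) (rule col_t)

text \<open>Given weak increase, strictness on one parity means that equal entries have the other
  parity, a condition that no longer refers to the order of the two cells.\<close>

lemma semistd_iff: "semistd lam t I \<longleftrightarrow> sstd N row col True I"
proof -
  have cells_iff: "(\<forall>a<N. \<forall>b<N. P (row a) (col a) (row b) (col b) a b) \<longleftrightarrow>
     (\<forall>r c r' c'. (r, c) \<in> cells lam \<longrightarrow> (r', c') \<in> cells lam \<longrightarrow> P r c r' c' (t (r, c)) (t (r', c')))" for P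
  proof
    assume *: "\<forall>a<N. \<forall>b<N. P (row a) (col a) (row b) (col b) a b"
    show "\<forall>r c r' c'. (r, c) \<in> cells lam \<longrightarrow> (r', c') \<in> cells lam \<longrightarrow> P r c r' c' (t (r, c)) (t (r', c'))"
    proof (intro allI impI)
      fix r c r' c' assume z: "(r, c) \<in> cells lam" "(r', c') \<in> cells lam"
      show "P r c r' c' (t (r, c)) (t (r', c'))"
        using *[rule_format, OF t_lt[OF z(1)] t_lt[OF z(2)]] row_t[OF z(1)] row_t[OF z(2)] col_t[OF z(1)] col_t[OF z(2)]
        by simp
    qed
  next
    assume *: "\<forall>r c r' c'. (r, c) \<in> cells lam \<longrightarrow> (r', c') \<in> cells lam \<longrightarrow> P r c r' c' (t (r, c)) (t (r', c'))"
    show "\<forall>a<N. \<forall>b<N. P (row a) (col a) (row b) (col b) a b"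
    proof (intro allI impI)
      fix a b assume ab: "a < N" "b < N"
      have z: "(row a, col a) = cell a" "(row b, col b) = cell b" by (simp_all add: row_def col_def)
      show "P (row a) (col a) (row b) (col b) a b"
        using *[rule_format, of "row a" "col a" "row b" "col b"] cell_mem[OF ab(1)] cell_mem[OF ab(2)]
          t_cell[OF ab(1)] t_cell[OF ab(2)] unfolding z by simp
    qed
  qed
  interpret young N row col True by (rule young)
  have "sstd N row col True I \<longleftrightarrow>
     (\<forall>a<N. \<forall>b<N. row a = row b \<and> col a < col b \<longrightarrow> I ! a \<le> I ! b \<and> (par (I ! a) \<and> par (I ! b) \<longrightarrow> I ! a < I ! b)) \<and>
     (\<forall>a<N. \<forall>b<N. col a = col b \<and> row a < row b \<longrightarrow> I ! a \<le> I ! b \<and> (\<not> par (I ! a) \<and> \<not> par (I ! b) \<longrightarrow> I ! a < I ! b))"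
    (is "_ \<longleftrightarrow> ?R \<and> ?C")
  proof
    assume s: "sstd N row col True I"
    show "?R \<and> ?C"
    proof (intro conjI allI impI; elim conjE)
      fix a b assume ab: "a < N" "b < N" "row a = row b" "col a < col b"
      then have ne: "a \<noteq> b" by auto
      show le: "I ! a \<le> I ! b" using s ab unfolding sstd_def fsorted_def by simp
      show "I ! a < I ! b" if "par (I ! a)" "par (I ! b)"
        using s ab ne that le unfolding sstd_def by (metis order_le_less)
    next
      fix a b assume ab: "a < N" "b < N" "col a = col b" "row a < row b"
      then have ne: "a \<noteq> b" by auto
      show le: "I ! a \<le> I ! b" using s ab unfolding sstd_def fsorted_def by simp
      show "I ! a < I ! b" if "\<not> par (I ! a)" "\<not> par (I ! b)"
        using s ab ne that le unfolding sstd_def by (metis order_le_less)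
    qed
  next
    assume RC: "?R \<and> ?C"
    show "sstd N row col True I" unfolding sstd_def fsorted_def
    proof (intro conjI allI impI)
      fix a b assume ab: "a < N" "b < N" "a \<noteq> b" "col a = col b" "I ! a = I ! b"
      then consider "row a < row b" | "row b < row a" using coord_inj[of a b] by linarith
      then show "par (I ! a) = True"
      proof cases
        case 1
        then have "\<not> par (I ! a) \<and> \<not> par (I ! b) \<longrightarrow> I ! a < I ! b" using conjunct2[OF RC] ab(1,2,4) by blast
        then show ?thesis using ab(5) by simp
      next
        case 2
        then have "\<not> par (I ! b) \<and> \<not> par (I ! a) \<longrightarrow> I ! b < I ! a" using conjunct2[OF RC] ab(1,2) ab(4)[symmetric] by blast
        then show ?thesis using ab(5) by simp
      qed
    next
      fix a b assume ab: "a < N" "b < N" "a \<noteq> b" "row a = row b" "I ! a = I ! b"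
      then consider "col a < col b" | "col b < col a" using coord_inj[of a b] by linarith
      then show "par (I ! a) = (\<not> True)"
      proof cases
        case 1
        then have "par (I ! a) \<and> par (I ! b) \<longrightarrow> I ! a < I ! b" using conjunct1[OF RC] ab(1,2,4) by blast
        then show ?thesis using ab(5) by simp
      next
        case 2
        then have "par (I ! b) \<and> par (I ! a) \<longrightarrow> I ! b < I ! a" using conjunct1[OF RC] ab(1,2) ab(4)[symmetric] by blast
        then show ?thesis using ab(5) by simp
      qed
    qed (use RC in blast)+
  qed
  then show ?thesis
    unfolding semistd_def
      cells_iff[of "\<lambda>r c r' c' a b. r = r' \<and> c < c' \<longrightarrow> I ! a \<le> I ! b \<and> (par (I ! a) \<and> par (I ! b) \<longrightarrow> I ! a < I ! b)"]
      cells_iff[of "\<lambda>r c r' c' a b. c = c' \<and> r < r' \<longrightarrow> I ! a \<le> I ! b \<and> (\<not> par (I ! a) \<and> \<not> par (I ! b) \<longrightarrow> I ! a < I ! b)"]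
    by blast
qed

lemma bmap_tact_\<delta>:
  assumes "finite U" "finite V" "I \<in> seqs U N" "J \<in> seqs V N" "\<pi> permutes {..<N}"
  shows "bmap U V N (tact N \<pi> (\<delta> I)) (\<delta> J) = sc (csign I (inv \<pi>)) (Z (act \<pi> I) J)"
proof -
  have len: "length I = N" using assms by (simp add: seqs_def)
  have "permute_list (inv \<pi>) I \<in> seqs U N" using assms permute_seqs[OF permutes_inv[OF assms(5)]] by blast
  then show ?thesis unfolding tact_\<delta>[OF assms(5) len] bmap_sc_left act_eq using assms by (simp add: bmap_\<delta>)
qed

lemma Pt_eq:
  assumes "finite U" "finite V" "I \<in> seqs U N" "J \<in> seqs V N"
  shows "Pt lam N t I J = (bmap U V N (ysym N row col True (\<delta> I)) (\<delta> J) :: _ \<Rightarrow> 'a::field)"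
proof -
  have "bmap U V N (ysym N row col True (\<delta> I)) (\<delta> J)
     = (\<Sum>\<sigma>\<in>stab N row. \<Sum>\<tau>\<in>stab N col. sc (of_int (sign \<tau>)) (bmap U V N (tact N (\<sigma> \<circ> \<tau>) (\<delta> I)) (\<delta> J :: _ \<Rightarrow> 'a)))"
    unfolding ysym_def symm_def tact_sum tact_sc fv.scale_sum_right bmap_sum_left bmap_sc_left
    by (intro sum.cong refl) (simp add: chi_def tact_comp[OF stab_Sym stab_Sym])
  also have "\<dots> = (\<Sum>\<sigma>\<in>stab N row. \<Sum>\<tau>\<in>stab N col. sc (of_int (sign \<tau>)) (sc (csign I (inv (\<sigma> \<circ> \<tau>))) (Z (act (\<sigma> \<circ> \<tau>) I) J)))"
    by (intro sum.cong refl) (simp only: bmap_tact_\<delta>[OF assms permutes_compose[OF stab_Sym stab_Sym]])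
  finally show ?thesis
    unfolding Pt_def rowstab_eq colstab_eq by (simp only: fun_eq_iff pointwise mult.assoc simp_thms)
qed

lemma Ptil_eq:
  assumes "finite U" "finite V" "I \<in> seqs U N" "J \<in> seqs V N"
  shows "Ptil lam N t I J = (bmap U V N (ysym N col row False (\<delta> I)) (\<delta> J) :: _ \<Rightarrow> 'a::field)"
proof -
  have "bmap U V N (ysym N col row False (\<delta> I)) (\<delta> J)
     = (\<Sum>\<tau>\<in>stab N col. \<Sum>\<sigma>\<in>stab N row. sc (of_int (sign \<tau>)) (bmap U V N (tact N (\<tau> \<circ> \<sigma>) (\<delta> I)) (\<delta> J :: _ \<Rightarrow> 'a)))"
    unfolding ysym_def symm_def tact_sum tact_sc fv.scale_sum_right bmap_sum_left bmap_sc_left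
    by (intro sum.cong refl) (simp add: chi_def tact_comp[OF stab_Sym stab_Sym])
  also have "\<dots> = (\<Sum>\<tau>\<in>stab N col. \<Sum>\<sigma>\<in>stab N row. sc (of_int (sign \<tau>)) (sc (csign I (inv (\<tau> \<circ> \<sigma>))) (Z (act (\<tau> \<circ> \<sigma>) I) J)))"
    by (intro sum.cong refl) (simp only: bmap_tact_\<delta>[OF assms permutes_compose[OF stab_Sym stab_Sym]])
  also have "\<dots> = (\<Sum>\<sigma>\<in>stab N row. \<Sum>\<tau>\<in>stab N col. sc (of_int (sign \<tau>)) (sc (csign I (inv (\<tau> \<circ> \<sigma>))) (Z (act (\<tau> \<circ> \<sigma>) I) J)))"
    by (rule sum.swap)
  finally show ?thesis
    unfolding Ptil_def rowstab_eq colstab_eq by (simp only: fun_eq_iff pointwise mult.assoc simp_thms)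
qed

text \<open>The tabloid of the tableau \<open>inv \<rho> \<circ> t\<close>.\<close>

definition rowT :: "(nat \<Rightarrow> nat) \<Rightarrow> nat \<Rightarrow> nat" where
  "rowT \<rho> = (\<lambda>a. if a < N then row (\<rho> a) else 0)"

lemma rowT_comp: "\<sigma> permutes {..<N} \<Longrightarrow> rowT \<rho> \<circ> \<sigma> = rowT (\<rho> \<circ> \<sigma>)"
  by (auto simp: rowT_def fun_eq_iff permutes_lt)

lemma rowf_comp:
  assumes p: "\<pi> permutes {..<N}"
  shows "rowf lam N (\<pi> \<circ> t) = rowT (inv \<pi>)"
proof
  fix a
  show "rowf lam N (\<pi> \<circ> t) a = rowT (inv \<pi>) a"
  proof (cases "a < N")
    case True
    then have lt: "inv \<pi> a < N" using permutes_lt[OF permutes_inv[OF p]] by simp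
    have inj: "inj_on (\<pi> \<circ> t) (cells lam)"
      using t_bij permutes_inj_on[OF p] by (intro comp_inj_on) (auto simp: bij_betw_def)
    have "inv_into (cells lam) (\<pi> \<circ> t) a = cell (inv \<pi> a)"
      by (rule inv_into_f_eq[OF inj cell_mem[OF lt]]) (simp add: t_cell[OF lt] permutes_inverses[OF p])
    then show ?thesis using True by (simp add: rowf_def rowT_def row_def)
  qed (simp add: rowf_def rowT_def)
qed

abbreviation "W' \<equiv> wgt N col row False"

lemma polytabloid_eq:
  "polytabloid lam N t T = (\<Sum>\<tau>\<in>stab N col. if T = rowT (inv \<tau>) then of_int (sign \<tau>) else 0)"
  unfolding polytabloid_def colstab_eq by (intro sum.cong refl) (simp add: rowf_comp[OF stab_Sym])

text \<open>Tabloids are cosets of the row stabilizer: \<open>\<tau>\<close> contributes exactly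
  when \<open>inv \<tau> \<circ> \<pi>\<close> is a row permutation and so completes a factorization
  of \<open>\<pi>\<close>. This ties the Specht module to the symmetrizer.\<close>

lemma polytabloid_rowT:
  assumes p: "\<pi> permutes {..<N}"
  shows "polytabloid lam N t (rowT (inv \<pi>)) = of_int (W' \<pi>)"
proof -
  have "W' \<pi> = (\<Sum>\<tau>\<in>stab N col. if rowT (inv \<pi>) = rowT (inv \<tau>) then sign \<tau> else 0)"
    unfolding wgt_def
  proof (rule sum.cong[OF refl])
    fix \<tau> assume \<tau>: "\<tau> \<in> stab N col"
    note tp = stab_Sym[OF \<tau>]
    have 1: "\<tau> \<circ> \<sigma> = \<pi> \<longleftrightarrow> \<sigma> = inv \<tau> \<circ> \<pi>" for \<sigma>
    proof
      assume "\<tau> \<circ> \<sigma> = \<pi>"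
      then show "\<sigma> = inv \<tau> \<circ> \<pi>" using permutes_inv_o(2)[OF tp] by (metis comp_id fun.map_comp id_comp)
    next
      assume "\<sigma> = inv \<tau> \<circ> \<pi>"
      then show "\<tau> \<circ> \<sigma> = \<pi>" using permutes_inv_o(1)[OF tp] by (simp add: o_assoc)
    qed
    have ip: "inv \<tau> \<circ> \<pi> permutes {..<N}" by (rule permutes_compose[OF p permutes_inv[OF tp]])
    have 2: "rowT (inv \<pi>) = rowT (inv \<tau>) \<longleftrightarrow> inv \<tau> \<circ> \<pi> \<in> stab N row"
    proof
      assume eq: "rowT (inv \<pi>) = rowT (inv \<tau>)"
      have "row ((inv \<tau> \<circ> \<pi>) b) = row b" if b: "b < N" for b
      proof -
        have "\<pi> b < N" using permutes_lt[OF p] b by simp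
        then have "row (inv \<pi> (\<pi> b)) = row (inv \<tau> (\<pi> b))"
          using fun_cong[OF eq, of "\<pi> b"] by (simp add: rowT_def)
        then show ?thesis using permutes_inverses[OF p] by simp
      qed
      then show "inv \<tau> \<circ> \<pi> \<in> stab N row" using ip by (simp add: stab_def)
    next
      assume s: "inv \<tau> \<circ> \<pi> \<in> stab N row"
      have "row (inv \<pi> a) = row (inv \<tau> a)" if "a < N" for a
        using stab_apply[OF s, of "inv \<pi> a"] permutes_lt[OF permutes_inv[OF p]] that permutes_inverses[OF p] by simp
      then show "rowT (inv \<pi>) = rowT (inv \<tau>)" by (simp add: rowT_def fun_eq_iff)
    qed
    have "(\<Sum>\<sigma>\<in>stab N row. if \<tau> \<circ> \<sigma> = \<pi> then chi (\<not> False) \<tau> * chi False \<sigma> else 0)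
        = (\<Sum>\<sigma>\<in>stab N row. if \<sigma> = inv \<tau> \<circ> \<pi> then sign \<tau> else 0)"
      unfolding 1 by (intro sum.cong refl) (simp add: chi_def)
    also have "\<dots> = (if rowT (inv \<pi>) = rowT (inv \<tau>) then sign \<tau> else 0)"
      unfolding 2 by (rule sum.delta[OF finite_stab])
    finally show "(\<Sum>\<sigma>\<in>stab N row. if \<tau> \<circ> \<sigma> = \<pi> then chi (\<not> False) \<tau> * chi False \<sigma> else 0)
        = (if rowT (inv \<pi>) = rowT (inv \<tau>) then sign \<tau> else 0)" .
  qed
  then show ?thesis unfolding polytabloid_eq by (simp add: if_distrib cong: if_cong)
qed

lemma is_tableau_comp: "\<pi> permutes {..<N} \<Longrightarrow> is_tableau lam N (\<pi> \<circ> t)"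
  unfolding is_tableau_def atLeast0LessThan by (rule bij_betw_trans[OF t_bij permutes_imp_bij])

text \<open>The column stabilizer of \<open>\<pi> \<circ> t\<close> is the conjugate by
  \<open>\<pi>\<close> of that of \<open>t\<close>, and conjugation preserves signs.\<close>

lemma polytabloid_comp:
  assumes p: "\<pi> permutes {..<N}"
  shows "polytabloid lam N (\<pi> \<circ> t) = Mact \<pi> (polytabloid lam N t)"
proof
  fix T
  interpret tp: tab lam N "\<pi> \<circ> t" by unfold_locales (rule part, rule is_tableau_comp[OF p])
  have col': "tp.col (\<pi> a) = col a" if "a < N" for a
    using tp.col_t[OF cell_mem[OF that]] t_cell[OF that] by (simp add: col_def)
  have bij: "bij_betw (\<lambda>\<tau>. \<pi> \<circ> \<tau> \<circ> inv \<pi>) (stab N col) (stab N tp.col)"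
  proof (rule bij_betw_byWitness[where f' = "\<lambda>\<tau>. inv \<pi> \<circ> \<tau> \<circ> \<pi>"])
    show "\<forall>\<tau>\<in>stab N col. inv \<pi> \<circ> (\<pi> \<circ> \<tau> \<circ> inv \<pi>) \<circ> \<pi> = \<tau>" "\<forall>\<tau>\<in>stab N tp.col. \<pi> \<circ> (inv \<pi> \<circ> \<tau> \<circ> \<pi>) \<circ> inv \<pi> = \<tau>"
      by (auto simp: fun_eq_iff permutes_inverses[OF p])
    show "(\<lambda>\<tau>. \<pi> \<circ> \<tau> \<circ> inv \<pi>) ` stab N col \<subseteq> stab N tp.col"
    proof clarify
      fix \<tau> assume \<tau>: "\<tau> \<in> stab N col"
      note q = stab_Sym[OF \<tau>]
      have "tp.col (\<pi> (\<tau> (inv \<pi> a))) = tp.col a" if "a < N" for a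
      proof -
        have lt: "inv \<pi> a < N" "\<tau> (inv \<pi> a) < N" using that permutes_lt[OF permutes_inv[OF p]] permutes_lt[OF q] by auto
        have "tp.col (\<pi> (\<tau> (inv \<pi> a))) = col (inv \<pi> a)" using col'[OF lt(2)] stab_apply[OF \<tau> lt(1)] by simp
        also have "\<dots> = tp.col a" using col'[OF lt(1)] permutes_inverses[OF p] by simp
        finally show ?thesis .
      qed
      moreover have "\<pi> \<circ> \<tau> \<circ> inv \<pi> permutes {..<N}" by (intro permutes_compose permutes_inv p q)
      ultimately show "\<pi> \<circ> \<tau> \<circ> inv \<pi> \<in> stab N tp.col" by (simp add: stab_def)
    qed
    show "(\<lambda>\<tau>. inv \<pi> \<circ> \<tau> \<circ> \<pi>) ` stab N tp.col \<subseteq> stab N col"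
    proof clarify
      fix \<tau> assume \<tau>: "\<tau> \<in> stab N tp.col"
      note q = stab_Sym[OF \<tau>]
      have "col (inv \<pi> (\<tau> (\<pi> a))) = col a" if "a < N" for a
      proof -
        have lt: "\<pi> a < N" "inv \<pi> (\<tau> (\<pi> a)) < N"
          using that permutes_lt[OF permutes_inv[OF p]] permutes_lt[OF q] permutes_lt[OF p] by auto
        have "col (inv \<pi> (\<tau> (\<pi> a))) = tp.col (\<tau> (\<pi> a))" using col'[OF lt(2)] permutes_inverses[OF p] by simp
        also have "\<dots> = col a" using stab_apply[OF \<tau> lt(1)] col'[OF that] by simp
        finally show ?thesis .
      qed
      moreover have "inv \<pi> \<circ> \<tau> \<circ> \<pi> permutes {..<N}" by (intro permutes_compose permutes_inv p q)
      ultimately show "inv \<pi> \<circ> \<tau> \<circ> \<pi> \<in> stab N col" by (simp add: stab_def)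
    qed
  qed
  have "polytabloid lam N (\<pi> \<circ> t) T = (\<Sum>\<tau>\<in>stab N tp.col. if T = rowf lam N (\<tau> \<circ> (\<pi> \<circ> t)) then of_int (sign \<tau>) else (0 :: 'a))"
    unfolding polytabloid_def tp.colstab_eq ..
  also have "\<dots> = (\<Sum>\<tau>\<in>stab N col. if T = rowf lam N (\<pi> \<circ> \<tau> \<circ> inv \<pi> \<circ> (\<pi> \<circ> t)) then of_int (sign (\<pi> \<circ> \<tau> \<circ> inv \<pi>)) else 0)"
    by (rule sum.reindex_bij_betw[OF bij, symmetric])
  also have "\<dots> = (\<Sum>\<tau>\<in>stab N col. if T \<circ> \<pi> = rowT (inv \<tau>) then of_int (sign \<tau>) else 0)"
  proof (rule sum.cong[OF refl])
    fix \<tau> assume \<tau>: "\<tau> \<in> stab N col"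
    note q = stab_Sym[OF \<tau>]
    have "\<pi> \<circ> \<tau> \<circ> inv \<pi> \<circ> (\<pi> \<circ> t) = (\<pi> \<circ> \<tau>) \<circ> t" by (auto simp: fun_eq_iff permutes_inverses[OF p])
    then have r: "rowf lam N (\<pi> \<circ> \<tau> \<circ> inv \<pi> \<circ> (\<pi> \<circ> t)) = rowT (inv \<tau> \<circ> inv \<pi>)"
      using rowf_comp[OF permutes_compose[OF q p]] inv_comp[OF p q] by simp
    have "T = rowT (inv \<tau> \<circ> inv \<pi>) \<longleftrightarrow> T \<circ> \<pi> = rowT (inv \<tau>)"
    proof
      assume "T = rowT (inv \<tau> \<circ> inv \<pi>)"
      then have "T \<circ> \<pi> = rowT (inv \<tau> \<circ> inv \<pi> \<circ> \<pi>)" using rowT_comp[OF p] by simp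
      then show "T \<circ> \<pi> = rowT (inv \<tau>)" by (simp only: o_assoc[symmetric] permutes_inv_o[OF p] comp_id)
    next
      assume "T \<circ> \<pi> = rowT (inv \<tau>)"
      then have "T \<circ> \<pi> \<circ> inv \<pi> = rowT (inv \<tau> \<circ> inv \<pi>)" using rowT_comp[OF permutes_inv[OF p]] by simp
      then show "T = rowT (inv \<tau> \<circ> inv \<pi>)" by (simp only: o_assoc[symmetric] permutes_inv_o[OF p] comp_id)
    qed
    moreover have "sign (\<pi> \<circ> \<tau> \<circ> inv \<pi>) = sign \<tau>"
    proof -
      have P: "permutation \<pi>" "permutation \<tau>" "permutation (inv \<pi>)"
        using p q permutes_inv[OF p] permutes_imp_permutation[OF finite_lessThan] by blast+
      then have "sign (\<pi> \<circ> \<tau> \<circ> inv \<pi>) = sign \<pi> * sign \<tau> * sign \<pi>"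
        by (simp add: sign_compose permutation_compose sign_inverse)
      also have "\<dots> = (sign \<pi> * sign \<pi>) * sign \<tau>" by (simp only: mult_ac)
      finally show ?thesis by simp
    qed
    ultimately show "(if T = rowf lam N (\<pi> \<circ> \<tau> \<circ> inv \<pi> \<circ> (\<pi> \<circ> t)) then of_int (sign (\<pi> \<circ> \<tau> \<circ> inv \<pi>)) else 0)
        = (if T \<circ> \<pi> = rowT (inv \<tau>) then of_int (sign \<tau>) else (0 :: 'a))"
      unfolding r by simp
  qed
  finally show "polytabloid lam N (\<pi> \<circ> t) T = (Mact \<pi> (polytabloid lam N t) T :: 'a)"
    unfolding Mact_def polytabloid_eq .
qed

lemma tableau_exists:
  assumes "is_tableau lam N t'"
  shows "\<exists>\<pi>. \<pi> permutes {..<N} \<and> (\<forall>z\<in>cells lam. t' z = (\<pi> \<circ> t) z)"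
proof -
  define \<pi> where "\<pi> a = (if a < N then t' (cell a) else a)" for a
  have "bij_betw (t' \<circ> cell) {..<N} {..<N}"
    using bij_betw_trans[OF bij_betw_inv_into[OF t_bij], of t' "{..<N}"] assms
    by (simp add: is_tableau_def cell_def lessThan_atLeast0)
  then have "bij_betw \<pi> {..<N} {..<N}"
    by (rule bij_betw_cong[THEN iffD1, rotated]) (simp add: \<pi>_def)
  then have "\<pi> permutes {..<N}" by (rule bij_imp_permutes) (simp add: \<pi>_def)
  moreover have "t' z = (\<pi> \<circ> t) z" if "z \<in> cells lam" for z
    using that t_lt cell_t by (simp add: \<pi>_def)
  ultimately show ?thesis by blast
qed

text \<open>Any two tableaux of one shape differ by a permutation of the entries, so the module is
  cyclic, generated by the polytabloid of \<open>t\<close>.\<close>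

lemma specht_eq: "specht lam N = fv.span {Mact \<pi> (polytabloid lam N t) | \<pi>. \<pi> permutes {..<N}}"
proof -
  have "{polytabloid lam N t' | t'. is_tableau lam N t'} = {Mact \<pi> (polytabloid lam N t :: _ \<Rightarrow> 'a) | \<pi>. \<pi> permutes {..<N}}"
  proof (intro set_eqI iffI; clarify)
    fix t' assume "is_tableau lam N t'"
    then obtain \<pi> where p: "\<pi> permutes {..<N}" and eq: "\<forall>z\<in>cells lam. t' z = (\<pi> \<circ> t) z"
      using tableau_exists by blast
    have "polytabloid lam N t' = (Mact \<pi> (polytabloid lam N t) :: _ \<Rightarrow> 'a)"
      unfolding polytabloid_comp[OF p, symmetric] by (rule polytabloid_cong) (rule bspec[OF eq])
    then show "\<exists>\<pi>. polytabloid lam N t' = (Mact \<pi> (polytabloid lam N t) :: _ \<Rightarrow> 'a) \<and> \<pi> permutes {..<N}"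
      using p by blast
  next
    fix \<pi> :: "nat \<Rightarrow> nat" assume p: "\<pi> permutes {..<N}"
    show "\<exists>t'. Mact \<pi> (polytabloid lam N t) = (polytabloid lam N t' :: _ \<Rightarrow> 'a) \<and> is_tableau lam N t'"
      by (intro exI[of _ "\<pi> \<circ> t"] conjI polytabloid_comp[OF p, symmetric] is_tableau_comp[OF p])
  qed
  then show ?thesis unfolding specht_def lspan_eq_span by simp
qed

lemma Mact_polytabloid_specht:
  "\<pi> permutes {..<N} \<Longrightarrow> Mact \<pi> (polytabloid lam N t) \<in> specht lam N"
  unfolding specht_eq by (intro fv.span_base) blast

text \<open>At a tabloid all values are coefficients by \<open>polytabloid_rowT\<close>, and the
  left side is the sum of \<open>wgt_convolution\<close> with the identity as first argument. At any
  other function both sides vanish.\<close>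

lemma polytabloid_ysym:
  "(\<Sum>\<pi>\<in>Sym N. sc (of_int (W' \<pi>)) (Mact \<pi> (polytabloid lam N t)))
    = sc (of_int (yscale N col row False)) (polytabloid lam N t :: _ \<Rightarrow> 'a::field)"
proof
  fix T
  interpret D: young N col row False using young_dual young by blast
  have L: "(\<Sum>\<pi>\<in>Sym N. sc (of_int (W' \<pi>)) (Mact \<pi> (polytabloid lam N t))) T
      = (\<Sum>\<pi>\<in>Sym N. of_int (W' \<pi>) * (polytabloid lam N t (T \<circ> \<pi>) :: 'a))"
    by (simp add: pointwise Mact_def)
  show "(\<Sum>\<pi>\<in>Sym N. sc (of_int (W' \<pi>)) (Mact \<pi> (polytabloid lam N t))) T
    = (sc (of_int (yscale N col row False)) (polytabloid lam N t) T :: 'a)"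
  proof (cases "\<exists>\<rho>. \<rho> permutes {..<N} \<and> T = rowT (inv \<rho>)")
    case True
    then obtain \<rho> where \<rho>: "\<rho> permutes {..<N}" "T = rowT (inv \<rho>)" by blast
    have "polytabloid lam N t (T \<circ> \<pi>) = (of_int (W' (inv \<pi> \<circ> \<rho>)) :: 'a)" if p: "\<pi> permutes {..<N}" for \<pi>
    proof -
      have "T \<circ> \<pi> = rowT (inv \<rho> \<circ> \<pi>)" using rowT_comp[OF p] \<rho> by simp
      also have "inv \<rho> \<circ> \<pi> = inv (inv \<pi> \<circ> \<rho>)"
        using inv_comp[OF permutes_inv[OF p] \<rho>(1)] permutes_inv_inv[OF p] by simp
      finally show ?thesis by (simp only: polytabloid_rowT[OF permutes_compose[OF \<rho>(1) permutes_inv[OF p]]])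
    qed
    then have "(\<Sum>\<pi>\<in>Sym N. of_int (W' \<pi>) * (polytabloid lam N t (T \<circ> \<pi>) :: 'a))
        = of_int (\<Sum>\<pi>\<in>Sym N. W' \<pi> * W' (id \<circ> inv \<pi> \<circ> \<rho>))"
      unfolding of_int_sum by (intro sum.cong refl) simp
    also have "\<dots> = of_int (yscale N col row False) * of_int (W' \<rho>)"
      using D.wgt_convolution[of id \<rho>] \<rho> D.wgt_id by simp
    finally show ?thesis using L \<rho> polytabloid_rowT[OF \<rho>(1), where 'a = 'a] by (simp add: pointwise)
  next
    case False
    have z: "polytabloid lam N t T' = (0 :: 'a)" if "\<And>\<rho>. \<rho> permutes {..<N} \<Longrightarrow> T' \<noteq> rowT (inv \<rho>)" for T'
      unfolding polytabloid_eq using that stab_Sym by (intro sum.neutral ballI) auto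
    have "T \<circ> \<pi> \<noteq> rowT (inv \<rho>)" if p: "\<pi> permutes {..<N}" and r: "\<rho> permutes {..<N}" for \<pi> \<rho>
    proof
      assume "T \<circ> \<pi> = rowT (inv \<rho>)"
      then have "T \<circ> \<pi> \<circ> inv \<pi> = rowT (inv \<rho> \<circ> inv \<pi>)" using rowT_comp[OF permutes_inv[OF p]] by simp
      then have "T = rowT (inv (\<pi> \<circ> \<rho>))"
        unfolding inv_comp[OF p r] by (simp only: o_assoc[symmetric] permutes_inv_o[OF p] comp_id)
      then show False using False permutes_compose[OF r p] by blast
    qed
    then have "polytabloid lam N t (T \<circ> \<pi>) = (0 :: 'a)" if "\<pi> permutes {..<N}" for \<pi> using z that by blast
    moreover have "polytabloid lam N t T = (0 :: 'a)" using z False by blast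
    ultimately show ?thesis using L by (simp add: pointwise)
  qed
qed

text \<open>A module map carries the eigenvector to an eigenvector. Where \<open>yscale\<close> is
  invertible, this places the image of the polytabloid in the image of the symmetrizer.\<close>

lemma equivariant_polytabloid:
  assumes eq: "equivariant k l lam N \<phi>"
  shows "ysym N col row False (\<phi> (polytabloid lam N t))
     = sc (of_int (yscale N col row False)) (\<phi> (polytabloid lam N t) :: _ \<Rightarrow> 'a::field)"
proof -
  let ?p = "polytabloid lam N t :: _ \<Rightarrow> 'a"
  have id: "Mact id ?p = ?p" by (simp add: Mact_def)
  have p: "?p \<in> specht lam N" using Mact_polytabloid_specht[OF permutes_id, where 'a = 'a] unfolding id .
  have "ysym N col row False (\<phi> ?p) = (\<Sum>\<pi>\<in>Sym N. sc (of_int (W' \<pi>)) (\<phi> (Mact \<pi> ?p)))"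
    unfolding ysym_eq_sum_wgt
    by (intro sum.cong refl) (use eq p in \<open>simp add: equivariant_def atLeast0LessThan\<close>)
  also have "\<dots> = \<phi> (\<Sum>\<pi>\<in>Sym N. sc (of_int (W' \<pi>)) (Mact \<pi> ?p))"
  proof -
    have ne: "Sym N \<noteq> {}" using permutes_id by blast
    have mem: "Mact \<pi> ?p \<in> specht lam N" if "\<pi> \<in> Sym N" for \<pi>
      using that by (simp add: Mact_polytabloid_specht)
    show ?thesis
      by (rule conjunct1[OF equivariant_sum[OF eq finite_Sym mem ne], symmetric])
  qed
  also have "\<dots> = sc (of_int (yscale N col row False)) (\<phi> ?p)"
    unfolding polytabloid_ysym
    using equivariant_sum[OF eq, of "{()}" "\<lambda>_. ?p" "\<lambda>_. of_int (yscale N col row False)"] p by simp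
  finally show ?thesis .
qed

lemma ysym_isotypic:
  assumes v: "v \<in> tens (RR k l) N"
  shows "ysym N col row False v \<in> (isotypic k l lam N :: (_ \<Rightarrow> 'a::field) set)"
proof -
  \<comment> \<open>A function on tabloids, pulled back to permutations, acts on \<open>v\<close>
    through the group algebra. At the polytabloid the coefficients are those of \<open>W'\<close>,
    so the value is the symmetrized \<open>v\<close>.\<close>
  define \<phi> where "\<phi> f = (\<Sum>\<pi>\<in>Sym N. sc (f (rowT (inv \<pi>))) (tact N \<pi> v))" for f :: "(nat \<Rightarrow> nat) \<Rightarrow> 'a"
  have eqv: "equivariant k l lam N \<phi>"
    unfolding equivariant_def
  proof (intro conjI ballI allI impI; (elim conjE)?)
    fix f :: "(nat \<Rightarrow> nat) \<Rightarrow> 'a"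
    show "\<phi> f \<in> tensp k l N"
      unfolding \<phi>_def tensp_eq using v
      by (intro fv.subspace_sum[OF tens_subspace] fv.subspace_scale[OF tens_subspace] tact_tens) auto
  next
    fix f g :: "(nat \<Rightarrow> nat) \<Rightarrow> 'a" and a b
    show "\<phi> (\<lambda>T. a * f T + b * g T) = (\<lambda>I. a * \<phi> f I + b * \<phi> g I)"
      unfolding \<phi>_def by (simp add: fun_eq_iff pointwise sum_distrib_left sum.distrib[symmetric] algebra_simps)
  next
    fix \<sigma> and f :: "(nat \<Rightarrow> nat) \<Rightarrow> 'a" assume s: "\<sigma> permutes {0..<N}"
    then have s: "\<sigma> permutes {..<N}" by (simp add: atLeast0LessThan)
    have "\<phi> (Mact \<sigma> f) = (\<Sum>\<pi>\<in>Sym N. sc (f (rowT (inv \<pi>) \<circ> \<sigma>)) (tact N \<pi> v))"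
      by (simp add: \<phi>_def Mact_def)
    also have "\<dots> = (\<Sum>\<pi>\<in>Sym N. sc (f (rowT (inv (\<sigma> \<circ> \<pi>)) \<circ> \<sigma>)) (tact N (\<sigma> \<circ> \<pi>) v))"
      by (rule sum.reindex_bij_betw[OF bij_Sym_left, symmetric]) (use s in simp)
    also have "\<dots> = (\<Sum>\<pi>\<in>Sym N. sc (f (rowT (inv \<pi>))) (tact N \<sigma> (tact N \<pi> v)))"
    proof (intro sum.cong refl)
      fix \<pi> assume "\<pi> \<in> Sym N"
      then have p: "\<pi> permutes {..<N}" by simp
      have "inv (\<sigma> \<circ> \<pi>) \<circ> \<sigma> = inv \<pi>"
        unfolding inv_comp[OF s p] by (simp only: o_assoc[symmetric] permutes_inv_o[OF s] comp_id)
      then show "sc (f (rowT (inv (\<sigma> \<circ> \<pi>)) \<circ> \<sigma>)) (tact N (\<sigma> \<circ> \<pi>) v) = sc (f (rowT (inv \<pi>))) (tact N \<sigma> (tact N \<pi> v))"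
        by (simp only: rowT_comp[OF s] tact_comp[OF s p])
    qed
    also have "\<dots> = tact N \<sigma> (\<phi> f)" by (simp only: \<phi>_def tact_sum tact_sc)
    finally show "\<phi> (Mact \<sigma> f) = tact N \<sigma> (\<phi> f)" .
  qed
  have pS: "polytabloid lam N t \<in> (specht lam N :: (_ \<Rightarrow> 'a) set)"
    using Mact_polytabloid_specht[OF permutes_id, where 'a = 'a] by (simp add: Mact_def)
  have "\<phi> (polytabloid lam N t) = ysym N col row False v"
    unfolding \<phi>_def ysym_eq_sum_wgt by (intro sum.cong refl) (simp add: polytabloid_rowT)
  then have "ysym N col row False v \<in> \<phi> ` specht lam N" by (rule image_eqI[OF sym pS])
  moreover have "\<phi> ` specht lam N \<in> {\<phi> ` specht lam N | \<phi>. equivariant k l lam N \<phi>}" using eqv by blast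
  ultimately have "ysym N col row False v \<in> \<Union> {\<phi> ` specht lam N | \<phi>. equivariant k l lam N \<phi>}"
    by (rule UnionI[rotated])
  then show ?thesis unfolding isotypic_def lspan_eq_span by (rule fv.span_base)
qed

text \<open>Values of module maps are spanned by the \<open>\<pi>\<close> applied to eigenvectors,
  and \<open>\<pi>\<close> crosses to the right factor, where all tensors are allowed. The converse
  is \<open>ysym_isotypic\<close>, after expanding the right factor in basis vectors.\<close>

lemma component_eq:
  "component k l p q lam N = fv.span {bmap (RR k l) (RR p q) N (ysym N col row False v) w :: _ \<Rightarrow> 'a::field_char_0 | v w.
     v \<in> tens (RR k l) N \<and> w \<in> tens (RR p q) N}"
  (is "_ = fv.span ?X")
proof -
  let ?U = "RR k l" and ?V = "RR p q"
  interpret D: young N col row False using young_dual young by blast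
  have mmap: "mmap k l N v J = bmap ?U ?V N v (\<delta> J)" if J: "J \<in> seqs ?V N" for v :: "idx list \<Rightarrow> 'a" and J
  proof
    fix m
    have "bmap ?U ?V N v (\<delta> J) m = (\<Sum>I\<in>seqs ?U N. \<Sum>J'\<in>seqs ?V N. if J' = J then v I * Z I J m else 0)"
      unfolding bmap_def by (intro sum.cong refl) (auto simp: \<delta>_def)
    also have "\<dots> = mmap k l N v J m" unfolding mmap_def using J by (simp add: finite_seqs)
    finally show "mmap k l N v J m = bmap ?U ?V N v (\<delta> J) m" ..
  qed
  show ?thesis unfolding component_def lspan_eq_span
  proof (rule antisym)
    show "fv.span {mmap k l N v J | v J. v \<in> isotypic k l lam N \<and> J \<in> seqs ?V N} \<subseteq> fv.span ?X"
    proof (rule fv.span_minimal[OF _ fv.subspace_span], clarify)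
      fix v :: "idx list \<Rightarrow> 'a" and J assume v: "v \<in> isotypic k l lam N" and J: "J \<in> seqs ?V N"
      have base: "bmap ?U ?V N (\<phi> s) (\<delta> J) \<in> fv.span ?X"
        if eq: "equivariant k l lam N \<phi>" and s: "s \<in> specht lam N" for \<phi> s
      proof -
        let ?p = "polytabloid lam N t :: _ \<Rightarrow> 'a" and ?h = "of_int (yscale N col row False) :: 'a"
        have pS: "?p \<in> specht lam N" using Mact_polytabloid_specht[OF permutes_id, where 'a = 'a] by (simp add: Mact_def)
        have gen: "bmap ?U ?V N (\<phi> (Mact \<pi> ?p)) (\<delta> J) \<in> fv.span ?X" if \<pi>: "\<pi> permutes {..<N}" for \<pi>
        proof -
          have pt: "\<phi> ?p \<in> tens ?U N" using eq pS unfolding equivariant_def tensp_eq by blast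
          have "\<phi> (Mact \<pi> ?p) = tact N \<pi> (\<phi> ?p)"
            using eq pS \<pi> unfolding equivariant_def by (simp add: atLeast0LessThan)
          then have "sc ?h (bmap ?U ?V N (\<phi> (Mact \<pi> ?p)) (\<delta> J)) = bmap ?U ?V N (tact N \<pi> (ysym N col row False (\<phi> ?p))) (\<delta> J)"
            unfolding equivariant_polytabloid[OF eq] by (simp add: tact_sc bmap_sc_left)
          also have "\<dots> = bmap ?U ?V N (ysym N col row False (\<phi> ?p)) (tact N (inv \<pi>) (\<delta> J))"
            by (rule bmap_tact_inv[OF \<pi>]) (use J in simp)
          also have "\<dots> \<in> ?X" using pt tact_tens[OF permutes_inv[OF \<pi>] \<delta>_tens[OF J]] by blast
          finally have "sc (inverse ?h) (sc ?h (bmap ?U ?V N (\<phi> (Mact \<pi> ?p)) (\<delta> J))) \<in> fv.span ?X"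
            by (intro fv.span_scale fv.span_base)
          then show ?thesis using D.yscale_pos by simp
        qed
        obtain S r where Sr: "finite S" "S \<subseteq> {Mact \<pi> ?p | \<pi>. \<pi> permutes {..<N}}" "s = (\<Sum>a\<in>S. sc (r a) a)"
          using s unfolding specht_eq fv.span_explicit by blast
        show ?thesis
        proof (cases "S = {}")
          case True
          \<comment> \<open>The zero vector is written as a multiple of \<open>?p\<close>, since
            \<open>equivariant_sum\<close> speaks of nonempty sums.\<close>
          then have "s = sc 0 ?p" using Sr by (simp add: fun_eq_iff pointwise)
          moreover have "\<phi> (sc 0 ?p) = sc 0 (\<phi> ?p)"
            using equivariant_sum[OF eq, of "{()}" "\<lambda>_. ?p" "\<lambda>_. 0"] pS by simp
          ultimately show ?thesis by (simp add: fv.span_zero)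
        next
          case False
          have "a \<in> specht lam N" if "a \<in> S" for a using Sr(2) that Mact_polytabloid_specht by auto
          then have "\<phi> s = (\<Sum>a\<in>S. sc (r a) (\<phi> a))"
            unfolding Sr(3) using equivariant_sum[OF eq Sr(1) _ False, of "\<lambda>a. a" r] by blast
          then show ?thesis
            using gen Sr(2) by (auto simp: bmap_sum_left bmap_sc_left intro!: fv.span_sum fv.span_scale)
        qed
      qed
      have "v \<in> fv.span (\<Union> {\<phi> ` specht lam N | \<phi>. equivariant k l lam N \<phi>})"
        using v unfolding isotypic_def lspan_eq_span .
      then have "bmap ?U ?V N v (\<delta> J) \<in> fv.span ?X"
      proof (rule bmap_span[of _ _ _ "{\<delta> J}"])
        show "\<delta> J \<in> fv.span {\<delta> J :: _ \<Rightarrow> 'a}" by (rule fv.span_base) simp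
        fix a b :: "idx list \<Rightarrow> 'a" assume "a \<in> \<Union> {\<phi> ` specht lam N | \<phi>. equivariant k l lam N \<phi>}" "b \<in> {\<delta> J :: _ \<Rightarrow> 'a}"
        then show "bmap ?U ?V N a b \<in> fv.span ?X" using base by auto
      qed
      then show "mmap k l N v J \<in> fv.span ?X" unfolding mmap[OF J] .
    qed
    show "fv.span ?X \<subseteq> fv.span {mmap k l N v J | v J. v \<in> isotypic k l lam N \<and> J \<in> seqs ?V N}"
    proof (rule fv.span_minimal[OF _ fv.subspace_span], clarify)
      fix v w :: "idx list \<Rightarrow> 'a" assume v: "v \<in> tens ?U N" and w: "w \<in> tens ?V N"
      have "bmap ?U ?V N (ysym N col row False v) w = (\<Sum>J\<in>seqs ?V N. sc (w J) (mmap k l N (ysym N col row False v) J))"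
        by (subst tens_expand[OF finite_RR w]) (simp add: bmap_sum_right bmap_sc_right mmap)
      moreover have "mmap k l N (ysym N col row False v) J \<in> fv.span {mmap k l N v J | v J. v \<in> isotypic k l lam N \<and> J \<in> seqs ?V N}"
        if "J \<in> seqs ?V N" for J
        using that ysym_isotypic[OF v] by (intro fv.span_base) blast
      ultimately show "bmap ?U ?V N (ysym N col row False v) w \<in> fv.span {mmap k l N v J | v J. v \<in> isotypic k l lam N \<and> J \<in> seqs ?V N}"
        by (auto intro!: fv.span_sum fv.span_scale)
    qed
  qed
qed

end

lemma basis_family_cong:
  assumes "\<And>a. a \<in> A \<Longrightarrow> f a = g a" "A = B" "V = V'"
  shows "basis_family f A V \<longleftrightarrow> basis_family g B V'"
proof -
  have "(\<lambda>m. \<Sum>a\<in>A. c a * f a m) = (\<lambda>m. \<Sum>a\<in>A. c a * g a m)" for c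
    by (intro ext sum.cong) (simp_all add: assms(1))
  moreover have "f ` A = g ` A" using assms(1) by (rule image_cong[OF refl])
  ultimately show ?thesis unfolding basis_family_def assms(2,3) by simp
qed

theorem theorem1p4:
  fixes k l p q N :: nat and lam :: "nat list" and t :: "nat \<times> nat \<Rightarrow> nat"
  assumes "is_partition lam N"
    and "standard_tableau lam N t"
  shows "basis_family (\<lambda>(I, J). Pt lam N t I J :: (idx \<times> idx) multiset \<Rightarrow> 'a::field_char_0)
           {(I, J). I \<in> seqs (RR k l) N \<and> semistd lam t I \<and> J \<in> seqs (RR p q) N \<and> semistd lam t J}
           (component k l p q lam N)
       \<and> basis_family (\<lambda>(I, J). Ptil lam N t I J :: (idx \<times> idx) multiset \<Rightarrow> 'a::field_char_0)
           {(I, J). I \<in> seqs (RR k l) N \<and> semistd lam t I \<and> J \<in> seqs (RR p q) N \<and> semistd lam t J}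
           (component k l p q lam N)"
proof -
  interpret T: tab lam N t using assms by unfold_locales (auto simp: standard_tableau_def)
  interpret Y: young N T.row T.col True by (rule T.young)
  interpret D: young N T.col T.row False using young_dual T.young by blast
  let ?U = "RR k l" and ?V = "RR p q"
  have dual: "sstd N T.col T.row False I \<longleftrightarrow> sstd N T.row T.col True I" for I
    using sstd_dual[of N T.col T.row True I] by simp
  show ?thesis
  proof
    \<comment> \<open>\<open>component_eq\<close> describes the component by the symmetrizer with
      the column factor on the left; \<open>bmap_ysym_span_dual_eq\<close> passes to the order of
      \<open>Pt\<close>.\<close>
    show "basis_family (\<lambda>(I, J). Pt lam N t I J :: (idx \<times> idx) multiset \<Rightarrow> 'a)
           {(I, J). I \<in> seqs ?U N \<and> semistd lam t I \<and> J \<in> seqs ?V N \<and> semistd lam t J}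
           (component k l p q lam N)"
      by (rule basis_family_cong[THEN iffD2, OF _ _ _ Y.basis_family_bmap[OF finite_RR[of k l] finite_RR[of p q]]])
        (auto simp: T.Pt_eq[of ?U ?V] T.semistd_iff T.component_eq Y.bmap_ysym_span_dual_eq)
    show "basis_family (\<lambda>(I, J). Ptil lam N t I J :: (idx \<times> idx) multiset \<Rightarrow> 'a)
           {(I, J). I \<in> seqs ?U N \<and> semistd lam t I \<and> J \<in> seqs ?V N \<and> semistd lam t J}
           (component k l p q lam N)"
      by (rule basis_family_cong[THEN iffD2, OF _ _ _ D.basis_family_bmap[OF finite_RR[of k l] finite_RR[of p q]]])
        (auto simp: T.Ptil_eq[of ?U ?V] T.semistd_iff dual T.component_eq)
  qed
qed


end
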